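(* Let $r\in\mathbb{N}$, $-1<x,y<1$ and $0\le z\le1$. Then $\mathfrak{K}_r(\xi;x,y,z;\omega_1,\omega_2)$ is meromorphic in $\xi$ and holomorphic at $\xi=0$; write its Taylor expansion as $\mathfrak{K}_r(\xi;x,y,z;\omega_1,\omega_2)=\sum_{k\ge1}\frac{\mathcal{K}_{k,r}(x,y,z;\omega_1,\omega_2)}{k!}\xi^{k-1}$. Let $k\in\mathbb{N}$; if $k=2$ and $z\in\{0,1\}$ assume $(x,y)\ne(0,0)$; if $k=1$ assume $0<z<1$ and $y+rz\notin\mathbb{Z}$. Then $$\mathcal{K}_{k,r}(x,y,z;\omega_1,\omega_2)=-k!\Bigl(\frac{\pi i}{\omega_2}\Bigr)^r\mathcal{G}^{\langle r\rangle}_k(x,y,z;\omega_1,\omega_2),$$ where, writing $T(m,n)=\frac{(-1)^{rn}}{(\sinh(m\pi i/\tau))^r}\frac{e^{2\pi i(m(x+r(z-1/2)/\tau)+n(y+r(z-1/2)))}}{(m\omega_1+n\omega_2)^k}$: if $k\ge3$, or $k=2$ and $0<z<1$, then $\mathcal{G}^{\langle r\rangle}_k=\sum_{(m,n)\in\mathbb{Z}^2,\,m\ne0}T(m,n)$, and this series converges absolutely and uniformly; in the remaining cases ($k=1$, or $k=2$ with $z\in\{0,1\}$) $\mathcal{G}^{\langle r\rangle}_k=\operatorname{Lim}_{M,N}\sum_{-M\le m\le M,\,-N\le n\le N,\,m\ne0}T(m,n)$, and this limit exists and does not depend on which of the three meanings of $\operatorname{Lim}_{M,N}$ is used.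
   Context: Let $\omega_1,\omega_2\in\mathbb{C}\setminus\{0\}$ with $\tau=\omega_2/\omega_1$, $\Im\tau>0$. Let $\theta(z;\tau)=-i\sum_{n\in\mathbb{Z}}\exp(\pi i(n+\tfrac12)^2\tau+2\pi i(n+\tfrac12)z+\pi in)$, and $\theta'$ its derivative in $z$. For $-1<x,y<1$, $(x,y)\ne(0,0)$, let $\mathfrak{E}(\xi;x,y;\omega_1,\omega_2)=\frac{e^{2\pi ix\xi/\omega_1}}{\omega_1}\frac{\theta'(0;\tau)\theta(\xi/\omega_1+x\tau-y;\tau)}{\theta(\xi/\omega_1;\tau)\theta(x\tau-y;\tau)}$, and $\mathfrak{E}(\xi;0,0;\omega_1,\omega_2)=\frac{1}{\omega_1}\frac{\theta'(\xi/\omega_1;\tau)}{\theta(\xi/\omega_1;\tau)}+\frac{2\pi i\xi}{\omega_1\omega_2}$. Let $\mathfrak{F}(\xi;z;\omega_2)=\frac{2\pi i}{\omega_2}\frac{e^{2\pi i\xi z/\omega_2}}{e^{2\pi i\xi/\omega_2}-1}$ and $\mathfrak{D}_r(\xi)=\mathfrak{E}(\xi;x,y;\omega_1,\omega_2)\mathfrak{F}(\xi;z;\omega_2)^r$. For $(x,y,z)\ne(0,0,1)$ and $\xi\notin\omega_2\mathbb{Z}$ define $\mathfrak{K}_r(\xi;x,y,z;\omega_1,\omega_2)=\operatorname{Res}_{\eta=0}\bigl(\mathfrak{D}_r(\xi)\eta^{-1}-\mathfrak{D}_r(\eta)\mathfrak{F}(\xi-\eta;\{y+rz\};\omega_2)\bigr)$,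 and $\mathfrak{K}_r(\xi;0,0,1;\omega_1,\omega_2)=(-1)^{r+1}\mathfrak{K}_r(-\xi;0,0,0;\omega_1,\omega_2)$. Here $\{t\}$ is the fractional part. $\operatorname{Lim}_{M,N}$ denotes any one of $\lim_{M\to\infty}\lim_{N\to\infty}$, $\lim_{N\to\infty}\lim_{M\to\infty}$, or the joint limit along sequences $M_j,N_j\to\infty$. *)

theory Defs
  imports "HOL-Complex_Analysis.Complex_Analysis"
begin

definition theta :: "complex \<Rightarrow> complex \<Rightarrow> complex" where
  "theta z \<tau> = - \<i> * (\<Sum>\<^sub>\<infinity>n\<in>(UNIV :: int set).
     exp (of_real pi * \<i> * (of_int n + 1/2)\<^sup>2 * \<tau>
          + 2 * of_real pi * \<i> * (of_int n + 1/2) * z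
          + of_real pi * \<i> * of_int n))"

definition theta' :: "complex \<Rightarrow> complex \<Rightarrow> complex" where
  "theta' z \<tau> = deriv (\<lambda>w. theta w \<tau>) z"

definition frakE :: "complex \<Rightarrow> real \<Rightarrow> real \<Rightarrow> complex \<Rightarrow> complex \<Rightarrow> complex" where
  "frakE \<xi> x y \<omega>1 \<omega>2 = (let \<tau> = \<omega>2 / \<omega>1 in
     if (x, y) = (0, 0)
     then 1 / \<omega>1 * (theta' (\<xi> / \<omega>1) \<tau> / theta (\<xi> / \<omega>1) \<tau>)
            + 2 * of_real pi * \<i> * \<xi> / (\<omega>1 * \<omega>2)
     else exp (2 * of_real pi * \<i> * of_real x * \<xi> / \<omega>1) / \<omega>1
            * (theta' 0 \<tau> * theta (\<xi> / \<omega>1 + of_real x * \<tau> - of_real y) \<tau>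
               / (theta (\<xi> / \<omega>1) \<tau> * theta (of_real x * \<tau> - of_real y) \<tau>)))"

definition frakF :: "complex \<Rightarrow> real \<Rightarrow> complex \<Rightarrow> complex" where
  "frakF \<xi> z \<omega>2 = 2 * of_real pi * \<i> / \<omega>2
     * (exp (2 * of_real pi * \<i> * \<xi> * of_real z / \<omega>2) / (exp (2 * of_real pi * \<i> * \<xi> / \<omega>2) - 1))"

definition frakD :: "nat \<Rightarrow> complex \<Rightarrow> real \<Rightarrow> real \<Rightarrow> real \<Rightarrow> complex \<Rightarrow> complex \<Rightarrow> complex" where
  "frakD r \<xi> x y z \<omega>1 \<omega>2 = frakE \<xi> x y \<omega>1 \<omega>2 * frakF \<xi> z \<omega>2 ^ r"

definition frakK_res ::
  "nat \<Rightarrow> complex \<Rightarrow> real \<Rightarrow> real \<Rightarrow> real \<Rightarrow> complex \<Rightarrow> complex \<Rightarrow> complex" where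
  "frakK_res r \<xi> x y z \<omega>1 \<omega>2 =
     residue (\<lambda>\<eta>. frakD r \<xi> x y z \<omega>1 \<omega>2 / \<eta>
                 - frakD r \<eta> x y z \<omega>1 \<omega>2 * frakF (\<xi> - \<eta>) (frac (y + real r * z)) \<omega>2) 0"

text \<open>The values of \<open>frakK\<close> on \<open>\<int>\<omega>1 + \<int>\<omega>2\<close> carry no meaning: the formula is undefined on
  \<open>\<int>\<omega>2\<close>, and \<open>frakD\<close> has poles at the remaining lattice points.  In particular \<open>frakK\<close> is only
  defined near \<open>0\<close>, not at \<open>0\<close>; holomorphy and Taylor expansion there concern \<open>frakK_ext\<close>,
  which fills in the removable singularities.\<close>

definition frakK ::
  "nat \<Rightarrow> complex \<Rightarrow> real \<Rightarrow> real \<Rightarrow> real \<Rightarrow> complex \<Rightarrow> complex \<Rightarrow> complex" where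
  "frakK r \<xi> x y z \<omega>1 \<omega>2 =
     (if (x, y, z) = (0, 0, 1) then (-1) ^ (r + 1) * frakK_res r (- \<xi>) 0 0 0 \<omega>1 \<omega>2
      else frakK_res r \<xi> x y z \<omega>1 \<omega>2)"

definition frakK_ext ::
  "nat \<Rightarrow> real \<Rightarrow> real \<Rightarrow> real \<Rightarrow> complex \<Rightarrow> complex \<Rightarrow> complex \<Rightarrow> complex" where
  "frakK_ext r x y z \<omega>1 \<omega>2 = remove_sings (\<lambda>\<xi>. frakK r \<xi> x y z \<omega>1 \<omega>2)"

text \<open>\<open>calK k r x y z \<omega>1 \<omega>2 / k!\<close> is the coefficient of \<open>\<xi> ^ (k - 1)\<close>; only \<open>k \<ge> 1\<close> is meant.\<close>

definition calK ::
  "nat \<Rightarrow> nat \<Rightarrow> real \<Rightarrow> real \<Rightarrow> real \<Rightarrow> complex \<Rightarrow> complex \<Rightarrow> complex" where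
  "calK k r x y z \<omega>1 \<omega>2 = fact k * fps_nth (fps_expansion (frakK_ext r x y z \<omega>1 \<omega>2) 0) (k - 1)"

definition termT ::
  "nat \<Rightarrow> nat \<Rightarrow> real \<Rightarrow> real \<Rightarrow> real \<Rightarrow> complex \<Rightarrow> complex \<Rightarrow> int \<Rightarrow> int \<Rightarrow> complex" where
  "termT r k x y z \<omega>1 \<omega>2 m n = (let \<tau> = \<omega>2 / \<omega>1 in
     (-1) powi (int r * n) / sinh (of_int m * of_real pi * \<i> / \<tau>) ^ r
     * (exp (2 * of_real pi * \<i> *
            (of_int m * (of_real x + of_nat r * (of_real z - 1/2) / \<tau>)
             + of_int n * (of_real y + of_nat r * (of_real z - 1/2))))
        / (of_int m * \<omega>1 + of_int n * \<omega>2) ^ k))"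

definition index_set :: "(int \<times> int) set" where
  "index_set = {(m, n). m \<noteq> 0}"

definition box_sum ::
  "nat \<Rightarrow> nat \<Rightarrow> real \<Rightarrow> real \<Rightarrow> real \<Rightarrow> complex \<Rightarrow> complex \<Rightarrow> nat \<Rightarrow> nat \<Rightarrow> complex" where
  "box_sum r k x y z \<omega>1 \<omega>2 M N =
     (\<Sum>(m, n)\<in>index_set \<inter> {- int M..int M} \<times> {- int N..int N}. termT r k x y z \<omega>1 \<omega>2 m n)"

definition has_iterated_limit :: "(nat \<Rightarrow> nat \<Rightarrow> complex) \<Rightarrow> complex \<Rightarrow> bool" where
  "has_iterated_limit S L \<longleftrightarrow> (\<exists>s. (\<forall>M. (\<lambda>N. S M N) \<longlonglongrightarrow> s M) \<and> s \<longlonglongrightarrow> L)"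

definition has_joint_limit :: "(nat \<Rightarrow> nat \<Rightarrow> complex) \<Rightarrow> complex \<Rightarrow> bool" where
  "has_joint_limit S L \<longleftrightarrow>
     (\<forall>Ms Ns. filterlim Ms at_top sequentially \<longrightarrow> filterlim Ns at_top sequentially \<longrightarrow>
        (\<lambda>j. S (Ms j) (Ns j)) \<longlonglongrightarrow> L)"

text \<open>All three meanings of the double limit exist and have the same value \<open>L\<close>.\<close>

definition has_Lim :: "(nat \<Rightarrow> nat \<Rightarrow> complex) \<Rightarrow> complex \<Rightarrow> bool" where
  "has_Lim S L \<longleftrightarrow> has_iterated_limit S L \<and> has_iterated_limit (\<lambda>N M. S M N) L \<and> has_joint_limit S L"

definition abs_case :: "nat \<Rightarrow> real \<Rightarrow> bool" where
  "abs_case k z \<longleftrightarrow> k \<ge> 3 \<or> k = 2 \<and> 0 < z \<and> z < 1"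

text \<open>In the conditionally convergent cases the definition picks one of the three readings;
  that the others agree with it is asserted separately, through \<open>has_Lim\<close>.\<close>

definition calG ::
  "nat \<Rightarrow> nat \<Rightarrow> real \<Rightarrow> real \<Rightarrow> real \<Rightarrow> complex \<Rightarrow> complex \<Rightarrow> complex" where
  "calG r k x y z \<omega>1 \<omega>2 =
     (if abs_case k z then \<Sum>\<^sub>\<infinity>(m, n)\<in>index_set. termT r k x y z \<omega>1 \<omega>2 m n
      else lim (\<lambda>M. lim (\<lambda>N. box_sum r k x y z \<omega>1 \<omega>2 M N)))"

end

theory Submission
  imports Defs
begin

text \<open>
  Let \<open>D = E F\<^sup>r\<close>.  The residue defining \<open>K\<close> subtracts from \<open>D\<close> the combination \<open>P\<close> of derivatives
  of \<open>F(\<cdot>; {y + r z})\<close> that has the same principal part at \<open>0\<close>.  Translation by \<open>\<omega>2\<close> multiplies \<open>D\<close>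
  and \<open>P\<close> by the same constant, so \<open>K = D - P\<close> has no poles on \<open>\<int>\<omega>2\<close>, and at the other lattice
  points the residue of \<open>K(\<xi>)/\<xi>\<^sup>k\<close> is \<open>(\<pi>i/\<omega>2)\<^sup>r T(m,n)\<close>.  Integrating \<open>K(\<xi>)/\<xi>\<^sup>k\<close> over the boundary of
  the parallelogram \<open>\<bar>a\<bar> \<le> M + 1/2\<close>, \<open>\<bar>b\<bar> \<le> N + 1/2\<close>, where \<open>\<xi> = a\<omega>1 + b\<omega>2\<close>, therefore
  expresses the Taylor coefficient at \<open>0\<close> plus the box sum.  On these contours \<open>E\<close> grows at most
  linearly in \<open>a\<close> and \<open>F\<close> decays exponentially in \<open>a\<close> unless \<open>z \<in> {0,1}\<close>, which makes the integral
  \<open>O(1/M + 1/N)\<close> for \<open>k \<ge> 2\<close>, and \<open>O(1/N)\<close> for \<open>k = 1\<close> and \<open>M = N\<close>; for \<open>k = 1\<close> the existence of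
  the double limit follows by summation by parts in \<open>n\<close>.  That \<open>\<theta>\<close> vanishes only on the lattice,
  to first order, comes from the argument principle on a period cell.
\<close>

subsection \<open>Parallelogram contours\<close>

text \<open>The size of \<open>K\<close> on the contours dictates the case split. The multipliers of
  \<open>frakE\<close> under the lattice have modulus 1, but for \<open>x = y = 0\<close> a
  translation by \<omega>1 also adds a constant, and this alone makes \<open>frakE\<close> grow
  linearly. When k = 2 and z is 0 or 1 no decay of \<open>frakF\<close> compensates, so there
  \<open>(x, y) \<noteq> (0, 0)\<close> is assumed. For k \<ge> 2 the integrand is at most a
  constant over a^2 + b^2; along an infinite line at height h this integrates to a multiple of 1/h,
  so that M and N may tend to infinity independently. For k = 1 the factor 1/|\<xi>| is not
  integrable along the sides a = const, so the estimate must tie N to M, and the contour identifies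
  the limit on squares only. The condition that y + rz is not an integer then enters twice: it gives
  0 < \<beta> < 1 for \<beta> = {y + rz}, so that \<open>P\<close> decays in both directions of a,
  and it gives q \<noteq> 1 for the multiplier q = exp(2 \<pi> i \<beta>) of \<open>K\<close> along
  \<omega>2; summation by parts divides by q - 1.\<close>

lemma half_not_Int: "a \<in> \<int> \<Longrightarrow> a - 1/2 \<notin> (\<int> :: real set)"
proof
  assume "a \<in> \<int>" "a - 1/2 \<in> \<int>"
  then obtain j k where "a = of_int j" "a - 1/2 = of_int k" by (auto elim!: Ints_cases)
  then have "of_int (2 * j - 2 * k) = (of_int 1 :: real)" by simp
  then have "2 * j - 2 * k = 1" by (simp only: of_int_eq_iff)
  then show False by presburger
qed

lemma abs_ge_half: "a - 1/2 \<in> \<int> \<Longrightarrow> 1/2 \<le> \<bar>a :: real\<bar>"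
proof -
  assume "a - 1/2 \<in> \<int>"
  then obtain k where "a = of_int k + 1/2" by (auto elim!: Ints_cases simp: algebra_simps)
  then show ?thesis by (cases "k \<ge> 0") auto
qed

lemma minus_half_Int: "a - 1/2 \<in> (\<int> :: real set) \<Longrightarrow> - a - 1/2 \<in> \<int>"
proof -
  assume a: "a - 1/2 \<in> \<int>"
  have e: "- a - 1/2 = - (a - 1/2) - 1" by simp
  show ?thesis unfolding e by (intro Ints_diff Ints_minus a Ints_1)
qed

locale period_pair =
  fixes \<omega>1 \<omega>2 :: complex
  assumes Im_ratio: "Im (\<omega>2 / \<omega>1) > 0"
begin

lemma nz1: "\<omega>1 \<noteq> 0" and nz2: "\<omega>2 \<noteq> 0"
  using Im_ratio by auto

definition pt :: "real \<Rightarrow> real \<Rightarrow> complex" where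
  "pt a b = of_real a * \<omega>1 + of_real b * \<omega>2"

text \<open>After division by \<omega>1 the basis becomes 1, \<tau>, and since \<tau> is not real
  the imaginary part alone yields the coordinate along \<omega>2.\<close>

definition cB :: "complex \<Rightarrow> real" where
  "cB \<xi> = Im (\<xi> / \<omega>1) / Im (\<omega>2 / \<omega>1)"

definition cA :: "complex \<Rightarrow> real" where
  "cA \<xi> = Re (\<xi> / \<omega>1) - cB \<xi> * Re (\<omega>2 / \<omega>1)"

lemma pt_div: "pt a b / \<omega>1 = of_real a + of_real b * (\<omega>2 / \<omega>1)"
  using nz1 by (simp add: pt_def field_simps)

lemma cB_pt [simp]: "cB (pt a b) = b"
  unfolding cB_def pt_div using Im_ratio by (simp del: times_divide_eq_right)

lemma cA_pt [simp]: "cA (pt a b) = a"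
  unfolding cA_def cB_pt pt_div by (simp del: times_divide_eq_right)

lemma pt_coords [simp]: "pt (cA \<xi>) (cB \<xi>) = \<xi>"
proof -
  have "pt (cA \<xi>) (cB \<xi>) / \<omega>1 = \<xi> / \<omega>1"
    unfolding pt_div using Im_ratio
    by (simp add: complex_eq_iff cA_def cB_def Re_complex_of_real del: times_divide_eq_right of_real_divide)
  then show ?thesis using nz1 by simp
qed

lemma pt_inj: "pt a b = pt a' b' \<longleftrightarrow> a = a' \<and> b = b'"
  by (metis cA_pt cB_pt)

lemma pt_add: "pt a b + pt a' b' = pt (a + a') (b + b')"
  and pt_scale: "of_real s * pt a b = pt (s * a) (s * b)"
  by (simp_all add: pt_def algebra_simps)

lemma continuous_cB [continuous_intros]: "continuous_on S f \<Longrightarrow> continuous_on S (\<lambda>x. cB (f x))"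
  unfolding cB_def using nz1 Im_ratio by (intro continuous_intros) auto

lemma continuous_cA [continuous_intros]: "continuous_on S f \<Longrightarrow> continuous_on S (\<lambda>x. cA (f x))"
  unfolding cA_def using nz1 by (intro continuous_intros) auto

lemma continuous_pt [continuous_intros]:
  "continuous_on S f \<Longrightarrow> continuous_on S g \<Longrightarrow> continuous_on S (\<lambda>x. pt (f x) (g x))"
  unfolding pt_def by (intro continuous_intros) auto

lemma cA_add: "cA (\<xi> + \<eta>) = cA \<xi> + cA \<eta>" and cB_add: "cB (\<xi> + \<eta>) = cB \<xi> + cB \<eta>"
  by (simp_all add: cA_def cB_def add_divide_distrib algebra_simps)

lemma cA_scale: "cA (of_real s * \<xi>) = s * cA \<xi>" and cB_scale: "cB (of_real s * \<xi>) = s * cB \<xi>"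
  by (metis cA_pt cB_pt pt_coords pt_scale)+

text \<open>A form of the equivalence of norms on the plane: the imaginary part controls
  \<open>b\<close>, and then \<open>a\<close> is what remains. The lower bounds for |\<xi>| and for
  distances between lattice points go back to this \<open>c\<close>.\<close>

lemma norm_pt_ge:
  obtains c where "c > 0" "\<And>a b. c * (\<bar>a\<bar> + \<bar>b\<bar>) \<le> norm (pt a b)"
proof -
  \<comment> \<open>With w = \<open>pt a b / \<omega>1\<close> the estimates |b| \<le> |w| / Im
    \<tau> and |a| \<le> |w| + |b| |\<tau>| add up to at most d |w|.\<close>
  define d where "d = (2 + norm (\<omega>2 / \<omega>1)) / Im (\<omega>2 / \<omega>1) + 1"
  have d: "d > 0" using Im_ratio by (auto simp: d_def intro!: add_nonneg_pos divide_nonneg_pos)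
  have *: "\<bar>a\<bar> + \<bar>b\<bar> \<le> d * norm (pt a b / \<omega>1)" for a b
  proof -
    let ?w = "pt a b / \<omega>1" and ?t = "\<omega>2 / \<omega>1"
    have b: "\<bar>b\<bar> * Im ?t \<le> norm ?w"
      using abs_Im_le_cmod[of ?w] Im_ratio unfolding pt_div
      by (simp add: abs_mult del: times_divide_eq_right)
    then have b': "\<bar>b\<bar> \<le> norm ?w / Im ?t" using Im_ratio by (simp add: field_simps)
    have "of_real a = ?w - of_real b * ?t" unfolding pt_div by simp
    then have "\<bar>a\<bar> = norm (?w - of_real b * ?t)" by (metis norm_of_real)
    also have "\<dots> \<le> norm ?w + \<bar>b\<bar> * norm ?t"
      by (metis norm_mult norm_of_real norm_triangle_ineq4)
    also have "\<dots> \<le> norm ?w + norm ?w / Im ?t * norm ?t"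
      using b' by (intro add_left_mono mult_right_mono) auto
    finally have "\<bar>a\<bar> + \<bar>b\<bar> \<le> norm ?w + norm ?w / Im ?t * norm ?t + norm ?w / Im ?t" using b' by simp
    also have "\<dots> \<le> d * norm ?w"
      using Im_ratio by (simp add: d_def field_simps)
    finally show ?thesis .
  qed
  have "1 / (d / norm \<omega>1) * (\<bar>a\<bar> + \<bar>b\<bar>) \<le> norm (pt a b)" for a b
    using *[of a b] d nz1 by (simp add: norm_divide field_simps)
  moreover have "1 / (d / norm \<omega>1) > 0" using d nz1 by simp
  ultimately show ?thesis using that by blast
qed

definition par :: "real \<Rightarrow> real \<Rightarrow> real \<Rightarrow> real \<Rightarrow> real \<Rightarrow> complex" where
  "par a a' b b' = linepath (pt a b) (pt a' b) +++ linepath (pt a' b) (pt a' b') +++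
     linepath (pt a' b') (pt a b') +++ linepath (pt a b') (pt a b)"

definition opar :: "real \<Rightarrow> real \<Rightarrow> real \<Rightarrow> real \<Rightarrow> complex set" where
  "opar a a' b b' = {\<xi>. a < cA \<xi> \<and> cA \<xi> < a' \<and> b < cB \<xi> \<and> cB \<xi> < b'}"

lemma valid_par [simp]: "valid_path (par a a' b b')"
  and par_loop [simp]: "pathfinish (par a a' b b') = pathstart (par a a' b b')"
  by (auto simp: par_def)

lemma coords_segment:
  assumes "\<xi> \<in> closed_segment (pt a b) (pt a' b')"
  obtains s where "0 \<le> s" "s \<le> 1" "cA \<xi> = (1 - s) * a + s * a'" "cB \<xi> = (1 - s) * b + s * b'"
proof -
  obtain s where s: "0 \<le> s" "s \<le> 1" "\<xi> = (1 - s) *\<^sub>R pt a b + s *\<^sub>R pt a' b'"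
    using assms by (auto simp: in_segment)
  then have "\<xi> = pt ((1 - s) * a + s * a') ((1 - s) * b + s * b')"
    by (simp only: pt_scale scaleR_conv_of_real pt_add)
  then show ?thesis using that[of s] s by simp
qed

lemma coords_segment1:
  assumes "\<xi> \<in> closed_segment (pt a b) (pt a' b)"
  shows "cB \<xi> = b" "cA \<xi> \<in> closed_segment a a'"
proof -
  obtain s where s: "0 \<le> s" "s \<le> 1" "cA \<xi> = (1 - s) * a + s * a'" "cB \<xi> = (1 - s) * b + s * b"
    using coords_segment[OF assms] by metis
  show "cB \<xi> = b" using s by (simp add: algebra_simps)
  show "cA \<xi> \<in> closed_segment a a'" using s by (auto simp: in_segment)
qed

lemma coords_segment2:
  assumes "\<xi> \<in> closed_segment (pt a b) (pt a b')"
  shows "cA \<xi> = a" "cB \<xi> \<in> closed_segment b b'"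
proof -
  obtain s where s: "0 \<le> s" "s \<le> 1" "cA \<xi> = (1 - s) * a + s * a" "cB \<xi> = (1 - s) * b + s * b'"
    using coords_segment[OF assms] by metis
  show "cA \<xi> = a" using s by (simp add: algebra_simps)
  show "cB \<xi> \<in> closed_segment b b'" using s by (auto simp: in_segment)
qed

lemma path_image_par:
  assumes "a \<le> a'" "b \<le> b'" "\<xi> \<in> path_image (par a a' b b')"
  shows "a \<le> cA \<xi>" "cA \<xi> \<le> a'" "b \<le> cB \<xi>" "cB \<xi> \<le> b'"
    "cA \<xi> \<in> {a, a'} \<or> cB \<xi> \<in> {b, b'}"
proof -
  have "cB \<xi> = b \<and> cA \<xi> \<in> {a..a'} \<or> cB \<xi> = b' \<and> cA \<xi> \<in> {a..a'} \<or>
      cA \<xi> = a \<and> cB \<xi> \<in> {b..b'} \<or> cA \<xi> = a' \<and> cB \<xi> \<in> {b..b'}"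
    using assms(3) coords_segment1[of \<xi> a b a'] coords_segment1[of \<xi> a b' a']
      coords_segment2[of \<xi> a' b b'] coords_segment2[of \<xi> a b b']
    unfolding par_def
    by (auto simp: path_image_join closed_segment_eq_real_ivl1[OF assms(1)]
      closed_segment_eq_real_ivl1[OF assms(2)] closed_segment_commute[of "pt a b'" "pt a b"]
      closed_segment_commute[of "pt a b'" "pt a' b'"])
  then show "a \<le> cA \<xi>" "cA \<xi> \<le> a'" "b \<le> cB \<xi>" "cB \<xi> \<le> b'"
    "cA \<xi> \<in> {a, a'} \<or> cB \<xi> \<in> {b, b'}"
    using assms(1,2) by auto
qed

lemma linear_cA: "linear cA" and linear_cB: "linear cB"
  by (auto intro!: linearI simp: cA_add cB_add cA_scale cB_scale scaleR_conv_of_real)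

lemma convex_opar: "convex (opar a a' b b')"
proof -
  note linear_cA linear_cB
  then have "convex (cA -` {a<..<a'} \<inter> cB -` {b<..<b'})"
    by (intro convex_Int convex_linear_vimage) auto
  also have "cA -` {a<..<a'} \<inter> cB -` {b<..<b'} = opar a a' b b'"
    by (auto simp: opar_def)
  finally show ?thesis .
qed

lemma open_opar: "open (opar a a' b b')"
  unfolding opar_def by (intro open_Collect_conj open_Collect_less continuous_intros)

lemma opar_path_disjoint:
  assumes "a < a'" "b < b'"
  shows "opar a a' b b' \<inter> path_image (par a a' b b') = {}"
  using path_image_par[OF less_imp_le[OF assms(1)] less_imp_le[OF assms(2)]]
  by (fastforce simp: opar_def)

text \<open>The winding number is constant on the connected interior, so a single well-placed point
  \<open>q\<close> settles it; there the formula for triangles is available.\<close>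

lemma winding_number_par:
  assumes "a < a'" "b < b'" "p \<in> opar a a' b b'"
  shows "winding_number (par a a' b b') p = 1"
proof -
  define z1 z2 z3 z4 where "z1 = pt a b" and "z2 = pt a' b" and "z3 = pt a' b'" and "z4 = pt a b'"
  note zd = z1_def z2_def z3_def z4_def
  \<comment> \<open>The centroid of the triangle \<open>z1\<close>, \<open>z2\<close>,
    \<open>z3\<close>.\<close>
  define q where "q = pt (a + 2/3 * (a' - a)) (b + 1/3 * (b' - b))"
  have lina: "a < a + 2/3 * (a' - a)" "a + 2/3 * (a' - a) < a'" using assms by (auto simp: field_simps)
  have linb: "b < b + 1/3 * (b' - b)" "b + 1/3 * (b' - b) < b'" using assms by (auto simp: field_simps)
  have q: "q \<in> opar a a' b b'" using lina linb by (simp add: opar_def q_def)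
  have nb: "q \<notin> path_image (par a a' b b')" using q opar_path_disjoint[OF assms(1,2)] by auto
  then have n: "q \<notin> closed_segment z1 z2" "q \<notin> closed_segment z2 z3"
     "q \<notin> closed_segment z3 z4" "q \<notin> closed_segment z4 z1"
    by (auto simp: par_def path_image_join zd)
  have n13: "q \<notin> closed_segment z1 z3"
  proof
    assume "q \<in> closed_segment z1 z3"
    then obtain s where s: "a + 2/3 * (a' - a) = (1 - s) * a + s * a'" "b + 1/3 * (b' - b) = (1 - s) * b + s * b'"
      unfolding zd by (rule coords_segment) (auto simp: q_def)
    from s(1) have "(s - 2/3) * (a' - a) = 0" by (simp add: algebra_simps)
    moreover from s(2) have "(s - 1/3) * (b' - b) = 0" by (simp add: algebra_simps)
    ultimately show False using assms by simp
  qed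
  then have n31: "q \<notin> closed_segment z3 z1" by (simp add: closed_segment_commute)
  note [simp] = n n13 n31
  \<comment> \<open>cut along the diagonal: \<open>q\<close> lies inside one triangle and outside the other\<close>
  have w1: "winding_number (linepath z1 z2 +++ linepath z2 z3 +++ linepath z3 z1) q = 1"
  proof -
    \<comment> \<open>This sign decides between 1 and -1 in the triangle formula. It is positive
      because \<omega>1, \<omega>2 is a positively oriented basis.\<close>
    have imp: "0 < Im ((z2 - z1) * cnj (z2 - q))"
    proof -
      have e: "z2 - z1 = of_real (a' - a) * \<omega>1"
        by (simp add: zd pt_def algebra_simps)
      have f: "z2 - q = of_real (1/3 * (a' - a)) * \<omega>1 - of_real (1/3 * (b' - b)) * \<omega>2"
        by (simp add: zd q_def pt_def field_simps)
      have "Im (\<omega>1 * cnj \<omega>2) = - Im (\<omega>2 / \<omega>1) * (norm \<omega>1)\<^sup>2"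
        using nz1 by (simp add: Im_divide cmod_power2)
      then have n: "Im (\<omega>1 * cnj \<omega>2) < 0" using Im_ratio nz1 by (simp add: mult_pos_pos)
      have m: "Im (\<omega>1 * cnj \<omega>1) = 0" by (simp add: complex_mult_cnj)
      have "(z2 - z1) * cnj (z2 - q) = of_real ((a' - a) * (1/3 * (a' - a))) * (\<omega>1 * cnj \<omega>1)
          - of_real ((a' - a) * (1/3 * (b' - b))) * (\<omega>1 * cnj \<omega>2)"
        unfolding e f by (simp add: algebra_simps)
      then have "Im ((z2 - z1) * cnj (z2 - q)) = - ((a' - a) * (1/3 * (b' - b))) * Im (\<omega>1 * cnj \<omega>2)"
        using m by (simp only: minus_complex.sel Im_complex_of_real times_complex.sel Re_complex_of_real) auto
      also have "\<dots> > 0" using n assms by (simp add: mult_pos_neg)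
      finally show ?thesis .
    qed
    have "q \<in> interior (convex hull {z1, z2, z3})"
    proof -
      have "q = (1/3) *\<^sub>R z1 + (1/3) *\<^sub>R z2 + (1/3) *\<^sub>R z3"
        by (simp add: q_def zd scaleR_conv_of_real pt_scale pt_add flip: of_real_divide)
          (simp add: pt_def field_simps)
      moreover have "\<dots> \<in> convex hull {z1, z2, z3}"
        unfolding convex_hull_3 mem_Collect_eq
        by (rule exI[of _ "1/3"], rule exI[of _ "1/3"], rule exI[of _ "1/3"]) simp
      ultimately have "q \<in> convex hull {z1, z2, z3}" by simp
      then show ?thesis by (simp add: interior_of_triangle)
    qed
    from winding_number_triangle[OF this] imp show ?thesis by simp
  qed
  have w2: "winding_number (linepath z1 z3 +++ linepath z3 z4 +++ linepath z4 z1) q = 0"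
  proof (rule winding_number_zero_outside)
    \<comment> \<open>The closed half-plane beyond the diagonal, on the side of \<open>z4\<close>:
      it contains the whole second triangle and misses \<open>q\<close>.\<close>
    let ?S = "{\<xi>. (cA \<xi> - a) * (b' - b) \<le> (cB \<xi> - b) * (a' - a)}"
    have *: "?S = {\<xi>. cA \<xi> * (b' - b) - cB \<xi> * (a' - a) \<le> a * (b' - b) - b * (a' - a)}"
      by (auto simp: algebra_simps)
    show "convex ?S"
      unfolding * convex_def
    proof safe
      fix x y and u v :: real
      let ?h = "\<lambda>\<xi>. cA \<xi> * (b' - b) - cB \<xi> * (a' - a)"
      assume h: "?h x \<le> a * (b' - b) - b * (a' - a)" "?h y \<le> a * (b' - b) - b * (a' - a)"
        "0 \<le> u" "0 \<le> v" "u + v = 1"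
      have "?h (u *\<^sub>R x + v *\<^sub>R y) = u * ?h x + v * ?h y"
        by (simp add: scaleR_conv_of_real cA_add cB_add cA_scale cB_scale) (simp add: algebra_simps)
      also have "\<dots> \<le> a * (b' - b) - b * (a' - a)" using h by (rule convex_bound_le)
      finally show "?h (u *\<^sub>R x + v *\<^sub>R y) \<le> a * (b' - b) - b * (a' - a)" .
    qed
    have "z1 \<in> ?S" "z3 \<in> ?S" "z4 \<in> ?S" using assms by (auto simp: zd)
    then show "path_image (linepath z1 z3 +++ linepath z3 z4 +++ linepath z4 z1) \<subseteq> ?S"
      using \<open>convex ?S\<close> by (simp add: path_image_join closed_segment_subset)
    have "0 < (a' - a) * (b' - b)" using assms by simp
    then show "q \<notin> ?S" by (simp add: q_def field_simps)
  qed (auto)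
  have "winding_number (par a a' b b') q = winding_number (linepath z1 z2) q +
     winding_number (linepath z2 z3) q + winding_number (linepath z3 z4) q + winding_number (linepath z4 z1) q"
    unfolding par_def zd[symmetric] by (simp add: winding_number_join path_image_join)
  also have "\<dots> = 1"
  proof -
    have "winding_number (linepath z3 z1) q = - winding_number (linepath z1 z3) q"
      using winding_number_reversepath[of "linepath z1 z3" q] by simp
    with w1 w2 show ?thesis by (simp add: winding_number_join path_image_join algebra_simps)
  qed
  finally have "winding_number (par a a' b b') q = 1" .
  moreover have "winding_number (par a a' b b') p = winding_number (par a a' b b') q"
    by (rule winding_number_eq[where S = "opar a a' b b'"])
      (use assms q convex_connected[OF convex_opar] opar_path_disjoint[OF assms(1,2)] in \<open>auto simp: valid_path_imp_path\<close>)
  ultimately show ?thesis by simp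
qed

end

section \<open>Integrals along segments, the lattice, and residues in a box\<close>

lemma contour_integral_linepath_translate:
  "contour_integral (linepath (a + w) (b + w)) f = contour_integral (linepath a b) (\<lambda>z. f (z + w))"
proof -
  have "linepath (a + w) (b + w) x = linepath a b x + w" for x
    by (simp add: linepath_def scaleR_conv_of_real algebra_simps)
  then show ?thesis
    by (simp add: contour_integral_integral)
qed

text \<open>The integral of 1/(h^2 + t^2) over the whole line is \<pi>/h, so the bound does not
  depend on the length of the segment. This is what later keeps M and N independent of each
  other.\<close>

lemma contour_integral_segment_arctan_bound:
  fixes f :: "complex \<Rightarrow> complex"
  assumes f: "continuous_on (closed_segment (c - of_real A * u) (c + of_real A * u)) f"
    and "A > 0" "h > 0"
    and bd: "\<And>t. \<bar>t\<bar> \<le> A \<Longrightarrow> norm (f (c + of_real t * u)) \<le> K / (h\<^sup>2 + t\<^sup>2)"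
  shows "norm (contour_integral (linepath (c - of_real A * u) (c + of_real A * u)) f) \<le> K * norm u * pi / h"
proof -
  have "K / (h\<^sup>2 + 0\<^sup>2) \<ge> 0" using bd[of 0] assms(2) norm_ge_zero order_trans by (metis abs_zero less_imp_le)
  then have K: "K \<ge> 0" using \<open>h > 0\<close> by (simp add: zero_le_divide_iff)
  let ?p = "linepath (c - of_real A * u) (c + of_real A * u)"
  have eq: "?p s = c + of_real (2 * A * s - A) * u" for s
    by (simp add: linepath_def scaleR_conv_of_real algebra_simps)
  have ftc: "((\<lambda>s. K * norm u * (2 * A) / (h\<^sup>2 + (2 * A * s - A)\<^sup>2)) has_integral
      (K * norm u / h * arctan ((2 * A * 1 - A) / h) - K * norm u / h * arctan ((2 * A * 0 - A) / h))) {0..1}"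
  proof (rule fundamental_theorem_of_calculus)
    fix s :: real
    have nz: "h\<^sup>2 + (2 * A * s - A)\<^sup>2 > 0" using \<open>h > 0\<close> by (simp add: add_pos_nonneg)
    have e: "1 + ((2 * A * s - A) / h)\<^sup>2 = (h\<^sup>2 + (2 * A * s - A)\<^sup>2) / h\<^sup>2"
      using \<open>h > 0\<close> by (simp add: power_divide field_simps)
    have "((\<lambda>s. K * norm u / h * arctan ((2 * A * s - A) / h)) has_real_derivative
        K * norm u / h * (inverse (1 + ((2 * A * s - A) / h)\<^sup>2) * (2 * A / h))) (at s within {0..1})"
      using \<open>h > 0\<close> by (auto intro!: derivative_eq_intros)
    also have "K * norm u / h * (inverse (1 + ((2 * A * s - A) / h)\<^sup>2) * (2 * A / h))
        = K * norm u * (2 * A) / (h\<^sup>2 + (2 * A * s - A)\<^sup>2)"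
      unfolding e using \<open>h > 0\<close> nz by (simp add: power2_eq_square)
    finally show "((\<lambda>s. K * norm u / h * arctan ((2 * A * s - A) / h)) has_vector_derivative
        K * norm u * (2 * A) / (h\<^sup>2 + (2 * A * s - A)\<^sup>2)) (at s within {0..1})"
      by (simp add: has_real_derivative_iff_has_vector_derivative)
  qed auto
  have int: "(\<lambda>s. f (?p s) * ((c + of_real A * u) - (c - of_real A * u))) integrable_on {0..1}"
    using contour_integrable_continuous_linepath[OF f] by (simp add: contour_integrable_on_def
        has_contour_integral_linepath integrable_on_def)
  have "norm (contour_integral ?p f) = norm (integral {0..1} (\<lambda>s. f (?p s) * ((c + of_real A * u) - (c - of_real A * u))))"
    by (simp add: contour_integral_integral)
  also have "\<dots> \<le> integral {0..1} (\<lambda>s. K * norm u * (2 * A) / (h\<^sup>2 + (2 * A * s - A)\<^sup>2))"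
  proof (rule integral_norm_bound_integral[OF int])
    show "(\<lambda>s. K * norm u * (2 * A) / (h\<^sup>2 + (2 * A * s - A)\<^sup>2)) integrable_on {0..1}"
      using ftc by (rule has_integral_integrable)
    fix s :: real assume s: "s \<in> {0..1}"
    have "2 * A * s \<le> 2 * A * 1" "0 \<le> 2 * A * s" using s \<open>A > 0\<close> by (intro mult_left_mono mult_nonneg_nonneg; simp)+
    then have "\<bar>2 * A * s - A\<bar> \<le> A" by simp
    from bd[OF this] have b: "norm (f (?p s)) \<le> K / (h\<^sup>2 + (2 * A * s - A)\<^sup>2)" by (simp only: eq)
    have "(c + of_real A * u) - (c - of_real A * u) = of_real (2 * A) * u" by (simp add: algebra_simps)
    then have "norm (f (?p s) * ((c + of_real A * u) - (c - of_real A * u))) = norm (f (?p s)) * (2 * A * norm u)"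
      using \<open>A > 0\<close> by (simp only: norm_mult norm_of_real)
    also have "\<dots> \<le> K / (h\<^sup>2 + (2 * A * s - A)\<^sup>2) * (2 * A * norm u)"
      using \<open>A > 0\<close> by (intro mult_right_mono b) auto
    finally show "norm (f (?p s) * ((c + of_real A * u) - (c - of_real A * u))) \<le> K * norm u * (2 * A) / (h\<^sup>2 + (2 * A * s - A)\<^sup>2)"
      by (simp add: mult_ac)
  qed
  also have "\<dots> = K * norm u / h * (2 * arctan (A / h))"
    by (simp only: integral_unique[OF ftc]) (simp add: arctan_minus)
  also have "\<dots> \<le> K * norm u / h * pi"
    using K \<open>h > 0\<close> arctan_ubound[of "A / h"] by (intro mult_left_mono) auto
  finally show ?thesis by simp
qed

context period_pair
begin

definition lat :: "complex set" where
  "lat = range (\<lambda>(m, n). pt (of_int m) (of_int n))"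

lemma lat_iff: "\<xi> \<in> lat \<longleftrightarrow> cA \<xi> \<in> \<int> \<and> cB \<xi> \<in> \<int>"
proof
  assume "\<xi> \<in> lat"
  then show "cA \<xi> \<in> \<int> \<and> cB \<xi> \<in> \<int>" by (auto simp: lat_def)
next
  assume "cA \<xi> \<in> \<int> \<and> cB \<xi> \<in> \<int>"
  then obtain m n where "cA \<xi> = of_int m" "cB \<xi> = of_int n" by (auto elim!: Ints_cases)
  then have "\<xi> = pt (of_int m) (of_int n)" by (metis pt_coords)
  then show "\<xi> \<in> lat" by (auto simp: lat_def)
qed

lemma pt_in_lat [simp]: "pt (of_int m) (of_int n) \<in> lat"
  by (simp add: lat_iff)

text \<open>Opposite sides are written with the same orientation, so that quasi-periodicity can
  compare one with the translate of the other in the zero count for theta, and each can be estimated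
  by the same segment bound.\<close>

lemma contour_integral_par:
  assumes "continuous_on (path_image (par a a' b b')) f"
  shows "contour_integral (par a a' b b') f =
    contour_integral (linepath (pt a b) (pt a' b)) f + contour_integral (linepath (pt a' b) (pt a' b')) f
    - contour_integral (linepath (pt a b') (pt a' b')) f - contour_integral (linepath (pt a b) (pt a b')) f"
proof -
  have c: "continuous_on (closed_segment (pt a b) (pt a' b)) f" "continuous_on (closed_segment (pt a' b) (pt a' b')) f"
    "continuous_on (closed_segment (pt a' b') (pt a b')) f" "continuous_on (closed_segment (pt a b') (pt a b)) f"
    by (rule continuous_on_subset[OF assms], force simp: par_def path_image_join)+
  note i = c[THEN contour_integrable_continuous_linepath]
  have r: "contour_integral (linepath y x) f = - contour_integral (linepath x y) f" for x y
    using contour_integral_reversepath[of "linepath x y" f] by simp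
  show ?thesis
    unfolding par_def using i
    by (simp add: contour_integral_join contour_integrable_join valid_path_join
        r[of "pt a' b'" "pt a b'"] r[of "pt a b'" "pt a b"])
qed

lemma residue_theorem_box:
  assumes f: "f holomorphic_on - lat"
  shows "contour_integral (par (- (real M + 1/2)) (real M + 1/2) (- (real N + 1/2)) (real N + 1/2)) f =
    2 * of_real pi * \<i> * (\<Sum>(m, n)\<in>{- int M..int M} \<times> {- int N..int N}. residue f (pt (of_int m) (of_int n)))"
proof -
  let ?box = "{- int M..int M} \<times> {- int N..int N}"
  let ?g = "par (- (real M + 1/2)) (real M + 1/2) (- (real N + 1/2)) (real N + 1/2)"
  let ?pt = "\<lambda>(m, n). pt (of_int m) (of_int n)"
  \<comment> \<open>Half a unit larger than the contour: \<open>S\<close> contains it but no lattice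
    point outside the box, so the residue theorem applies on a convex open set without further
    poles.\<close>
  define S where "S = opar (- (real M + 1)) (real M + 1) (- (real N + 1)) (real N + 1)"
  define P where "P = ?pt ` ?box"
  have box: "- int M \<le> m \<and> m \<le> int M" if "- (real M + 1) < of_int m" "of_int m < real M + 1" for m :: int and M :: nat
    using that by linarith
  have "S \<inter> lat \<subseteq> P"
  proof
    fix \<xi> assume "\<xi> \<in> S \<inter> lat"
    then obtain m n where mn: "\<xi> = pt (of_int m) (of_int n)" "\<xi> \<in> S" by (auto simp: lat_def)
    then have "(m, n) \<in> ?box" using box[of M m] box[of N n] by (auto simp: S_def opar_def)
    then show "\<xi> \<in> P" unfolding P_def mn(1) by (force intro!: image_eqI[of _ _ "(m, n)"])
  qed
  have half: "(- (real M + 1/2)) \<notin> \<int>" "real M + 1/2 \<notin> \<int>" for M :: nat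
  proof -
    show "real M + 1/2 \<notin> \<int>" using half_not_Int[of "real M + 1/2"] by auto
    then show "(- (real M + 1/2)) \<notin> \<int>" using minus_in_Ints_iff by blast
  qed
  have img: "path_image ?g \<subseteq> S - P"
  proof
    fix \<xi> assume "\<xi> \<in> path_image ?g"
    note pi = path_image_par[OF _ _ this]
    have "\<xi> \<in> S" using pi by (simp add: S_def opar_def)
    moreover have "\<xi> \<notin> lat" using pi(5) half by (auto simp: lat_iff)
    ultimately show "\<xi> \<in> S - P" by (auto simp: P_def)
  qed
  have "contour_integral ?g f = 2 * pi * \<i> * (\<Sum>p\<in>P. winding_number ?g p * residue f p)"
  proof (rule Residue_theorem[where S = S])
    show "open S" "connected S" unfolding S_def by (simp_all add: open_opar convex_opar convex_connected)
    show "finite P" by (simp add: P_def)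
    show "f holomorphic_on S - P"
      by (rule holomorphic_on_subset[OF f]) (use \<open>S \<inter> lat \<subseteq> P\<close> in auto)
    show "path_image ?g \<subseteq> S - P" by (fact img)
    show "\<forall>z. z \<notin> S \<longrightarrow> winding_number ?g z = 0"
    proof (intro allI impI)
      fix z assume "z \<notin> S"
      show "winding_number ?g z = 0"
        by (rule winding_number_zero_outside[OF _ _ _ \<open>z \<notin> S\<close>])
          (use img in \<open>auto simp: S_def convex_opar valid_path_imp_path\<close>)
    qed
  qed auto
  also have "(\<Sum>p\<in>P. winding_number ?g p * residue f p) = (\<Sum>p\<in>P. residue f p)"
  proof (rule sum.cong)
    fix p assume "p \<in> P"
    then obtain m n :: int where mn: "p = pt (of_int m) (of_int n)" "\<bar>m\<bar> \<le> int M" "\<bar>n\<bar> \<le> int N"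
      by (auto simp: P_def)
    then have "\<bar>real_of_int m\<bar> \<le> real M" "\<bar>real_of_int n\<bar> \<le> real N" by linarith+
    then have "winding_number ?g p = 1"
      by (intro winding_number_par) (auto simp: opar_def mn)
    then show "winding_number ?g p * residue f p = residue f p" by simp
  qed simp
  also have "\<dots> = (\<Sum>x\<in>?box. residue f (?pt x))"
    unfolding P_def by (rule sum.reindex_cong[where l = ?pt]) (auto simp: inj_on_def pt_inj)
  finally show ?thesis by (simp add: case_prod_unfold)
qed

end

subsection \<open>The theta function\<close>

definition thetaterm :: "complex \<Rightarrow> int \<Rightarrow> complex \<Rightarrow> complex" where
  "thetaterm \<tau> n z = exp (of_real pi * \<i> * (of_int n + 1/2)\<^sup>2 * \<tau>
          + 2 * of_real pi * \<i> * (of_int n + 1/2) * z + of_real pi * \<i> * of_int n)"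

lemma theta_eq: "theta z \<tau> = - \<i> * (\<Sum>\<^sub>\<infinity>n. thetaterm \<tau> n z)"
  by (simp add: theta_def thetaterm_def)

lemma norm_thetaterm:
  "norm (thetaterm \<tau> n z) = exp (- pi * (of_int n + 1/2)\<^sup>2 * Im \<tau> - 2 * pi * (of_int n + 1/2) * Im z)"
proof -
  have e: "complex_of_int n + 1/2 = of_real (of_int n + 1/2)"
    by simp
  show ?thesis
    unfolding thetaterm_def norm_exp_eq_Re e of_real_power[symmetric]
    by (simp del: of_real_add of_real_divide of_real_power)
qed

lemma summable_on_int_abs:
  fixes g :: "real \<Rightarrow> real"
  assumes "(\<lambda>n. g (real n)) summable_on UNIV"
  shows "(\<lambda>n::int. g \<bar>of_int n\<bar>) summable_on UNIV"
proof -
  have "(\<lambda>n. g \<bar>of_int n\<bar>) summable_on (int ` UNIV)"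
    using assms by (subst summable_on_reindex) (auto simp: o_def)
  moreover have "(\<lambda>n. g \<bar>of_int n\<bar>) summable_on ((\<lambda>n. - int n) ` UNIV)"
    using assms by (subst summable_on_reindex) (auto simp: o_def inj_on_def)
  ultimately have "(\<lambda>n. g \<bar>of_int n\<bar>) summable_on (int ` UNIV \<union> (\<lambda>n. - int n) ` UNIV)"
    by (rule summable_on_union)
  also have "int ` UNIV \<union> (\<lambda>n. - int n) ` UNIV = UNIV"
    by (auto simp: image_iff) (metis int_cases2)
  finally show ?thesis .
qed

lemma summable_exp_int:
  assumes "(c::real) > 0"
  shows "(\<lambda>n::int. exp (- c * \<bar>of_int n\<bar>)) summable_on UNIV"
proof -
  have "(\<lambda>n. exp (-c) ^ n) summable_on (UNIV :: nat set)"
    using assms by (intro norm_summable_imp_summable_on) (auto intro!: summable_geometric simp: norm_power)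
  moreover have "exp (-c) ^ n = exp (- c * real n)" for n
    by (simp add: exp_of_nat_mult[symmetric] mult.commute)
  ultimately have "(\<lambda>n. exp (- c * real n)) summable_on UNIV" by (simp only:)
  from summable_on_int_abs[OF this] show ?thesis by simp
qed

text \<open>The Gaussian factor beats the exponential growth caused by Im z: after completing the
  square in s = |n + 1/2| a factor exp(-s) is left over. The bound is uniform on horizontal
  strips.\<close>

lemma thetaterm_bound:
  assumes "Im \<tau> > 0" and R: "R \<ge> 0"
  obtains C where "\<And>n z. \<bar>Im z\<bar> \<le> R \<Longrightarrow> norm (thetaterm \<tau> n z) \<le> C * exp (- (1::real) * \<bar>of_int n\<bar>)"
proof -
  \<comment> \<open>The summand 1 in \<open>b\<close> is what pays for exp(-s); the maximum of b s -
    a s^2 is b^2/(4a), and |n| \<le> s + 1 accounts for the other 1 in the exponent.\<close>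
  define a b where "a = pi * Im \<tau>" and "b = 2 * pi * R + 1"
  have a: "a > 0" using assms by (simp add: a_def)
  have "norm (thetaterm \<tau> n z) \<le> exp (b\<^sup>2 / (4 * a) + 1) * exp (- (1::real) * \<bar>of_int n\<bar>)" if "\<bar>Im z\<bar> \<le> R" for n z
  proof -
    define s where "s = \<bar>real_of_int n + 1/2\<bar>"
    have ab: "\<bar>real_of_int n\<bar> \<le> s + 1" unfolding s_def by linarith
    have "- ((real_of_int n + 1/2) * Im z) \<le> \<bar>(real_of_int n + 1/2) * Im z\<bar>" by linarith
    also have "\<dots> \<le> s * R" using that unfolding abs_mult s_def by (intro mult_left_mono) auto
    finally have "2 * pi * (- ((real_of_int n + 1/2) * Im z)) \<le> 2 * pi * (s * R)" by (intro mult_left_mono) auto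
    then have "- pi * (of_int n + 1/2)\<^sup>2 * Im \<tau> - 2 * pi * (of_int n + 1/2) * Im z \<le> - a * s\<^sup>2 + 2 * pi * R * s"
      by (simp add: a_def s_def algebra_simps)
    also have "\<dots> = b * s - a * s\<^sup>2 - s" by (simp add: b_def algebra_simps)
    also have "b * s - a * s\<^sup>2 \<le> b\<^sup>2 / (4 * a)"
    proof -
      have "0 \<le> (b - 2 * a * s)\<^sup>2 / (4 * a)" using a by simp
      also have "\<dots> = b\<^sup>2 / (4 * a) - (b * s - a * s\<^sup>2)" using a by (simp add: power2_eq_square field_simps)
      finally show ?thesis by simp
    qed
    finally have "- pi * (of_int n + 1/2)\<^sup>2 * Im \<tau> - 2 * pi * (of_int n + 1/2) * Im z \<le> b\<^sup>2 / (4 * a) + 1 - \<bar>of_int n\<bar>"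
      using ab by linarith
    then show ?thesis unfolding norm_thetaterm by (simp flip: exp_add)
  qed
  then show ?thesis using that by blast
qed

lemma uniform_limit_theta:
  assumes "Im \<tau> > 0" and "\<And>z. z \<in> Y \<Longrightarrow> \<bar>Im z\<bar> \<le> R"
  shows "uniform_limit Y (\<lambda>X z. \<Sum>n\<in>X. thetaterm \<tau> n z) (\<lambda>z. \<Sum>\<^sub>\<infinity>n. thetaterm \<tau> n z) (finite_subsets_at_top UNIV)"
proof (cases "Y = {}")
  case False
  then have "R \<ge> 0" using assms(2) by force
  then obtain C where C: "\<And>n z. \<bar>Im z\<bar> \<le> R \<Longrightarrow> norm (thetaterm \<tau> n z) \<le> C * exp (- (1::real) * \<bar>of_int n\<bar>)"
    using thetaterm_bound[OF assms(1)] by blast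
  show ?thesis
    by (rule Weierstrass_m_test_general[where M = "\<lambda>n. C * exp (- (1::real) * \<bar>of_int n\<bar>)"])
      (use C assms(2) summable_exp_int[of 1] in \<open>auto intro!: summable_on_cmult_right\<close>)
qed simp

lemma holomorphic_theta:
  assumes "Im \<tau> > 0"
  shows "(\<lambda>z. theta z \<tau>) holomorphic_on UNIV"
proof -
  have "(\<lambda>z. \<Sum>\<^sub>\<infinity>n. thetaterm \<tau> n z) field_differentiable (at z)" for z
  proof -
    have "(\<lambda>z. \<Sum>\<^sub>\<infinity>n. thetaterm \<tau> n z) holomorphic_on ball z 1"
    proof (rule holomorphic_uniform_limit)
      show "uniform_limit (cball z 1) (\<lambda>X z. \<Sum>n\<in>X. thetaterm \<tau> n z) (\<lambda>z. \<Sum>\<^sub>\<infinity>n. thetaterm \<tau> n z) (finite_subsets_at_top UNIV)"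
      proof (rule uniform_limit_theta[OF assms])
        fix w assume "w \<in> cball z 1"
        then have "\<bar>Im (z - w)\<bar> \<le> 1" using abs_Im_le_cmod[of "z - w"] by (simp add: dist_norm)
        then show "\<bar>Im w\<bar> \<le> \<bar>Im z\<bar> + 1" by simp
      qed
      show "\<forall>\<^sub>F X in finite_subsets_at_top UNIV. continuous_on (cball z 1) (\<lambda>z. \<Sum>n\<in>X. thetaterm \<tau> n z) \<and>
          (\<lambda>z. \<Sum>n\<in>X. thetaterm \<tau> n z) holomorphic_on ball z 1"
        unfolding thetaterm_def
        by (intro always_eventually allI conjI continuous_intros holomorphic_intros)
    qed auto
    then show ?thesis by (rule holomorphic_on_imp_differentiable_at) auto
  qed
  then have "(\<lambda>z. \<Sum>\<^sub>\<infinity>n. thetaterm \<tau> n z) holomorphic_on UNIV"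
    by (simp add: holomorphic_on_open field_differentiable_def)
  then show ?thesis unfolding theta_eq by (intro holomorphic_intros)
qed

lemma theta_plus_1: "theta (z + 1) \<tau> = - theta z \<tau>"
proof -
  have e: "exp (2 * of_real pi * \<i> * (of_int n + 1/2)) = -1" for n :: int
  proof -
    have "2 * of_real pi * \<i> * (of_int n + 1/2) = of_int n * (2 * of_real pi * \<i>) + of_real pi * \<i>"
      by (simp add: algebra_simps)
    then show ?thesis by (simp add: exp_add exp_integer_2pi mult_ac)
  qed
  have "thetaterm \<tau> n (z + 1) = - 1 * thetaterm \<tau> n z" for n
  proof -
    have "thetaterm \<tau> n (z + 1) = exp (2 * of_real pi * \<i> * (of_int n + 1/2)) * thetaterm \<tau> n z"
      unfolding thetaterm_def exp_add[symmetric] by (simp add: algebra_simps)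
    then show ?thesis by (simp only: e)
  qed
  then show ?thesis unfolding theta_eq by (simp add: infsum_uminus)
qed

text \<open>Since (n + 1/2)^2 + 2 (n + 1/2) = (n + 3/2)^2 - 1, translation by \<tau> shifts the
  index by one; the sign comes from exp(\<pi> i n).\<close>

lemma theta_plus_tau: "theta (z + \<tau>) \<tau> = - exp (- of_real pi * \<i> * \<tau> - 2 * of_real pi * \<i> * z) * theta z \<tau>"
proof -
  have "thetaterm \<tau> n (z + \<tau>) = - exp (- of_real pi * \<i> * \<tau> - 2 * of_real pi * \<i> * z) * thetaterm \<tau> (n + 1) z" for n
  proof -
    have "- exp (- of_real pi * \<i> * \<tau> - 2 * of_real pi * \<i> * z) * thetaterm \<tau> (n + 1) z
       = exp (- of_real pi * \<i>) * exp (- of_real pi * \<i> * \<tau> - 2 * of_real pi * \<i> * z) * thetaterm \<tau> (n + 1) z"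
      using exp_pi_i' by (simp add: exp_minus mult.commute)
    also have "\<dots> = thetaterm \<tau> n (z + \<tau>)"
      unfolding thetaterm_def exp_add[symmetric] by (rule arg_cong[of _ _ exp]) (simp add: power2_eq_square algebra_simps)
    finally show ?thesis by simp
  qed
  then have "theta (z + \<tau>) \<tau> = - \<i> * (- exp (- of_real pi * \<i> * \<tau> - 2 * of_real pi * \<i> * z) * (\<Sum>\<^sub>\<infinity>n. thetaterm \<tau> (n + 1) z))"
    unfolding theta_eq by (simp only: infsum_cmult_right')
  also have "(\<Sum>\<^sub>\<infinity>n. thetaterm \<tau> (n + 1) z) = (\<Sum>\<^sub>\<infinity>n. thetaterm \<tau> n z)"
    by (rule infsum_reindex_bij_betw) (rule bij_betwI[where g = "\<lambda>n. n - 1"], auto)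
  finally show ?thesis unfolding theta_eq by simp
qed

lemma has_field_derivative_theta:
  "Im \<tau> > 0 \<Longrightarrow> ((\<lambda>w. theta w \<tau>) has_field_derivative theta' z \<tau>) (at z)"
  unfolding theta'_def using holomorphic_derivI[OF holomorphic_theta] by simp

lemma theta'_plus_1:
  assumes "Im \<tau> > 0"
  shows "theta' (z + 1) \<tau> = - theta' z \<tau>"
proof -
  note der = has_field_derivative_theta[OF assms]
  have "((\<lambda>z. theta (z + 1) \<tau>) has_field_derivative theta' (z + 1) \<tau>) (at z)"
    using der[of "z + 1"] by (subst DERIV_shift[symmetric]) (simp add: add.commute)
  moreover have "((\<lambda>z. theta (z + 1) \<tau>) has_field_derivative - theta' z \<tau>) (at z)"
    unfolding theta_plus_1 using der by (rule DERIV_minus)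
  ultimately show ?thesis by (rule DERIV_unique)
qed

lemma theta'_plus_tau:
  assumes "Im \<tau> > 0"
  shows "theta' (z + \<tau>) \<tau> = - exp (- of_real pi * \<i> * \<tau> - 2 * of_real pi * \<i> * z)
    * (theta' z \<tau> - 2 * of_real pi * \<i> * theta z \<tau>)"
proof -
  note der = has_field_derivative_theta[OF assms]
  have "((\<lambda>z. theta (z + \<tau>) \<tau>) has_field_derivative theta' (z + \<tau>) \<tau>) (at z)"
    using der[of "z + \<tau>"] by (subst DERIV_shift[symmetric]) (simp add: add.commute)
  moreover have "((\<lambda>z. theta (z + \<tau>) \<tau>) has_field_derivative
      - exp (- of_real pi * \<i> * \<tau> - 2 * of_real pi * \<i> * z) * (theta' z \<tau> - 2 * of_real pi * \<i> * theta z \<tau>)) (at z)"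
    unfolding theta_plus_tau
    by (rule derivative_eq_intros der refl | simp add: algebra_simps)+
  ultimately show ?thesis by (rule DERIV_unique)
qed

text \<open>Reflecting the index from n to -1 - n changes the sign of n + 1/2, and the factor
  exp(\<pi> i n) contributes the minus sign.\<close>

lemma theta_minus: "theta (- z) \<tau> = - theta z \<tau>"
proof -
  have "thetaterm \<tau> n (- z) = - thetaterm \<tau> (- 1 - n) z" for n
  proof -
    have e: "exp (of_real pi * \<i> * (2 * of_int n + 1)) = -1"
    proof -
      have "of_real pi * \<i> * (2 * of_int n + 1) = of_int n * (2 * of_real pi * \<i>) + of_real pi * \<i>"
        by (simp add: algebra_simps)
      then show ?thesis by (simp add: exp_add exp_integer_2pi mult_ac)
    qed
    have "thetaterm \<tau> n (- z) = exp (of_real pi * \<i> * (2 * of_int n + 1)) * thetaterm \<tau> (- 1 - n) z"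
      unfolding thetaterm_def exp_add[symmetric] by (rule arg_cong[of _ _ exp]) (simp add: power2_eq_square algebra_simps)
    then show ?thesis by (simp add: e)
  qed
  then have "theta (- z) \<tau> = \<i> * (\<Sum>\<^sub>\<infinity>n. thetaterm \<tau> (- 1 - n) z)"
    unfolding theta_eq by (simp add: infsum_uminus)
  also have "(\<Sum>\<^sub>\<infinity>n. thetaterm \<tau> (- 1 - n) z) = (\<Sum>\<^sub>\<infinity>n. thetaterm \<tau> n z)"
    by (rule infsum_reindex_bij_betw) (rule bij_betwI[where g = "\<lambda>n. - 1 - n"], auto)
  finally show ?thesis unfolding theta_eq by simp
qed

lemma theta_0 [simp]: "theta 0 \<tau> = 0"
  using theta_minus[of 0 \<tau>] by simp

lemma theta_not_identically_0:
  assumes "Im \<tau> > 0"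
  obtains z where "theta z \<tau> \<noteq> 0"
proof -
  \<comment> \<open>the zeroth Fourier coefficient, which the integral over \<open>[0, 1]\<close> recovers, is nonzero\<close>
  define c where "c n = exp (of_real pi * \<i> * (of_int n + 1/2)\<^sup>2 * \<tau> + of_real pi * \<i> * of_int n)" for n :: int
  \<comment> \<open>The factor exp(-\<pi> i t) turns the half-integral frequencies n + 1/2 into
    integers n, so only n = 0 survives integration over a period.\<close>
  have fourier: "((\<lambda>t. thetaterm \<tau> n (of_real t) * exp (- of_real pi * \<i> * of_real t)) has_integral (if n = 0 then c 0 else 0)) {0..1::real}" for n
  proof -
    have eq: "thetaterm \<tau> n (of_real t) * exp (- of_real pi * \<i> * of_real t) = c n * exp (2 * of_real pi * \<i> * of_int n * of_real t)" for t
      unfolding thetaterm_def c_def exp_add[symmetric] by (rule arg_cong[of _ _ exp]) (simp add: algebra_simps)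
    show ?thesis
    proof (cases "n = 0")
      case True
      show ?thesis unfolding eq using True has_integral_const_real[of "c 0" 0 1] by simp
    next
      case False
      let ?w = "2 * of_real pi * \<i> * of_int n :: complex"
      have w: "?w \<noteq> 0" using False by simp
      have "((\<lambda>t. c n * exp (?w * of_real t)) has_integral
          (c n / ?w * exp (?w * of_real 1) - c n / ?w * exp (?w * of_real 0))) {0..1}"
      proof (rule fundamental_theorem_of_calculus)
        fix t :: real
        have "((\<lambda>z. c n / ?w * exp (?w * z)) has_field_derivative c n * exp (?w * of_real t)) (at (of_real t))"
          using w by (auto intro!: derivative_eq_intros)
        from has_vector_derivative_real_field[OF this]
        show "((\<lambda>t. c n / ?w * exp (?w * of_real t)) has_vector_derivative c n * exp (?w * of_real t)) (at t within {0..1})"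
          by (rule has_vector_derivative_at_within)
      qed auto
      moreover have "exp (?w * of_real 1) = 1"
        using exp_integer_2pi[of "of_int n"] by (simp add: mult_ac)
      ultimately show ?thesis unfolding eq using False by simp
    qed
  qed
  show ?thesis
  proof (rule ccontr)
    assume "\<not> thesis"
    then have z: "theta z \<tau> = 0" for z using that by blast
    \<comment> \<open>Uniform convergence on the real segment allows integration term by term; every
      finite partial sum that contains n = 0 has the same integral \<open>c 0\<close>, which
      therefore equals the integral of the limit.\<close>
    have "uniform_limit {0..1::real} (\<lambda>X t. \<Sum>n\<in>X. thetaterm \<tau> n (of_real t)) (\<lambda>t. \<Sum>\<^sub>\<infinity>n. thetaterm \<tau> n (of_real t)) (finite_subsets_at_top UNIV)"
      by (rule uniform_limit_compose'[OF uniform_limit_theta[OF assms, of "of_real ` {0..1}" 0]]) auto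
    then have "uniform_limit {0..1::real} (\<lambda>X t. (\<Sum>n\<in>X. thetaterm \<tau> n (of_real t)) * exp (- of_real pi * \<i> * of_real t))
       (\<lambda>t. (\<Sum>\<^sub>\<infinity>n. thetaterm \<tau> n (of_real t)) * exp (- of_real pi * \<i> * of_real t)) (finite_subsets_at_top UNIV)"
      using z unfolding theta_eq
      by (intro uniform_lim_mult uniform_limit_const)
        (auto intro!: boundedI[where B = 1] simp: norm_exp_eq_Re)
    then obtain I J where
      IJ: "\<And>X. ((\<lambda>t. (\<Sum>n\<in>X. thetaterm \<tau> n (of_real t)) * exp (- of_real pi * \<i> * of_real t)) has_integral I X) {0..1}"
      "((\<lambda>t. (\<Sum>\<^sub>\<infinity>n. thetaterm \<tau> n (of_real t)) * exp (- of_real pi * \<i> * of_real t)) has_integral J) {0..1}"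
      "(I \<longlongrightarrow> J) (finite_subsets_at_top UNIV)"
      by (rule uniform_limit_integral) (auto intro!: continuous_intros simp: thetaterm_def)
    have "J = 0" using IJ(2) z unfolding theta_eq by (simp add: has_integral_iff)
    have "I X = c 0" if "finite X" "{0} \<subseteq> X" for X
    proof -
      have "((\<lambda>t. \<Sum>n\<in>X. thetaterm \<tau> n (of_real t) * exp (- of_real pi * \<i> * of_real t)) has_integral (\<Sum>n\<in>X. if n = 0 then c 0 else 0)) {0..1}"
        by (intro has_integral_sum that fourier)
      moreover have "(\<Sum>n\<in>X. if n = 0 then c 0 else 0) = c 0" using that by simp
      ultimately show ?thesis using IJ(1)[of X] by (simp add: sum_distrib_right has_integral_unique)
    qed
    then have "eventually (\<lambda>X. I X = c 0) (finite_subsets_at_top UNIV)"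
      unfolding eventually_finite_subsets_at_top by (intro exI[of _ "{0}"]) auto
    then have "(I \<longlongrightarrow> c 0) (finite_subsets_at_top UNIV)" by (rule tendsto_eventually)
    then have "c 0 = J" using IJ(3) by (intro tendsto_unique[of "finite_subsets_at_top UNIV"]) auto
    then show False using \<open>J = 0\<close> by (simp add: c_def)
  qed
qed

section \<open>The zeros of theta\<close>

context period_pair
begin

lemma closed_par_convex: "convex {\<xi>. a \<le> cA \<xi> \<and> cA \<xi> \<le> a' \<and> b \<le> cB \<xi> \<and> cB \<xi> \<le> b'}"
proof -
  note linear_cA linear_cB
  then have "convex (cA -` {a..a'} \<inter> cB -` {b..b'})"
    by (intro convex_Int convex_linear_vimage) auto
  also have "cA -` {a..a'} \<inter> cB -` {b..b'} = {\<xi>. a \<le> cA \<xi> \<and> cA \<xi> \<le> a' \<and> b \<le> cB \<xi> \<and> cB \<xi> \<le> b'}"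
    by auto
  finally show ?thesis .
qed

lemma winding_number_par_outside:
  assumes "a \<le> a'" "b \<le> b'" "\<not> (a \<le> cA p \<and> cA p \<le> a' \<and> b \<le> cB p \<and> cB p \<le> b')"
  shows "winding_number (par a a' b b') p = 0"
  by (rule winding_number_zero_outside[OF _ closed_par_convex[of a a' b b']])
    (use path_image_par[OF assms(1,2)] assms(3) in \<open>auto simp: valid_path_imp_path\<close>)

lemma bounded_opar: "bounded (opar a a' b b')"
proof (rule boundedI)
  fix \<xi> assume "\<xi> \<in> opar a a' b b'"
  then have "\<bar>cA \<xi>\<bar> \<le> \<bar>a\<bar> + \<bar>a'\<bar>" "\<bar>cB \<xi>\<bar> \<le> \<bar>b\<bar> + \<bar>b'\<bar>" by (auto simp: opar_def)
  then have "\<bar>cA \<xi>\<bar> * norm \<omega>1 + \<bar>cB \<xi>\<bar> * norm \<omega>2 \<le> (\<bar>a\<bar> + \<bar>a'\<bar>) * norm \<omega>1 + (\<bar>b\<bar> + \<bar>b'\<bar>) * norm \<omega>2"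
    by (intro add_mono mult_right_mono) auto
  moreover have "norm \<xi> \<le> \<bar>cA \<xi>\<bar> * norm \<omega>1 + \<bar>cB \<xi>\<bar> * norm \<omega>2"
    by (metis pt_coords pt_def norm_triangle_ineq norm_mult norm_of_real)
  ultimately show "norm \<xi> \<le> (\<bar>a\<bar> + \<bar>a'\<bar>) * norm \<omega>1 + (\<bar>b\<bar> + \<bar>b'\<bar>) * norm \<omega>2" by linarith
qed

end

text \<open>The logarithmic derivative integrates to 2 \<pi> i around a period cell, so the orders
  of the zeros inside sum to 1: there is just one, and it is simple. As 0 is a zero, all others are
  its translates.\<close>

lemma theta_zeros_and_deriv:
  assumes \<tau>: "Im \<tau> > 0"
  shows "theta z \<tau> = 0 \<longleftrightarrow> (\<exists>m n. z = of_int m + of_int n * \<tau>)" and "theta' 0 \<tau> \<noteq> 0"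
proof -
  \<comment> \<open>With the periods 1 and \<tau> the coordinates and contours of the locale refer
    to the argument of theta itself.\<close>
  interpret period_pair 1 \<tau> by unfold_locales (use \<tau> in simp)
  define f where "f z = theta z \<tau>" for z
  have hol: "f holomorphic_on S" for S
    unfolding f_def using holomorphic_theta[OF \<tau>] holomorphic_on_subset by blast
  obtain z0 where z0: "f z0 \<noteq> 0" using theta_not_identically_0[OF \<tau>] unfolding f_def by blast
  have f0: "f 0 = 0" by (simp add: f_def)
  have nconst: "\<not> f constant_on UNIV" using z0 f0 by (metis UNIV_I constant_on_def)
  have f1: "f (z + 1) = - f z" for z by (simp add: f_def theta_plus_1)
  define e where "e z = - exp (- of_real pi * \<i> * \<tau> - 2 * of_real pi * \<i> * z)" for z
  have ft: "f (z + \<tau>) = e z * f z" for z by (simp add: f_def theta_plus_tau e_def)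
  have ez: "e z \<noteq> 0" for z by (simp add: e_def)
  have per_nat: "f (z + pt (real m) (real n)) = 0 \<longleftrightarrow> f z = 0" for z m n
  proof (induction m)
    case 0
    show ?case
    proof (induction n)
      case (Suc n)
      have "z + pt (real 0) (real (Suc n)) = (z + pt (real 0) (real n)) + \<tau>"
        by (simp add: pt_def algebra_simps)
      then show ?case using Suc by (simp only: ft) (simp add: ez)
    qed (simp add: pt_def)
  next
    case (Suc m)
    have "z + pt (real (Suc m)) (real n) = (z + pt (real m) (real n)) + 1"
      by (simp add: pt_def algebra_simps)
    then show ?case using Suc by (simp only: f1) simp
  qed
  have per: "f (z + pt (of_int m) (of_int n)) = 0 \<longleftrightarrow> f z = 0" for z m n
  proof -
    \<comment> \<open>Adding |m| and |n| leaves only natural shifts: the translated point and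
      \<open>z\<close> are both compared with the common point \<open>z + pt M' N'\<close>.\<close>
    define M N where "M = nat \<bar>m\<bar>" and "N = nat \<bar>n\<bar>"
    define M' N' where "M' = nat (m + \<bar>m\<bar>)" and "N' = nat (n + \<bar>n\<bar>)"
    have eq: "(z + pt (of_int m) (of_int n)) + pt (real M) (real N) = z + pt (real M') (real N')"
      by (simp add: M_def N_def M'_def N'_def add.assoc pt_add)
    show ?thesis using per_nat[of "z + pt (of_int m) (of_int n)" M N] per_nat[of z M' N'] unfolding eq by simp
  qed
  have df: "deriv f z = theta' z \<tau>" for z by (simp add: theta'_def f_def[abs_def])
  have d1: "deriv f (z + 1) = - deriv f z" for z
    unfolding df by (rule theta'_plus_1[OF \<tau>])
  have dt: "deriv f (z + \<tau>) = e z * (deriv f z - 2 * of_real pi * \<i> * f z)" for z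
    unfolding df f_def e_def by (rule theta'_plus_tau[OF \<tau>])
  have count: "(\<Sum>p\<in>{p\<in>opar a (a + 1) b (b + 1). f p = 0}. zorder f p) = 1 \<and>
      finite {p\<in>opar a (a + 1) b (b + 1). f p = 0}"
    if nz: "\<And>p. p \<in> path_image (par a (a + 1) b (b + 1)) \<Longrightarrow> f p \<noteq> 0" for a b
  proof -
    let ?g = "par a (a + 1) b (b + 1)"
    define S where "S = opar (a - 1) (a + 2) (b - 1) (b + 2)"
    let ?Z = "{p \<in> opar a (a + 1) b (b + 1). f p = 0}"
    have "compact (closure S)" unfolding S_def by (simp add: bounded_opar)
    then have "finite {z \<in> closure S. f z = 0}"
      by (intro holomorphic_compact_finite_zeros[OF hol[of UNIV]]) (use nconst in auto)
    then have finS: "finite {z \<in> S. f z = 0}"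
      by (rule finite_subset[rotated]) (use closure_subset[of S] in auto)
    have ZS: "?Z \<subseteq> {z \<in> S. f z = 0}" by (auto simp: S_def opar_def)
    let ?L = "\<lambda>z. deriv f z / f z"
    have Lhol: "?L holomorphic_on {z. f z \<noteq> 0}"
      by (intro holomorphic_intros holomorphic_deriv hol[of UNIV, THEN holomorphic_on_subset])
        (auto intro!: open_Collect_neq continuous_intros holomorphic_on_imp_continuous_on[OF hol]
          holomorphic_on_subset[OF holomorphic_deriv[OF hol[of UNIV]]])
    have sub: "path_image ?g \<subseteq> {z. f z \<noteq> 0}" using nz by auto
    have Lc: "continuous_on (path_image ?g) ?L"
      by (rule continuous_on_subset[OF holomorphic_on_imp_continuous_on[OF Lhol] sub])
    have "contour_integral ?g (\<lambda>x. deriv f x * (\<lambda>_. 1) x / f x) =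
        2 * pi * \<i> * (\<Sum>p\<in>{w\<in>S. f w = 0 \<or> w \<in> {}}. winding_number ?g p * (\<lambda>_. 1) p * zorder f p)"
    proof (rule argument_principle)
      show "open S" "connected S" unfolding S_def by (simp_all add: open_opar convex_opar convex_connected)
      show "path_image ?g \<subseteq> S - {w \<in> S. f w = 0 \<or> w \<in> {}}"
      proof
        fix p assume p: "p \<in> path_image ?g"
        show "p \<in> S - {w \<in> S. f w = 0 \<or> w \<in> {}}"
          using nz[OF p] path_image_par(1-4)[OF _ _ p] by (simp add: S_def opar_def)
      qed
      show "\<forall>z. z \<notin> S \<longrightarrow> winding_number ?g z = 0"
        by (auto intro!: winding_number_par_outside simp: S_def opar_def)
    qed (use hol finS in auto)
    also have "(\<Sum>p\<in>{w\<in>S. f w = 0 \<or> w \<in> {}}. winding_number ?g p * (\<lambda>_. 1) p * zorder f p)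
        = (\<Sum>p\<in>?Z. of_int (zorder f p))"
    proof (rule sum.mono_neutral_cong_right)
      \<comment> \<open>Zeros outside the open cell do not count: off the closed cell the winding
        number is 0, and the boundary carries no zeros by assumption.\<close>
      show "\<forall>i\<in>{w \<in> S. f w = 0 \<or> w \<in> {}} - ?Z. winding_number ?g i * (\<lambda>_. 1) i * zorder f i = 0"
      proof
        fix p assume p: "p \<in> {w \<in> S. f w = 0 \<or> w \<in> {}} - ?Z"
        then have "\<not> (a < cA p \<and> cA p < a + 1 \<and> b < cB p \<and> cB p < b + 1)" by (auto simp: opar_def)
        have "winding_number ?g p = 0"
        proof (cases "a \<le> cA p \<and> cA p \<le> a + 1 \<and> b \<le> cB p \<and> cB p \<le> b + 1")
          case False
          then show ?thesis by (intro winding_number_par_outside) auto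
        next
          case True
          have img: "path_image ?g = closed_segment (pt a b) (pt (a + 1) b) \<union> closed_segment (pt (a + 1) b) (pt (a + 1) (b + 1))
              \<union> closed_segment (pt (a + 1) (b + 1)) (pt a (b + 1)) \<union> closed_segment (pt a (b + 1)) (pt a b)"
            by (auto simp: par_def path_image_join)
          have h: "pt s c \<in> closed_segment (pt a c) (pt (a + 1) c)" if "a \<le> s" "s \<le> a + 1" for s c
            unfolding in_segment
          proof (intro exI[of _ "s - a"] conjI)
            show "pt s c = (1 - (s - a)) *\<^sub>R pt a c + (s - a) *\<^sub>R pt (a + 1) c"
              unfolding scaleR_conv_of_real pt_scale pt_add by (simp add: pt_inj algebra_simps)
          qed (use that in auto)
          have v: "pt c s \<in> closed_segment (pt c b) (pt c (b + 1))" if "b \<le> s" "s \<le> b + 1" for s c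
            unfolding in_segment
          proof (intro exI[of _ "s - b"] conjI)
            show "pt c s = (1 - (s - b)) *\<^sub>R pt c b + (s - b) *\<^sub>R pt c (b + 1)"
              unfolding scaleR_conv_of_real pt_scale pt_add by (simp add: pt_inj algebra_simps)
          qed (use that in auto)
          have "cA p = a \<or> cA p = a + 1 \<or> cB p = b \<or> cB p = b + 1"
            using True \<open>\<not> (a < cA p \<and> _)\<close> by linarith
          then have "pt (cA p) (cB p) \<in> path_image ?g"
            unfolding img using h[of "cA p"] v[of "cB p"] True
            by (auto simp del: pt_coords simp: closed_segment_commute)
          then show ?thesis using nz[of p] p by auto
        qed
        then show "winding_number ?g p * (\<lambda>_. 1) p * zorder f p = 0" by simp
      qed
    qed (use ZS finS in \<open>auto simp: winding_number_par\<close>)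
    finally have I: "contour_integral ?g ?L = 2 * pi * \<i> * (\<Sum>p\<in>?Z. of_int (zorder f p))" by simp
    have seg: "closed_segment (pt a b) (pt (a + 1) b) \<subseteq> path_image ?g"
      by (auto simp: par_def path_image_join)
    \<comment> \<open>The logarithmic derivative has period 1 and drops by 2 \<pi> i under
      translation by \<tau>. Hence the sides parallel to \<tau> cancel, while the sides parallel to
      1 differ by 2 \<pi> i times their length 1.\<close>
    have t1: "contour_integral (linepath (pt (a + 1) b) (pt (a + 1) (b + 1))) ?L = contour_integral (linepath (pt a b) (pt a (b + 1))) ?L"
    proof -
      have "pt (a + 1) s = pt a s + 1" for s by (simp add: pt_def)
      then show ?thesis by (simp add: contour_integral_linepath_translate f1 d1)
    qed
    have t2: "contour_integral (linepath (pt a (b + 1)) (pt (a + 1) (b + 1))) ?L =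
        contour_integral (linepath (pt a b) (pt (a + 1) b)) ?L - 2 * of_real pi * \<i>"
    proof -
      have "pt s (b + 1) = pt s b + \<tau>" for s by (simp add: pt_def algebra_simps)
      then have "contour_integral (linepath (pt a (b + 1)) (pt (a + 1) (b + 1))) ?L =
          contour_integral (linepath (pt a b) (pt (a + 1) b)) (\<lambda>z. ?L (z + \<tau>))"
        by (simp add: contour_integral_linepath_translate)
      also have "\<dots> = contour_integral (linepath (pt a b) (pt (a + 1) b)) (\<lambda>z. ?L z - 2 * of_real pi * \<i>)"
      proof (rule contour_integral_cong[OF refl])
        fix z assume "z \<in> path_image (linepath (pt a b) (pt (a + 1) b))"
        then have "f z \<noteq> 0" using seg nz by auto
        then show "?L (z + \<tau>) = ?L z - 2 * of_real pi * \<i>"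
          unfolding ft dt using ez[of z] by (simp add: field_simps)
      qed
      also have "\<dots> = contour_integral (linepath (pt a b) (pt (a + 1) b)) ?L - 2 * of_real pi * \<i> * (pt (a + 1) b - pt a b)"
        by (subst contour_integral_diff)
          (auto intro!: contour_integrable_continuous_linepath continuous_on_subset[OF Lc seg] continuous_intros)
      also have "pt (a + 1) b - pt a b = 1" by (simp add: pt_def)
      finally show ?thesis by simp
    qed
    have "contour_integral ?g ?L = 2 * pi * \<i>"
      unfolding contour_integral_par[OF Lc] t1 t2 by simp
    with I have "(\<Sum>p\<in>?Z. of_int (zorder f p) :: complex) = of_int 1" by simp
    then have "(\<Sum>p\<in>?Z. zorder f p) = 1" unfolding of_int_sum[symmetric] by (simp only: of_int_eq_iff)
    then show ?thesis using finite_subset[OF ZS finS] by simp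
  qed
  have ex: "\<exists>w\<in>UNIV. f w \<noteq> 0" using z0 by blast
  note zoz = zorder_exist_zero[OF hol[of UNIV] open_UNIV convex_connected[OF convex_UNIV] UNIV_I ex]
  have zo: "zorder f p \<ge> 1" if "f p = 0" for p
    using zoz[of p] that by simp
  have unique: "p = q" if "f p = 0" "f q = 0" "p \<in> opar a (a + 1) b (b + 1)" "q \<in> opar a (a + 1) b (b + 1)"
    "\<And>p. p \<in> path_image (par a (a + 1) b (b + 1)) \<Longrightarrow> f p \<noteq> 0" for p q a b
  proof (rule ccontr)
    assume "p \<noteq> q"
    let ?Z = "{p\<in>opar a (a + 1) b (b + 1). f p = 0}"
    have fin: "finite ?Z" and s: "(\<Sum>p\<in>?Z. zorder f p) = 1" using count[of a b] that(5) by auto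
    have "(2::int) = (\<Sum>p\<in>{p, q}. 1)" using \<open>p \<noteq> q\<close> by simp
    also have "\<dots> \<le> (\<Sum>p\<in>{p, q}. zorder f p)" using zo that by (intro sum_mono) auto
    also have "\<dots> \<le> (\<Sum>p\<in>?Z. zorder f p)"
      by (rule sum_mono2[OF fin]) (use that zo in \<open>force+\<close>)
    finally show False using s by simp
  qed
  have zeros: "p \<in> lat" if p: "f p = 0" for p
  proof -
    \<comment> \<open>there are countably many zeros, so some period cell has none on its boundary\<close>
    have cZ: "countable {z. f z = 0}"
      using holomorphic_countable_zeros[OF hol[of UNIV]] nconst convex_connected[OF convex_UNIV] by simp
    have ex: "\<exists>a. \<forall>z. f z = 0 \<longrightarrow> h z - a \<notin> \<int>" for h :: "complex \<Rightarrow> real"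
    proof -
      have "countable ((\<lambda>(z, k). h z - of_int k) ` ({z. f z = 0} \<times> (UNIV :: int set)))"
        using cZ by (intro countable_image countable_SIGMA) auto
      then have "(\<lambda>(z, k). h z - of_int k) ` ({z. f z = 0} \<times> (UNIV :: int set)) \<noteq> UNIV"
        using uncountable_UNIV_real by metis
      then obtain a where a: "a \<notin> (\<lambda>(z, k). h z - of_int k) ` ({z. f z = 0} \<times> (UNIV :: int set))" by auto
      have "h z - a \<notin> \<int>" if "f z = 0" for z
      proof
        assume "h z - a \<in> \<int>"
        then obtain k where "h z - a = of_int k" by (auto elim: Ints_cases)
        then have "a = h z - of_int k" by simp
        then show False using a that by force
      qed
      then show ?thesis by blast
    qed
    obtain a where a: "\<And>z. f z = 0 \<Longrightarrow> cA z - a \<notin> \<int>" using ex[of cA] by auto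
    obtain b where b: "\<And>z. f z = 0 \<Longrightarrow> cB z - b \<notin> \<int>" using ex[of cB] by auto
    have bd: "f q \<noteq> 0" if "q \<in> path_image (par a (a + 1) b (b + 1))" for q
      using path_image_par(5)[OF _ _ that] a[of q] b[of q] by auto
    define rep where "rep q = q + pt (of_int (- \<lfloor>cA q - a\<rfloor>)) (of_int (- \<lfloor>cB q - b\<rfloor>))" for q
    have rep: "f (rep q) = 0" "rep q \<in> opar a (a + 1) b (b + 1)" if "f q = 0" for q
    proof -
      show "f (rep q) = 0" unfolding rep_def per by fact
      have "frac (cA q - a) > 0" "frac (cB q - b) > 0" using a[OF that] b[OF that] by (auto simp: frac_gt_0_iff)
      moreover have "frac (cA q - a) < 1" "frac (cB q - b) < 1" by (auto simp: frac_lt_1)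
      moreover have "cA (rep q) = a + frac (cA q - a)" "cB (rep q) = b + frac (cB q - b)"
        by (auto simp: rep_def cA_add cB_add frac_def)
      ultimately show "rep q \<in> opar a (a + 1) b (b + 1)" by (simp add: opar_def)
    qed
    \<comment> \<open>Both \<open>p\<close> and 0 are zeros, so their translates into the cell
      coincide with its only zero, and \<open>p\<close> is a lattice vector.\<close>
    have "rep p = rep 0" by (rule unique[of _ _ a b]) (use rep p f0 bd in auto)
    then have "p = pt (of_int (- \<lfloor>cA 0 - a\<rfloor> + \<lfloor>cA p - a\<rfloor>)) (of_int (- \<lfloor>cB 0 - b\<rfloor> + \<lfloor>cB p - b\<rfloor>))"
      unfolding rep_def by (simp add: algebra_simps pt_def)
    then show ?thesis using pt_in_lat by metis
  qed
  show "theta z \<tau> = 0 \<longleftrightarrow> (\<exists>m n. z = of_int m + of_int n * \<tau>)"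
  proof
    assume "theta z \<tau> = 0"
    then have "z \<in> lat" using zeros by (simp add: f_def)
    then show "\<exists>m n. z = of_int m + of_int n * \<tau>" by (auto simp: lat_def pt_def)
  next
    assume "\<exists>m n. z = of_int m + of_int n * \<tau>"
    then obtain m n where "z = 0 + pt (of_int m) (of_int n)" by (auto simp: pt_def)
    then show "theta z \<tau> = 0" using per[of 0 m n] f0 by (simp add: f_def)
  qed
  \<comment> \<open>Once the zeros are known to be lattice points, the cell centred at 0 is
    admissible for the count, and the count gives order 1 at 0.\<close>
  have bd: "f p \<noteq> 0" if "p \<in> path_image (par (- 1/2) (- 1/2 + 1) (- 1/2) (- 1/2 + 1))" for p
  proof
    assume "f p = 0"
    then have "cA p \<in> \<int>" "cB p \<in> \<int>" using zeros lat_iff by auto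
    moreover have "(1/2::real) \<notin> \<int>" "(- 1/2::real) \<notin> \<int>"
      using half_not_Int[of "1/2"] half_not_Int[of 0] by auto
    ultimately have "cA p \<noteq> 1/2" "cA p \<noteq> - 1/2" "cB p \<noteq> 1/2" "cB p \<noteq> - 1/2" by metis+
    then show False using path_image_par(5)[OF _ _ that] by simp
  qed
  have "{p \<in> opar (- 1/2) (- 1/2 + 1) (- 1/2) (- 1/2 + 1). f p = 0} = {0}"
  proof -
    have o: "0 \<in> opar (- 1/2) (- 1/2 + 1) (- 1/2) (- 1/2 + 1)" by (simp add: opar_def cA_def cB_def)
    then show ?thesis using unique[of _ 0 "-1/2" "-1/2"] f0 bd by blast
  qed
  then have z1: "zorder f 0 = 1" using count[of "- 1/2" "- 1/2", OF bd] by simp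
  have "\<exists>r>0. cball 0 r \<subseteq> UNIV \<and> zor_poly f 0 holomorphic_on cball 0 r \<and>
      (\<forall>w\<in>cball 0 r. f w = zor_poly f 0 w * (w - 0) ^ nat (zorder f 0) \<and> zor_poly f 0 w \<noteq> 0)"
    using zoz[of 0] by blast
  then obtain r where r: "r > 0" "zor_poly f 0 holomorphic_on cball 0 r"
      "\<And>w. w \<in> cball 0 r \<Longrightarrow> f w = zor_poly f 0 w * w" "zor_poly f 0 0 \<noteq> 0"
    unfolding z1 by auto
  have "(zor_poly f 0 has_field_derivative deriv (zor_poly f 0) 0) (at 0)"
    by (rule holomorphic_derivI[OF holomorphic_on_subset[OF r(2) ball_subset_cball]]) (use r in auto)
  then have "((\<lambda>w. zor_poly f 0 w * w) has_field_derivative zor_poly f 0 0) (at 0)"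
    by (auto intro!: derivative_eq_intros)
  then have "(f has_field_derivative zor_poly f 0 0) (at 0)"
    by (rule has_field_derivative_transform_within_open[where S = "ball 0 r"]) (use r in auto)
  then have "deriv f 0 = zor_poly f 0 0" by (rule DERIV_imp_deriv)
  then show "theta' 0 \<tau> \<noteq> 0" using r(4) by (simp add: theta'_def f_def[abs_def])
qed

subsection \<open>The functions E and F\<close>

text \<open>The residue is kept as explicit data, since it is later the summand of the lattice sum;
  the value at \<open>p\<close> itself is left free, and \<open>c = 0\<close> is allowed.\<close>

definition simple_pole_at :: "(complex \<Rightarrow> complex) \<Rightarrow> complex \<Rightarrow> complex \<Rightarrow> bool" where
  "simple_pole_at f p c \<longleftrightarrow> (\<exists>h. h analytic_on {p} \<and> (\<forall>\<^sub>F \<xi> in at p. f \<xi> = c / (\<xi> - p) + h \<xi>))"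

lemma analytic_difference_quotient:
  assumes "g analytic_on {p :: complex}"
  obtains h where "h analytic_on {p}" "h p = deriv g p" "\<forall>\<^sub>F \<xi> in nhds p. g \<xi> = g p + (\<xi> - p) * h \<xi>"
proof -
  obtain S where S: "open S" "p \<in> S" "g holomorphic_on S" using assms by (auto simp: analytic_at)
  let ?h = "\<lambda>z. if z = p then deriv g p else (g z - g p) / (z - p)"
  have "?h holomorphic_on S" by (rule pole_lemma_open[OF S(3,1)])
  then have "?h analytic_on {p}" using S analytic_at by blast
  then show ?thesis by (rule that) auto
qed

text \<open>Splitting off the zero of the denominator as T = (\<xi> - p) t with t(p) = T'(p) leaves
  the analytic function N/t, whose value at p is the residue.\<close>

lemma simple_pole_at_quotient:
  assumes N: "N analytic_on {p}" and T: "T analytic_on {p}" "T p = 0" "deriv T p \<noteq> 0"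
  shows "simple_pole_at (\<lambda>\<xi>. N \<xi> / T \<xi>) p (N p / deriv T p)"
proof -
  obtain t where t: "t analytic_on {p}" "t p = deriv T p" "\<forall>\<^sub>F \<xi> in nhds p. T \<xi> = T p + (\<xi> - p) * t \<xi>"
    using analytic_difference_quotient[OF T(1)] by blast
  have "(\<lambda>\<xi>. N \<xi> / t \<xi>) analytic_on {p}" using N t T by (intro analytic_intros) auto
  from analytic_difference_quotient[OF this] obtain h where h: "h analytic_on {p}"
    "\<forall>\<^sub>F \<xi> in nhds p. N \<xi> / t \<xi> = N p / t p + (\<xi> - p) * h \<xi>" by metis
  have "\<forall>\<^sub>F \<xi> in at p. \<xi> \<noteq> p" by (simp add: eventually_at_filter)
  moreover have "\<forall>\<^sub>F \<xi> in at p. T \<xi> = T p + (\<xi> - p) * t \<xi>"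
    and "\<forall>\<^sub>F \<xi> in at p. N \<xi> / t \<xi> = N p / t p + (\<xi> - p) * h \<xi>"
    using t(3) h(2) by (auto simp: eventually_nhds_conv_at)
  ultimately have "\<forall>\<^sub>F \<xi> in at p. N \<xi> / T \<xi> = (N p / deriv T p) / (\<xi> - p) + h \<xi>"
  proof eventually_elim
    case (elim \<xi>)
    have "N \<xi> / T \<xi> = (N \<xi> / t \<xi>) / (\<xi> - p)" by (simp add: elim(2) T(2) mult.commute)
    also have "\<dots> = (N p / t p) / (\<xi> - p) + h \<xi>" unfolding elim(3) using elim(1) by (simp add: add_divide_distrib)
    finally show ?case by (simp add: t(2))
  qed
  then show ?thesis using h(1) unfolding simple_pole_at_def by blast
qed

lemma simple_pole_at_add_analytic:
  assumes "simple_pole_at f p c" "g analytic_on {p}"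
  shows "simple_pole_at (\<lambda>\<xi>. f \<xi> + g \<xi>) p c"
proof -
  obtain h where h: "h analytic_on {p}" "\<forall>\<^sub>F \<xi> in at p. f \<xi> = c / (\<xi> - p) + h \<xi>"
    using assms(1) unfolding simple_pole_at_def by blast
  have "(\<lambda>\<xi>. h \<xi> + g \<xi>) analytic_on {p}" using h assms by (intro analytic_intros)
  moreover have "\<forall>\<^sub>F \<xi> in at p. f \<xi> + g \<xi> = c / (\<xi> - p) + (h \<xi> + g \<xi>)"
    using h(2) by eventually_elim simp
  ultimately show ?thesis unfolding simple_pole_at_def by blast
qed

text \<open>Serves both kinds of quasi-periodicity at once: the additive constant \<open>b\<close>
  disappears in the analytic part, and only the multiplier \<open>a\<close> reaches the
  residue.\<close>

lemma simple_pole_at_shift: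
  assumes "simple_pole_at f p c" "\<forall>\<^sub>F \<xi> in at p. f (\<xi> + w) = a * f \<xi> + b"
  shows "simple_pole_at f (p + w) (a * c)"
proof -
  obtain h where h: "h analytic_on {p}" "\<forall>\<^sub>F \<xi> in at p. f \<xi> = c / (\<xi> - p) + h \<xi>"
    using assms(1) unfolding simple_pole_at_def by blast
  have "\<forall>\<^sub>F \<xi> in at p. f (\<xi> + w) = (a * c) / ((\<xi> + w) - (p + w)) + (a * h ((\<xi> + w) - w) + b)"
    using h(2) assms(2) by eventually_elim (simp add: algebra_simps)
  moreover have "at (p + w) = filtermap (\<lambda>\<xi>. \<xi> + w) (at p)"
    using filtermap_at_shift[of "- w" p] by simp
  ultimately have "\<forall>\<^sub>F \<xi> in at (p + w). f \<xi> = (a * c) / (\<xi> - (p + w)) + (a * h (\<xi> - w) + b)"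
    by (simp add: eventually_filtermap)
  moreover have "(h \<circ> (\<lambda>\<xi>. \<xi> - w)) analytic_on {p + w}"
    using h(1) by (intro analytic_on_compose analytic_intros) auto
  then have "(\<lambda>\<xi>. a * h (\<xi> - w) + b) analytic_on {p + w}"
    unfolding o_def by (intro analytic_intros)
  ultimately show ?thesis unfolding simple_pole_at_def by blast
qed

text \<open>For |Re W| > 1 the triangle inequality suffices; in the remaining strip, periodicity
  moves W into a compact set on which exp W - 1 has no zero. The factor 1 + exp (Re W) records the
  right order of magnitude in both directions.\<close>

lemma norm_exp_minus_1_lower:
  assumes "\<delta> > 0"
  obtains c where "c > 0" "\<And>W. (\<And>n::int. norm (W - of_int n * (2 * of_real pi * \<i>)) \<ge> \<delta>) \<Longrightarrow> c * (1 + exp (Re W)) \<le> norm (exp W - 1)"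
proof -
  \<comment> \<open>One period of the strip |Re W| \<le> 1; of the points 2 \<pi> i n only 0 lies in
    it, and the disc about 0 is removed.\<close>
  define K where "K = cbox (Complex (-1) (- pi)) (Complex 1 pi) - ball 0 \<delta>"
  have K: "compact K" unfolding K_def by (intro compact_diff) auto
  have nz: "exp W - 1 \<noteq> 0" if "W \<in> K" for W
  proof
    assume "exp W - 1 = 0"
    then obtain n :: int where n: "Re W = 0" "Im W = of_int (2 * n) * pi" by (auto simp: exp_eq_1)
    have W: "- pi \<le> Im W" "Im W \<le> pi" "norm W \<ge> \<delta>" using that by (auto simp: K_def in_cbox_complex_iff)
    have "of_int (2 * n) * pi \<le> 1 * pi" "(-1) * pi \<le> of_int (2 * n) * pi" using W n by auto
    then have "of_int (2 * n) \<le> (1::real)" "(-1::real) \<le> of_int (2 * n)"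
      using pi_gt_zero by (simp_all only: mult_le_cancel_right)
    then have "n = 0" by linarith
    then have "W = 0" using n by (simp add: complex_eq_iff)
    then show False using W assms by simp
  qed
  have "\<exists>\<mu>>0. \<forall>W\<in>K. \<mu> \<le> norm (exp W - 1)"
  proof (cases "K = {}")
    case False
    have "continuous_on K (\<lambda>W. norm (exp W - 1))" by (intro continuous_intros)
    from continuous_attains_inf[OF K False this] obtain W0 where
      "W0 \<in> K" "\<forall>W\<in>K. norm (exp W0 - 1) \<le> norm (exp W - 1)" by blast
    then show ?thesis using nz by (intro exI[of _ "norm (exp W0 - 1)"]) auto
  qed (auto intro: exI[of _ 1])
  then obtain \<mu> where \<mu>: "\<mu> > 0" "\<And>W. W \<in> K \<Longrightarrow> \<mu> \<le> norm (exp W - 1)" by blast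
  \<comment> \<open>The value 1/4 serves |Re W| > 1, where exp (Re W) is at least 2 or at most 1/2;
    the second value serves the strip, where 1 + exp (Re W) \<le> 1 + e.\<close>
  define c where "c = min (1/4) (\<mu> / (1 + exp 1))"
  have e1: "1 + exp (1::real) > 0" by (simp add: add_pos_pos)
  have c: "c > 0" using \<mu>(1) e1 by (simp add: c_def)
  have cle: "c \<le> 1/4" "c \<le> \<mu> / (1 + exp 1)"
    unfolding c_def by (rule min.cobounded1, rule min.cobounded2)
  have "c * (1 + exp (Re W)) \<le> norm (exp W - 1)"
    if W: "\<And>n::int. norm (W - of_int n * (2 * of_real pi * \<i>)) \<ge> \<delta>" for W
  proof -
    have "\<bar>exp (Re W) - 1\<bar> \<le> norm (exp W - 1)"
      using norm_triangle_ineq3[of "exp W" 1] by (simp add: norm_exp_eq_Re)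
    then have tri: "exp (Re W) - 1 \<le> norm (exp W - 1)" "1 - exp (Re W) \<le> norm (exp W - 1)"
      by (auto simp only: abs_le_iff minus_diff_eq)
    have c4: "c * (1 + exp (Re W)) \<le> 1/4 * (1 + exp (Re W))"
      by (intro mult_right_mono cle add_nonneg_nonneg) auto
    consider "Re W > 1" | "Re W < -1" | "\<bar>Re W\<bar> \<le> 1" by linarith
    then show ?thesis
    proof cases
      case 1
      then have "exp (Re W) \<ge> 2" using exp_ge_add_one_self[of "Re W"] by linarith
      then have "1/4 * (1 + exp (Re W)) \<le> norm (exp W - 1)" using tri by (simp add: algebra_simps)
      with c4 show ?thesis by (rule order_trans)
    next
      case 2
      have "exp (- Re W) \<ge> 2" using exp_ge_add_one_self[of "- Re W"] 2 by linarith
      then have "exp (Re W) \<le> 1/2" by (simp add: exp_minus field_simps)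
      then have "1/4 * (1 + exp (Re W)) \<le> norm (exp W - 1)" using tri by (simp add: algebra_simps)
      with c4 show ?thesis by (rule order_trans)
    next
      case 3
      define n where "n = \<lfloor>Im W / (2 * pi) + 1/2\<rfloor>"
      define V where "V = W - of_int n * (2 * of_real pi * \<i>)"
      have "of_int n \<le> Im W / (2 * pi) + 1/2" "Im W / (2 * pi) + 1/2 < of_int n + 1"
        unfolding n_def by linarith+
      then have "- pi \<le> Im V" "Im V \<le> pi" by (auto simp: V_def field_simps)
      moreover have "Re V = Re W" by (simp add: V_def)
      moreover have "norm V \<ge> \<delta>" using W V_def by blast
      ultimately have "V \<in> K" using 3 by (auto simp: K_def in_cbox_complex_iff)
      then have "\<mu> \<le> norm (exp V - 1)" by (rule \<mu>)
      also have "exp V = exp W"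
        unfolding V_def exp_diff using exp_integer_2pi[of "of_int n"] by (simp add: mult_ac)
      finally have "\<mu> \<le> norm (exp W - 1)" .
      moreover have "c * (1 + exp (Re W)) \<le> \<mu> / (1 + exp 1) * (1 + exp 1)"
        using 3 \<mu>(1) e1 by (intro mult_mono cle add_nonneg_nonneg divide_nonneg_pos) auto
      ultimately show ?thesis using e1 by simp
    qed
  qed
  then show ?thesis using c that by blast
qed

section \<open>Poles, quasi-periodicity and size of \<open>frakF\<close>\<close>

context period_pair
begin

text \<open>The poles of \<open>frakF\<close>.\<close>

definition lin :: "complex set" where "lin = range (\<lambda>n::int. of_int n * \<omega>2)"

text \<open>The rate at which \<open>frakF\<close> decays along \<open>\<omega>1\<close>: \<open>exp (2\<pi>i\<xi>/\<omega>2)\<close> has modulus \<open>exp (\<kappa> * cA \<xi>)\<close>.\<close>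

definition \<kappa> :: real where "\<kappa> = - 2 * pi * Im (\<omega>1 / \<omega>2)"

text \<open>With a = \<open>cA \<xi>\<close>, \<open>frakF \<xi> z \<omega>2\<close> behaves like
  exp(z \<kappa> a) for a to -\<infinity> and like exp(-(1 - z) \<kappa> a) for a to \<infinity>;
  the slower of the two rates counts, and the power r multiplies it.\<close>

abbreviation decay :: "nat \<Rightarrow> real \<Rightarrow> real \<Rightarrow> real" where
  "decay r z t \<equiv> exp (- (real r * (min z (1 - z) * \<kappa>) * t))"

lemma kappa_pos: "\<kappa> > 0"
proof -
  have "Im (\<omega>1 / \<omega>2) = - Im (\<omega>2 / \<omega>1) / (norm (\<omega>2 / \<omega>1))\<^sup>2"
  proof -
    have "\<omega>1 / \<omega>2 = inverse (\<omega>2 / \<omega>1)" by simp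
    then show ?thesis by (simp only: inverse_complex.sel cmod_power2)
  qed
  moreover have "norm (\<omega>2 / \<omega>1) > 0" using nz1 nz2 by simp
  ultimately have "Im (\<omega>1 / \<omega>2) < 0" using Im_ratio by (simp add: divide_neg_pos)
  then show ?thesis using pi_gt_zero by (simp add: \<kappa>_def mult_pos_neg)
qed

lemma Re_exponent: "Re (2 * of_real pi * \<i> * \<xi> / \<omega>2) = \<kappa> * cA \<xi>"
proof -
  have "\<xi> / \<omega>2 = of_real (cA \<xi>) * (\<omega>1 / \<omega>2) + of_real (cB \<xi>)"
    using nz2 pt_coords[of \<xi>] unfolding pt_def by (simp add: field_simps)
  then have "Im (\<xi> / \<omega>2) = cA \<xi> * Im (\<omega>1 / \<omega>2)" by (simp del: times_divide_eq_right)
  moreover have "2 * of_real pi * \<i> * \<xi> / \<omega>2 = of_real (2 * pi) * (\<i> * (\<xi> / \<omega>2))" by simp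
  then have "Re (2 * of_real pi * \<i> * \<xi> / \<omega>2) = - 2 * pi * Im (\<xi> / \<omega>2)"
    by (simp only: Re_complex_of_real Im_complex_of_real times_complex.sel) simp
  ultimately show ?thesis by (simp add: \<kappa>_def)
qed

lemma frakF_denom_zero: "exp (2 * of_real pi * \<i> * \<xi> / \<omega>2) - 1 = 0 \<longleftrightarrow> \<xi> \<in> lin"
proof
  assume "exp (2 * of_real pi * \<i> * \<xi> / \<omega>2) - 1 = 0"
  then have "exp (2 * of_real pi * \<i> * (\<xi> / \<omega>2)) = exp 0" by simp
  then obtain n :: int where "2 * of_real pi * \<i> * (\<xi> / \<omega>2) = 0 + of_int (2 * n) * pi * \<i>"
    unfolding exp_eq by blast
  then have "2 * of_real pi * \<i> * (\<xi> / \<omega>2) = 2 * of_real pi * \<i> * of_int n" by simp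
  then have "\<xi> / \<omega>2 = of_int n" by (simp only: mult_cancel_left) simp
  then have "\<xi> = of_int n * \<omega>2" using nz2 by (simp add: field_simps)
  then show "\<xi> \<in> lin" by (auto simp: lin_def)
next
  assume "\<xi> \<in> lin"
  then obtain n :: int where "\<xi> = of_int n * \<omega>2" by (auto simp: lin_def)
  then show "exp (2 * of_real pi * \<i> * \<xi> / \<omega>2) - 1 = 0"
    using nz2 exp_integer_2pi[of "of_int n"] by (simp add: mult_ac)
qed

lemma lin_eq: "lin = {\<xi>\<in>lat. cA \<xi> = 0}"
proof -
  have e: "of_int n * \<omega>2 = pt (of_int 0) (of_int n)" for n by (simp add: pt_def)
  show ?thesis
  proof
    show "lin \<subseteq> {\<xi>\<in>lat. cA \<xi> = 0}" unfolding lin_def e by (auto simp del: of_int_0)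
    show "{\<xi>\<in>lat. cA \<xi> = 0} \<subseteq> lin" unfolding lin_def e by (auto simp: lat_def)
  qed
qed

lemma closed_lin: "closed lin"
proof -
  have "closed {\<xi>. exp (2 * of_real pi * \<i> * \<xi> / \<omega>2) - 1 = 0}"
    using nz2 by (intro closed_Collect_eq continuous_intros) auto
  then show ?thesis by (simp only: frakF_denom_zero Collect_mem_eq)
qed

lemma holomorphic_frakF: "(\<lambda>\<xi>. frakF \<xi> s \<omega>2) holomorphic_on - lin"
  unfolding frakF_def by (intro holomorphic_intros) (use nz2 in \<open>simp_all only: frakF_denom_zero, auto\<close>)

lemma simple_pole_frakF: "simple_pole_at (\<lambda>\<xi>. frakF \<xi> s \<omega>2) 0 1"
proof -
  let ?N = "\<lambda>\<xi>. 2 * of_real pi * \<i> / \<omega>2 * exp (2 * of_real pi * \<i> * \<xi> * of_real s / \<omega>2)"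
  let ?T = "\<lambda>\<xi>. exp (2 * of_real pi * \<i> * \<xi> / \<omega>2) - 1"
  have "(?T has_field_derivative 2 * of_real pi * \<i> / \<omega>2) (at 0)"
    using nz2 by (auto intro!: derivative_eq_intros)
  then have d: "deriv ?T 0 = 2 * of_real pi * \<i> / \<omega>2" by (rule DERIV_imp_deriv)
  have "simple_pole_at (\<lambda>\<xi>. ?N \<xi> / ?T \<xi>) 0 (?N 0 / deriv ?T 0)"
    by (rule simple_pole_at_quotient) (use nz2 in \<open>auto simp: d intro!: analytic_intros\<close>)
  then show ?thesis using nz2 by (simp add: d frakF_def[abs_def])
qed

lemma frakF_shift: "frakF (\<xi> + \<omega>2) s \<omega>2 = exp (2 * of_real pi * \<i> * of_real s) * frakF \<xi> s \<omega>2"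
proof -
  have "2 * of_real pi * \<i> * (\<xi> + \<omega>2) * of_real s / \<omega>2 = 2 * of_real pi * \<i> * of_real s + 2 * of_real pi * \<i> * \<xi> * of_real s / \<omega>2"
    "2 * of_real pi * \<i> * (\<xi> + \<omega>2) / \<omega>2 = 2 * of_real pi * \<i> * \<xi> / \<omega>2 + 2 * of_real pi * \<i>"
    using nz2 by (simp_all add: field_simps)
  then show ?thesis unfolding frakF_def by (simp add: exp_add)
qed

text \<open>The numerator has modulus exp(s \<kappa> a), the denominator is at least of order 1 +
  exp(\<kappa> a) away from the poles. One \<open>C\<close> serves all \<open>s\<close>, which later
  gives majorants uniform in z.\<close>

lemma frakF_bound:
  assumes "\<delta> > 0"
  shows "\<exists>C>0. \<forall>s \<xi>. 0 \<le> s \<longrightarrow> s \<le> 1 \<longrightarrow> (\<forall>n::int. norm (\<xi> - of_int n * \<omega>2) \<ge> \<delta>) \<longrightarrow>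
    norm (frakF \<xi> s \<omega>2) \<le> C * exp (- (min s (1 - s) * \<kappa> * \<bar>cA \<xi>\<bar>))"
proof -
  have n2: "norm \<omega>2 > 0" using nz2 by simp
  define \<delta>' where "\<delta>' = 2 * pi * \<delta> / norm \<omega>2"
  have "\<delta>' > 0" using assms n2 by (simp add: \<delta>'_def)
  from norm_exp_minus_1_lower[OF this] obtain c where c: "c > 0"
    "\<And>W. (\<And>n::int. norm (W - of_int n * (2 * of_real pi * \<i>)) \<ge> \<delta>') \<Longrightarrow> c * (1 + exp (Re W)) \<le> norm (exp W - 1)"
    by blast
  define C where "C = 2 * pi / norm \<omega>2 / c"
  have "C > 0" using c n2 by (simp add: C_def)
  moreover have "norm (frakF \<xi> s \<omega>2) \<le> C * exp (- (min s (1 - s) * \<kappa> * \<bar>cA \<xi>\<bar>))"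
    if s: "0 \<le> s" "s \<le> 1" and far: "\<And>n::int. norm (\<xi> - of_int n * \<omega>2) \<ge> \<delta>" for s \<xi>
  proof -
    define W where "W = 2 * of_real pi * \<i> * \<xi> / \<omega>2"
    define a where "a = \<kappa> * cA \<xi>"
    have ReW: "Re W = a" unfolding W_def a_def by (rule Re_exponent)
    have "norm (W - of_int n * (2 * of_real pi * \<i>)) \<ge> \<delta>'" for n :: int
    proof -
      have "W - of_int n * (2 * of_real pi * \<i>) = 2 * of_real pi * \<i> * (\<xi> - of_int n * \<omega>2) / \<omega>2"
        using nz2 by (simp add: W_def field_simps)
      then have "norm (W - of_int n * (2 * of_real pi * \<i>)) = 2 * pi * norm (\<xi> - of_int n * \<omega>2) / norm \<omega>2"
        by (simp add: norm_mult norm_divide)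
      then show ?thesis using far[of n] n2 by (simp add: \<delta>'_def divide_right_mono)
    qed
    then have low: "c * (1 + exp a) \<le> norm (exp W - 1)" using c(2)[of W] ReW by simp
    have pos: "c * (1 + exp a) > 0" using c(1) by (simp add: add_pos_pos)
    have "frakF \<xi> s \<omega>2 = 2 * of_real pi * \<i> / \<omega>2 * (exp (of_real s * W) / (exp W - 1))"
      by (simp add: frakF_def W_def mult_ac)
    then have "norm (frakF \<xi> s \<omega>2) = 2 * pi / norm \<omega>2 * (exp (s * a) / norm (exp W - 1))"
      by (simp add: norm_mult norm_divide norm_exp_eq_Re ReW)
    also have "\<dots> \<le> 2 * pi / norm \<omega>2 * (exp (s * a) / (c * (1 + exp a)))"
      by (intro mult_left_mono frac_le low pos) auto
    also have "\<dots> = C * (exp (s * a) / (1 + exp a))" by (simp add: C_def)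
    also have "exp (s * a) / (1 + exp a) \<le> exp (- (min s (1 - s) * \<bar>a\<bar>))"
    proof (cases "a \<ge> 0")
      case True
      have "exp (s * a) / (1 + exp a) \<le> exp (s * a) / exp a" by (intro divide_left_mono) (auto simp: add_pos_pos)
      also have "\<dots> = exp (- ((1 - s) * a))" by (simp add: exp_diff[symmetric] algebra_simps)
      also have "\<dots> \<le> exp (- (min s (1 - s) * \<bar>a\<bar>))"
        using True by (auto intro!: mult_right_mono)
      finally show ?thesis .
    next
      case False
      have "exp (s * a) / (1 + exp a) \<le> exp (s * a) / 1" by (intro divide_left_mono) (auto simp: add_pos_pos)
      also have "\<dots> = exp (- (s * \<bar>a\<bar>))" using False by simp
      also have "\<dots> \<le> exp (- (min s (1 - s) * \<bar>a\<bar>))"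
        by (auto intro!: mult_right_mono)
      finally show ?thesis .
    qed
    finally show ?thesis using \<open>C > 0\<close> kappa_pos by (simp add: a_def abs_mult mult_ac)
  qed
  ultimately show ?thesis by blast
qed

section \<open>Poles, quasi-periodicity and size of \<open>frakE\<close>\<close>

lemma theta_denom_zero: "theta (\<xi> / \<omega>1) (\<omega>2 / \<omega>1) = 0 \<longleftrightarrow> \<xi> \<in> lat"
proof -
  have "\<xi> / \<omega>1 = of_int m + of_int n * (\<omega>2 / \<omega>1) \<longleftrightarrow> \<xi> = pt (of_int m) (of_int n)" for m n
    using nz1 by (simp add: pt_def field_simps)
  then show ?thesis
    unfolding theta_zeros_and_deriv(1)[OF Im_ratio] lat_def by auto
qed

text \<open>The zeros of theta are lattice points, and a lattice point with both coordinates of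
  modulus below 1 is 0.\<close>

lemma theta_shift_nonzero:
  assumes "-1 < x" "x < 1" "-1 < y" "y < 1" "(x, y) \<noteq> (0, 0)"
  shows "theta (of_real x * (\<omega>2 / \<omega>1) - of_real y) (\<omega>2 / \<omega>1) \<noteq> 0"
proof
  assume "theta (of_real x * (\<omega>2 / \<omega>1) - of_real y) (\<omega>2 / \<omega>1) = 0"
  moreover have "of_real x * (\<omega>2 / \<omega>1) - of_real y = pt (- y) x / \<omega>1"
    by (simp add: pt_div)
  ultimately have "pt (- y) x \<in> lat" using theta_denom_zero by simp
  then obtain m n :: int where "- y = of_int m" "x = of_int n" by (auto simp: lat_def pt_inj)
  then have "m = 0" "n = 0" using assms by linarith+
  then show False using assms(5) \<open>- y = _\<close> \<open>x = _\<close> \<open>m = 0\<close> \<open>n = 0\<close> by simp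
qed

lemma analytic_theta [analytic_intros]:
  "f analytic_on S \<Longrightarrow> (\<lambda>\<xi>. theta (f \<xi>) (\<omega>2 / \<omega>1)) analytic_on S"
  using analytic_on_compose_gen[of f S "\<lambda>w. theta w (\<omega>2 / \<omega>1)" UNIV] holomorphic_theta[OF Im_ratio]
  by (simp add: o_def analytic_on_open)

lemma analytic_theta' [analytic_intros]:
  "f analytic_on S \<Longrightarrow> (\<lambda>\<xi>. theta' (f \<xi>) (\<omega>2 / \<omega>1)) analytic_on S"
proof -
  assume f: "f analytic_on S"
  have "(\<lambda>w. theta' w (\<omega>2 / \<omega>1)) holomorphic_on UNIV"
    unfolding theta'_def using holomorphic_theta[OF Im_ratio] by (intro holomorphic_deriv) auto
  then show ?thesis
    using analytic_on_compose_gen[OF f, of "\<lambda>w. theta' w (\<omega>2 / \<omega>1)" UNIV]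
    by (simp add: o_def analytic_on_open)
qed

lemma closed_lat: "closed lat"
proof -
  have "closed {\<xi>. theta (\<xi> / \<omega>1) (\<omega>2 / \<omega>1) = 0}"
    by (intro closed_Collect_eq continuous_on_const analytic_imp_holomorphic[THEN holomorphic_on_imp_continuous_on]
        analytic_intros) (use nz1 in auto)
  then show ?thesis by (simp only: theta_denom_zero Collect_mem_eq)
qed

lemma deriv_theta_scaled: "deriv (\<lambda>\<xi>. theta (\<xi> / \<omega>1) (\<omega>2 / \<omega>1)) \<xi> = theta' (\<xi> / \<omega>1) (\<omega>2 / \<omega>1) / \<omega>1"
proof -
  note has_field_derivative_theta[OF Im_ratio, of "\<xi> / \<omega>1"]
  then have "((\<lambda>\<xi>. theta (\<xi> / \<omega>1) (\<omega>2 / \<omega>1)) has_field_derivative theta' (\<xi> / \<omega>1) (\<omega>2 / \<omega>1) * (1 / \<omega>1)) (at \<xi>)"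
    by (rule DERIV_chain2[where f = "\<lambda>w. theta w (\<omega>2 / \<omega>1)" and g = "\<lambda>\<xi>. \<xi> / \<omega>1"])
      (use nz1 in \<open>auto intro!: derivative_eq_intros\<close>)
  then show ?thesis using DERIV_imp_deriv by fastforce
qed

definition good :: "real \<Rightarrow> real \<Rightarrow> bool" where
  "good x y \<longleftrightarrow> -1 < x \<and> x < 1 \<and> -1 < y \<and> y < 1"

text \<open>\<open>frakE\<close> with \<open>x = y = 0\<close> is only additively quasi-periodic along \<open>\<omega>1\<close>.\<close>

definition Ejump :: "real \<Rightarrow> real \<Rightarrow> complex" where
  "Ejump x y = (if (x, y) = (0, 0) then 2 * of_real pi * \<i> / \<omega>2 else 0)"

lemma analytic_frakE: "(\<lambda>\<xi>. frakE \<xi> x y \<omega>1 \<omega>2) analytic_on - lat"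
proof (cases "(x, y) = (0, 0)")
  case True
  show ?thesis unfolding frakE_def Let_def if_P[OF True]
    by (intro analytic_intros) (use nz1 nz2 theta_denom_zero in auto)
next
  case False
  show ?thesis
  proof (cases "theta (of_real x * (\<omega>2 / \<omega>1) - of_real y) (\<omega>2 / \<omega>1) = 0")
    case True
    \<comment> \<open>The vanishing factor is a constant in the denominator, so division by zero
      makes \<open>frakE\<close> the zero function.\<close>
    then show ?thesis unfolding frakE_def Let_def if_not_P[OF False] by simp
  next
    case nz: False
    show ?thesis unfolding frakE_def Let_def if_not_P[OF False]
      by (intro analytic_intros) (use nz1 nz theta_denom_zero in auto)
  qed
qed

text \<open>The constants in \<open>frakE\<close> normalise the residue: theta(\<xi>/\<omega>1) has
  derivative theta'(0)/\<omega>1 at 0, and the remaining theta factors cancel there.\<close>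

lemma simple_pole_frakE_0:
  assumes "good x y"
  shows "simple_pole_at (\<lambda>\<xi>. frakE \<xi> x y \<omega>1 \<omega>2) 0 1"
proof -
  let ?t = "\<omega>2 / \<omega>1"
  let ?T = "\<lambda>\<xi>. theta (\<xi> / \<omega>1) ?t"
  have nz': "theta' 0 ?t \<noteq> 0" by (rule theta_zeros_and_deriv(2)[OF Im_ratio])
  have d: "deriv ?T 0 = theta' 0 ?t / \<omega>1" by (simp add: deriv_theta_scaled)
  have T: "?T analytic_on {0}" by (intro analytic_intros) (use nz1 in auto)
  show ?thesis
  proof (cases "(x, y) = (0, 0)")
    case True
    let ?N = "\<lambda>\<xi>. theta' (\<xi> / \<omega>1) ?t / \<omega>1"
    have "simple_pole_at (\<lambda>\<xi>. ?N \<xi> / ?T \<xi> + 2 * of_real pi * \<i> * \<xi> / (\<omega>1 * \<omega>2)) 0 (?N 0 / deriv ?T 0)"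
      by (intro simple_pole_at_add_analytic simple_pole_at_quotient T analytic_intros)
        (use nz1 nz2 nz' d in auto)
    then show ?thesis unfolding frakE_def Let_def if_P[OF True] using nz1 nz' by (simp add: d mult_ac)
  next
    case False
    let ?v = "of_real x * ?t - of_real y"
    have v: "theta ?v ?t \<noteq> 0" using theta_shift_nonzero[of x y] assms False by (auto simp: good_def)
    let ?N = "\<lambda>\<xi>. exp (2 * of_real pi * \<i> * of_real x * \<xi> / \<omega>1) / \<omega>1
       * (theta' 0 ?t * theta (\<xi> / \<omega>1 + of_real x * ?t - of_real y) ?t / theta ?v ?t)"
    have "simple_pole_at (\<lambda>\<xi>. ?N \<xi> / ?T \<xi>) 0 (?N 0 / deriv ?T 0)"
      by (intro simple_pole_at_quotient T analytic_intros) (use nz1 nz2 nz' v d in auto)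
    moreover have "?N 0 / deriv ?T 0 = 1" using nz1 nz' v by (simp add: d)
    moreover have "frakE \<xi> x y \<omega>1 \<omega>2 = ?N \<xi> / ?T \<xi>" for \<xi>
      unfolding frakE_def Let_def if_not_P[OF False] by (simp add: mult_ac)
    ultimately show ?thesis by simp
  qed
qed

text \<open>The extra terms of \<open>frakE\<close> are made for this period. For
  \<open>x = y = 0\<close> the linear term grows by 2 \<pi> i/\<omega>1 and cancels the loss of
  theta'/theta; otherwise the exponential prefactor gains exp(2 \<pi> i x \<tau>), which turns the
  multiplier exp(-2 \<pi> i (x \<tau> - y)) of theta into exp(2 \<pi> i y).\<close>

lemma frakE_shift2:
  assumes "\<xi> \<notin> lat"
  shows "frakE (\<xi> + \<omega>2) x y \<omega>1 \<omega>2 = exp (2 * of_real pi * \<i> * of_real y) * frakE \<xi> x y \<omega>1 \<omega>2"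
proof -
  define t where "t = \<omega>2 / \<omega>1"
  have t: "Im t > 0" using Im_ratio by (simp add: t_def)
  have s: "(\<xi> + \<omega>2) / \<omega>1 = \<xi> / \<omega>1 + t" by (simp add: t_def add_divide_distrib)
  define e where "e z = - exp (- of_real pi * \<i> * t - 2 * of_real pi * \<i> * z)" for z
  have e0: "e z \<noteq> 0" for z by (simp add: e_def)
  have th: "theta (z + t) t = e z * theta z t" for z unfolding e_def by (rule theta_plus_tau)
  have nz: "theta (\<xi> / \<omega>1) t \<noteq> 0" using assms theta_denom_zero by (simp add: t_def)
  show ?thesis
  proof (cases "(x, y) = (0, 0)")
    case True
    have dt: "theta' (z + t) t = e z * (theta' z t - 2 * of_real pi * \<i> * theta z t)" for z
      unfolding e_def by (rule theta'_plus_tau[OF t])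
    have q: "theta' (\<xi> / \<omega>1 + t) t / theta (\<xi> / \<omega>1 + t) t = theta' (\<xi> / \<omega>1) t / theta (\<xi> / \<omega>1) t - 2 * of_real pi * \<i>"
      unfolding dt th using nz e0[of "\<xi> / \<omega>1"] by (simp add: field_simps)
    show ?thesis using True nz1 nz2
      unfolding frakE_def Let_def if_P[OF True] t_def[symmetric] s q
      by (simp add: add_divide_distrib diff_divide_distrib distrib_left)
  next
    case False
    let ?v = "of_real x * t - of_real y :: complex"
    have s': "\<xi> / \<omega>1 + t + of_real x * t - of_real y = (\<xi> / \<omega>1 + of_real x * t - of_real y) + t" by simp
    have ee: "e (\<xi> / \<omega>1 + of_real x * t - of_real y) = exp (- 2 * of_real pi * \<i> * ?v) * e (\<xi> / \<omega>1)"
      unfolding e_def by (simp add: exp_add[symmetric] algebra_simps)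
    have x: "exp (2 * of_real pi * \<i> * of_real x * (\<xi> + \<omega>2) / \<omega>1) = exp (2 * of_real pi * \<i> * of_real x * t) * exp (2 * of_real pi * \<i> * of_real x * \<xi> / \<omega>1)"
      by (simp add: exp_add[symmetric] t_def algebra_simps add_divide_distrib)
    have y: "exp (2 * of_real pi * \<i> * of_real x * t) * exp (- 2 * of_real pi * \<i> * ?v) = exp (2 * of_real pi * \<i> * of_real y)"
      by (simp add: exp_add[symmetric] algebra_simps)
    show ?thesis
      unfolding frakE_def Let_def if_not_P[OF False] t_def[symmetric] s s' th ee x y[symmetric]
      using e0[of "\<xi> / \<omega>1"] by simp
  qed
qed

text \<open>Here theta'/theta is periodic, so for \<open>x = y = 0\<close> the increase of the
  linear term remains as the jump.\<close>

lemma frakE_shift1: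
  "frakE (\<xi> + \<omega>1) x y \<omega>1 \<omega>2 = exp (2 * of_real pi * \<i> * of_real x) * frakE \<xi> x y \<omega>1 \<omega>2 + Ejump x y"
proof -
  define t where "t = \<omega>2 / \<omega>1"
  have t: "Im t > 0" using Im_ratio by (simp add: t_def)
  have s: "(\<xi> + \<omega>1) / \<omega>1 = \<xi> / \<omega>1 + 1" using nz1 by (simp add: add_divide_distrib)
  show ?thesis
  proof (cases "(x, y) = (0, 0)")
    case True
    show ?thesis using True nz1 nz2
      unfolding frakE_def Let_def if_P[OF True] t_def[symmetric] s theta'_plus_1[OF t] theta_plus_1 Ejump_def by (simp add: field_simps)
  next
    case False
    have s': "\<xi> / \<omega>1 + 1 + of_real x * t - of_real y = (\<xi> / \<omega>1 + of_real x * t - of_real y) + 1" by simp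
    have x: "exp (2 * of_real pi * \<i> * of_real x * (\<xi> + \<omega>1) / \<omega>1) = exp (2 * of_real pi * \<i> * of_real x) * exp (2 * of_real pi * \<i> * of_real x * \<xi> / \<omega>1)"
      using nz1 by (simp add: exp_add[symmetric] algebra_simps add_divide_distrib)
    show ?thesis
      unfolding frakE_def Let_def if_not_P[OF False] t_def[symmetric] s s' theta_plus_1 x Ejump_def by simp
  qed
qed

lemma lat_add: "\<xi> + pt (of_int m) (of_int n) \<in> lat \<longleftrightarrow> \<xi> \<in> lat"
  by (simp add: lat_iff cA_add cB_add)

lemma char_mult: "exp (2 * of_real pi * \<i> * of_real x) ^ m = exp (2 * of_real pi * \<i> * (of_nat m * of_real x))"
  by (simp add: exp_of_nat_mult[symmetric] mult_ac)

lemma frakE_shift_nat: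
  assumes "\<xi> \<notin> lat"
  shows "frakE (\<xi> + pt (real m) (real n)) x y \<omega>1 \<omega>2 =
    exp (2 * of_real pi * \<i> * (of_nat m * of_real x + of_nat n * of_real y)) * frakE \<xi> x y \<omega>1 \<omega>2 + of_nat m * Ejump x y"
proof (induction m)
  case 0
  show ?case
  proof (induction n)
    case (Suc n)
    have nl: "\<xi> + pt (real 0) (real n) \<notin> lat" using lat_add[of \<xi> 0 "int n"] assms by simp
    have "\<xi> + pt (real 0) (real (Suc n)) = (\<xi> + pt (real 0) (real n)) + \<omega>2"
      by (simp add: pt_def algebra_simps)
    moreover have "exp (2 * of_real pi * \<i> * (of_nat 0 * of_real x + of_nat (Suc n) * of_real y)) =
        exp (2 * of_real pi * \<i> * of_real y) * exp (2 * of_real pi * \<i> * (of_nat 0 * of_real x + of_nat n * of_real y))"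
      by (simp add: exp_add[symmetric] algebra_simps)
    ultimately show ?case using Suc frakE_shift2[OF nl] by (simp add: add.assoc)
  qed (simp add: pt_def)
next
  case (Suc m)
  have "\<xi> + pt (real (Suc m)) (real n) = (\<xi> + pt (real m) (real n)) + \<omega>1"
    by (simp add: pt_def algebra_simps)
  then have "frakE (\<xi> + pt (real (Suc m)) (real n)) x y \<omega>1 \<omega>2 =
     exp (2 * of_real pi * \<i> * of_real x) * (exp (2 * of_real pi * \<i> * (of_nat m * of_real x + of_nat n * of_real y)) * frakE \<xi> x y \<omega>1 \<omega>2 + of_nat m * Ejump x y) + Ejump x y"
    using Suc by (simp only: frakE_shift1)
  \<comment> \<open>The multiplier fixes the jump: for \<open>x = y = 0\<close> it is 1, and
    otherwise the jump is 0.\<close>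
  also have "\<dots> = exp (2 * of_real pi * \<i> * of_real x) * exp (2 * of_real pi * \<i> * (of_nat m * of_real x + of_nat n * of_real y)) * frakE \<xi> x y \<omega>1 \<omega>2
      + of_nat (Suc m) * Ejump x y"
    by (auto simp: Ejump_def algebra_simps)
  finally show ?case by (simp add: exp_add[symmetric] algebra_simps)
qed

lemma frakE_shift:
  assumes "\<xi> \<notin> lat"
  shows "frakE (\<xi> + pt (of_int m) (of_int n)) x y \<omega>1 \<omega>2 =
    exp (2 * of_real pi * \<i> * (of_int m * of_real x + of_int n * of_real y)) * frakE \<xi> x y \<omega>1 \<omega>2 + of_int m * Ejump x y"
proof -
  \<comment> \<open>As for the zeros of theta, |m| and |n| are added to reduce to natural shifts;
    the nonzero multiplier is cancelled afterwards.\<close>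
  define M N where "M = nat \<bar>m\<bar>" and "N = nat \<bar>n\<bar>"
  define M' N' where "M' = nat (m + \<bar>m\<bar>)" and "N' = nat (n + \<bar>n\<bar>)"
  let ?c = "\<lambda>m n. exp (2 * of_real pi * \<i> * (m * of_real x + n * of_real y))"
  have r: "real M' = of_int m + real M" "real N' = of_int n + real N"
    by (auto simp: M_def N_def M'_def N'_def)
  have c: "of_nat M' = of_int m + (of_nat M :: complex)" "of_nat N' = of_int n + (of_nat N :: complex)"
    using r by (metis of_int_of_nat_eq of_real_add of_real_of_int_eq of_real_of_nat_eq)+
  have eq: "(\<xi> + pt (of_int m) (of_int n)) + pt (real M) (real N) = \<xi> + pt (real M') (real N')"
    by (simp add: add.assoc pt_add r)
  have "?c (of_nat M) (of_nat N) * frakE (\<xi> + pt (of_int m) (of_int n)) x y \<omega>1 \<omega>2 + of_nat M * Ejump x y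
      = frakE (\<xi> + pt (real M') (real N')) x y \<omega>1 \<omega>2"
    using frakE_shift_nat[of "\<xi> + pt (of_int m) (of_int n)" M N x y] assms unfolding lat_add eq by simp
  also have "\<dots> = ?c (of_nat M') (of_nat N') * frakE \<xi> x y \<omega>1 \<omega>2 + of_nat M' * Ejump x y"
    by (rule frakE_shift_nat[OF assms])
  also have "?c (of_nat M') (of_nat N') = ?c (of_nat M) (of_nat N) * ?c (of_int m) (of_int n)"
    unfolding c by (simp add: exp_add[symmetric] algebra_simps)
  also have "of_nat M' * Ejump x y = of_nat M * Ejump x y + ?c (of_nat M) (of_nat N) * (of_int m * Ejump x y)"
    unfolding c by (auto simp: Ejump_def algebra_simps)
  finally have "?c (of_nat M) (of_nat N) * frakE (\<xi> + pt (of_int m) (of_int n)) x y \<omega>1 \<omega>2 =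
     ?c (of_nat M) (of_nat N) * (?c (of_int m) (of_int n) * frakE \<xi> x y \<omega>1 \<omega>2 + of_int m * Ejump x y)"
    by (simp add: algebra_simps)
  then show ?thesis by (simp only: mult_cancel_left exp_not_eq_zero) simp
qed

lemma simple_pole_frakE:
  assumes "good x y"
  shows "simple_pole_at (\<lambda>\<xi>. frakE \<xi> x y \<omega>1 \<omega>2) (pt (of_int m) (of_int n))
    (exp (2 * of_real pi * \<i> * (of_int m * of_real x + of_int n * of_real y)))"
proof -
  have "\<forall>\<^sub>F \<xi> in at 0. \<xi> \<notin> lat"
  proof -
    obtain c where c: "c > 0" "\<And>a b. c * (\<bar>a\<bar> + \<bar>b\<bar>) \<le> norm (pt a b)" using norm_pt_ge by blast
    have "\<forall>\<^sub>F \<xi> in at 0. \<xi> \<in> ball 0 c - {0}" using eventually_at_in_open[of "ball 0 c" 0] c by auto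
    then show ?thesis
    proof eventually_elim
      case (elim \<xi>)
      show ?case
      proof
        assume "\<xi> \<in> lat"
        then obtain m n :: int where mn: "\<xi> = pt (of_int m) (of_int n)" by (auto simp: lat_def)
        have "c * (\<bar>of_int m\<bar> + \<bar>of_int n\<bar>) < c * 1" using c(2)[of "of_int m" "of_int n"] elim mn by simp
        then have "\<bar>m\<bar> + \<bar>n\<bar> < 1" using c(1) by (simp only: mult_less_cancel_left_pos)
        then have "m = 0" "n = 0" by linarith+
        then show False using elim mn by (simp add: pt_def)
      qed
    qed
  qed
  then have "\<forall>\<^sub>F \<xi> in at 0. frakE (\<xi> + pt (of_int m) (of_int n)) x y \<omega>1 \<omega>2 =
      exp (2 * of_real pi * \<i> * (of_int m * of_real x + of_int n * of_real y)) * frakE \<xi> x y \<omega>1 \<omega>2 + of_int m * Ejump x y"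
    by eventually_elim (rule frakE_shift)
  from simple_pole_at_shift[OF simple_pole_frakE_0[OF assms] this] show ?thesis by simp
qed

text \<open>The contours of \<open>residue_theorem_box\<close> run inside \<open>grid\<close>.\<close>

definition grid :: "complex set" where
  "grid = {\<xi>. cA \<xi> - 1/2 \<in> \<int> \<or> cB \<xi> - 1/2 \<in> \<int>}"

lemma grid_lat: "\<xi> \<in> grid \<Longrightarrow> \<xi> \<notin> lat"
  using half_not_Int by (auto simp: grid_def lat_iff)

text \<open>Lattice translations move the grid onto a compact cross in one cell, on which
  \<open>frakE\<close> is bounded. The multipliers have modulus 1, so the only growth is that of m
  times the jump.\<close>

lemma frakE_grid_bound:
  "\<exists>C>0. \<forall>\<xi>\<in>grid. norm (frakE \<xi> x y \<omega>1 \<omega>2) \<le> C * (1 + \<bar>cA \<xi>\<bar>) \<and>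
    ((x, y) \<noteq> (0, 0) \<longrightarrow> norm (frakE \<xi> x y \<omega>1 \<omega>2) \<le> C)"
proof -
  define K where "K = (\<lambda>(a, b). pt a b) ` (({1/2} \<times> {0..1}) \<union> ({0..1} \<times> {1/2}))"
  have "compact K" unfolding K_def case_prod_unfold
    by (intro compact_continuous_image continuous_intros compact_Un compact_Times) auto
  moreover have Kg: "K \<subseteq> grid" by (auto simp: K_def grid_def)
  then have "K \<subseteq> - lat" using grid_lat by auto
  then have "continuous_on K (\<lambda>\<xi>. frakE \<xi> x y \<omega>1 \<omega>2)"
    by (rule continuous_on_subset[OF holomorphic_on_imp_continuous_on[OF analytic_imp_holomorphic[OF analytic_frakE]]])
  ultimately have "bounded ((\<lambda>\<xi>. frakE \<xi> x y \<omega>1 \<omega>2) ` K)"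
    using compact_continuous_image compact_imp_bounded by blast
  then obtain B where B: "B > 0" "\<And>\<xi>. \<xi> \<in> K \<Longrightarrow> norm (frakE \<xi> x y \<omega>1 \<omega>2) \<le> B"
    by (auto simp: bounded_pos)
  have main: "norm (frakE \<xi> x y \<omega>1 \<omega>2) \<le> B + (1 + \<bar>cA \<xi>\<bar>) * norm (Ejump x y)" if g: "\<xi> \<in> grid" for \<xi>
  proof -
    define m n where "m = \<lfloor>cA \<xi>\<rfloor>" and "n = \<lfloor>cB \<xi>\<rfloor>"
    define \<eta> where "\<eta> = pt (frac (cA \<xi>)) (frac (cB \<xi>))"
    have eq: "\<xi> = \<eta> + pt (of_int m) (of_int n)"
      unfolding \<eta>_def m_def n_def by (simp add: pt_add frac_def)
    have fr: "frac a = 1/2" if "a - 1/2 \<in> \<int>" for a :: real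
    proof -
      from that obtain k where "a - 1/2 = of_int k" by (auto elim: Ints_cases)
      then have "a = of_int k + 1/2" by simp
      then have "\<lfloor>a\<rfloor> = k" by linarith
      then show ?thesis using \<open>a = _\<close> by (simp add: frac_def)
    qed
    have "(frac (cA \<xi>), frac (cB \<xi>)) \<in> ({1/2} \<times> {0..1}) \<union> ({0..1} \<times> {1/2})"
      using g fr frac_ge_0 less_imp_le[OF frac_lt_1] by (auto simp: grid_def)
    then have "\<eta> \<in> K" unfolding K_def \<eta>_def by (intro image_eqI[of _ _ "(frac (cA \<xi>), frac (cB \<xi>))"]) auto
    have "frakE \<xi> x y \<omega>1 \<omega>2 = exp (2 * of_real pi * \<i> * (of_int m * of_real x + of_int n * of_real y)) * frakE \<eta> x y \<omega>1 \<omega>2 + of_int m * Ejump x y"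
      unfolding eq by (rule frakE_shift) (use \<open>\<eta> \<in> K\<close> Kg grid_lat in auto)
    also have "norm \<dots> \<le> norm (frakE \<eta> x y \<omega>1 \<omega>2) + \<bar>of_int m\<bar> * norm (Ejump x y)"
    proof -
      have "norm (exp (2 * of_real pi * \<i> * (of_int m * of_real x + of_int n * of_real y))) = 1"
        by (simp add: norm_exp_eq_Re)
      then show ?thesis using norm_triangle_ineq[of "exp (2 * of_real pi * \<i> * (of_int m * of_real x + of_int n * of_real y)) * frakE \<eta> x y \<omega>1 \<omega>2" "of_int m * Ejump x y"]
        by (simp add: norm_mult)
    qed
    also have "\<bar>of_int m\<bar> \<le> 1 + \<bar>cA \<xi>\<bar>" unfolding m_def by linarith
    finally show ?thesis using B(2)[OF \<open>\<eta> \<in> K\<close>] by (simp add: mult_right_mono)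
  qed
  define C where "C = B + norm (Ejump x y)"
  have "C > 0" using B by (simp add: C_def add_pos_nonneg)
  moreover have "norm (frakE \<xi> x y \<omega>1 \<omega>2) \<le> C * (1 + \<bar>cA \<xi>\<bar>)" if "\<xi> \<in> grid" for \<xi>
  proof -
    have "B * 1 \<le> B * (1 + \<bar>cA \<xi>\<bar>)" using B by (intro mult_left_mono) auto
    then show ?thesis using main[OF that] by (simp add: C_def algebra_simps)
  qed
  moreover have "norm (frakE \<xi> x y \<omega>1 \<omega>2) \<le> C" if "\<xi> \<in> grid" "(x, y) \<noteq> (0, 0)" for \<xi>
    proof -
    have "Ejump x y = 0" using that(2) by (auto simp: Ejump_def)
    then show ?thesis using main[OF that(1)] by (simp add: C_def)
  qed
  ultimately show ?thesis by blast
qed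

end

subsection \<open>The function K\<close>

text \<open>Taylor coefficients are split off one at a time. The coefficient \<open>d j\<close>
  belongs to \<eta>^(-j-1), so that j also counts the derivatives in the residue formula.\<close>

lemma principal_part_exists:
  assumes "g analytic_on {0 :: complex}"
  shows "\<exists>d h. h analytic_on {0} \<and> (\<forall>\<^sub>F \<eta> in at 0. g \<eta> / \<eta> ^ n = (\<Sum>j<n. d j / \<eta> ^ Suc j) + h \<eta>)"
  using assms
proof (induction n arbitrary: g)
  case 0
  then show ?case by auto
next
  case (Suc n)
  obtain g1 where g1: "g1 analytic_on {0}" "\<forall>\<^sub>F \<xi> in nhds 0. g \<xi> = g 0 + (\<xi> - 0) * g1 \<xi>"
    using analytic_difference_quotient[OF Suc.prems] by metis
  obtain d h where h: "h analytic_on {0}" "\<forall>\<^sub>F \<eta> in at 0. g1 \<eta> / \<eta> ^ n = (\<Sum>j<n. d j / \<eta> ^ Suc j) + h \<eta>"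
    using Suc.IH[OF g1(1)] by blast
  have "\<forall>\<^sub>F \<xi> in at 0. g \<xi> = g 0 + \<xi> * g1 \<xi>" using g1(2) by (auto simp: eventually_nhds_conv_at)
  moreover have "\<forall>\<^sub>F \<xi> in at (0::complex). \<xi> \<noteq> 0" by (simp add: eventually_at_filter)
  ultimately have "\<forall>\<^sub>F \<eta> in at 0. g \<eta> / \<eta> ^ Suc n = (\<Sum>j<Suc n. (d(n := g 0)) j / \<eta> ^ Suc j) + h \<eta>"
    using h(2)
  proof eventually_elim
    case (elim \<xi>)
    have "g \<xi> / \<xi> ^ Suc n = g 0 / \<xi> ^ Suc n + g1 \<xi> / \<xi> ^ n"
      unfolding elim(1) using elim(2) by (simp add: add_divide_distrib)
    then show ?case using elim(3) by simp
  qed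
  then show ?case using h(1) by blast
qed

text \<open>The coefficient of \<eta>^(-j-1) meets the j-th Taylor coefficient of \<open>g\<close>.
  Applied to \<open>g \<eta> = G (\<xi> - \<eta>)\<close> this expresses \<open>P\<close> by
  derivatives of \<open>G\<close>.\<close>

lemma residue_principal_part:
  assumes h: "h analytic_on {0 :: complex}" and g: "g analytic_on {0}"
    and f: "\<forall>\<^sub>F \<eta> in at 0. f \<eta> = (\<Sum>j<n. d j / \<eta> ^ Suc j) + h \<eta>"
  shows "residue (\<lambda>\<eta>. f \<eta> * g \<eta>) 0 = (\<Sum>j<n. d j * (deriv ^^ j) g 0 / fact j)"
proof -
  obtain S where S: "open S" "0 \<in> S" "h holomorphic_on S" "g holomorphic_on S"
    using h g by (metis analytic_at_two)
  have hol: "(\<lambda>\<eta>. (\<Sum>j<n. d j / \<eta> ^ Suc j) + h \<eta>) holomorphic_on S - {0}" for n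
    by (intro holomorphic_intros holomorphic_on_subset[OF S(3)]) auto
  have gS: "g holomorphic_on S - {0}" using S(4) by (rule holomorphic_on_subset) auto
  have "residue (\<lambda>\<eta>. f \<eta> * g \<eta>) 0 = residue (\<lambda>\<eta>. ((\<Sum>j<n. d j / \<eta> ^ Suc j) + h \<eta>) * g \<eta>) 0"
    by (rule residue_cong) (use f in \<open>auto elim: eventually_mono\<close>)
  also have "\<dots> = (\<Sum>j<n. d j * (deriv ^^ j) g 0 / fact j)"
  proof (induction n)
    case 0
    have "(\<lambda>\<eta>. h \<eta> * g \<eta>) holomorphic_on S" using S by (intro holomorphic_intros)
    then show ?case using residue_holo[OF S(1,2)] by simp
  next
    case (Suc n)
    have "residue (\<lambda>\<eta>. ((\<Sum>j<Suc n. d j / \<eta> ^ Suc j) + h \<eta>) * g \<eta>) 0 =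
        residue (\<lambda>\<eta>. ((\<Sum>j<n. d j / \<eta> ^ Suc j) + h \<eta>) * g \<eta> + d n * (g \<eta> / \<eta> ^ Suc n)) 0"
      by (rule arg_cong[of _ _ "\<lambda>f. residue f 0"]) (auto simp: fun_eq_iff algebra_simps)
    also have "\<dots> = residue (\<lambda>\<eta>. ((\<Sum>j<n. d j / \<eta> ^ Suc j) + h \<eta>) * g \<eta>) 0 + residue (\<lambda>\<eta>. d n * (g \<eta> / \<eta> ^ Suc n)) 0"
      by (rule residue_add[OF S(1,2)]) (intro holomorphic_intros hol gS; simp)+
    also have "residue (\<lambda>\<eta>. d n * (g \<eta> / \<eta> ^ Suc n)) 0 = d n * residue (\<lambda>\<eta>. g \<eta> / \<eta> ^ Suc n) 0"
      by (rule residue_lmul[OF S(1,2)]) (intro holomorphic_intros gS; simp)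
    also have "residue (\<lambda>\<eta>. g \<eta> / \<eta> ^ Suc n) 0 = (deriv ^^ n) g 0 / fact n"
      by (rule residue_holomorphic_over_power'[OF S(1,2,4)])
    finally show ?case using Suc by simp
  qed
  finally show ?thesis .
qed

lemma higher_deriv_reciprocal:
  assumes "(\<xi> :: complex) \<noteq> 0"
  shows "(deriv ^^ n) (\<lambda>\<xi>. 1 / \<xi>) \<xi> = (-1) ^ n * fact n / \<xi> ^ Suc n"
  using assms
proof (induction n arbitrary: \<xi>)
  case (Suc n)
  have "\<forall>\<^sub>F w in nhds \<xi>. w \<noteq> 0" using Suc.prems by (rule t1_space_nhds)
  then have "\<forall>\<^sub>F w in nhds \<xi>. (deriv ^^ n) (\<lambda>\<xi>. 1 / \<xi>) w = (-1) ^ n * fact n / w ^ Suc n"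
    by eventually_elim (rule Suc.IH)
  then have "deriv ((deriv ^^ n) (\<lambda>\<xi>. 1 / \<xi>)) \<xi> = deriv (\<lambda>w. (-1) ^ n * fact n / w ^ Suc n) \<xi>"
    by (intro deriv_cong_ev) auto
  also have "((\<lambda>w. (-1) ^ n * fact n / w ^ Suc n) has_field_derivative
      (0 * \<xi> ^ Suc n - (-1) ^ n * fact n * (of_nat (Suc n) * \<xi> ^ n)) / (\<xi> ^ Suc n * \<xi> ^ Suc n)) (at \<xi>)"
    by (rule derivative_eq_intros refl | use Suc.prems in simp)+
  then have "deriv (\<lambda>w. (-1) ^ n * fact n / w ^ Suc n) \<xi> =
      (0 * \<xi> ^ Suc n - (-1) ^ n * fact n * (of_nat (Suc n) * \<xi> ^ n)) / (\<xi> ^ Suc n * \<xi> ^ Suc n)"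
    by (rule DERIV_imp_deriv)
  also have "\<dots> = (-1) ^ Suc n * fact (Suc n) / \<xi> ^ Suc (Suc n)"
    using Suc.prems by (simp add: field_simps)
  finally show ?case by simp
qed simp

lemma simple_pole_at_0_D:
  assumes "simple_pole_at f 0 c"
  obtains g where "g analytic_on {0}" "\<forall>\<^sub>F \<eta> in at 0. f \<eta> = g \<eta> / \<eta>"
proof -
  obtain h where h: "h analytic_on {0}" "\<forall>\<^sub>F \<eta> in at 0. f \<eta> = c / (\<eta> - 0) + h \<eta>"
    using assms unfolding simple_pole_at_def by blast
  have "(\<lambda>\<eta>. c + \<eta> * h \<eta>) analytic_on {0}" using h(1) by (intro analytic_intros)
  moreover have "\<forall>\<^sub>F \<xi> in at (0::complex). \<xi> \<noteq> 0" by (simp add: eventually_at_filter)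
  with h(2) have "\<forall>\<^sub>F \<eta> in at 0. f \<eta> = (c + \<eta> * h \<eta>) / \<eta>"
    by eventually_elim (simp add: field_simps)
  ultimately show ?thesis using that by blast
qed

locale kernel = period_pair +
  fixes r :: nat and x y z :: real
  assumes xy: "good x y" and z01: "0 \<le> z" "z \<le> 1"
begin

definition \<beta> where "\<beta> = frac (y + real r * z)"
definition D where "D \<xi> = frakD r \<xi> x y z \<omega>1 \<omega>2"
definition G where "G \<xi> = frakF \<xi> \<beta> \<omega>2"
text \<open>The plain residue formula for all parameters; the value of \<open>frakK\<close> at (0,
  0, 1), which is defined by a reflection, is dealt with separately at the end.\<close>

definition K where "K \<xi> = frakK_res r \<xi> x y z \<omega>1 \<omega>2"
definition P where "P \<xi> = residue (\<lambda>\<eta>. D \<eta> * G (\<xi> - \<eta>)) 0"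

lemma beta01: "0 \<le> \<beta>" "\<beta> < 1" by (simp_all add: \<beta>_def frac_lt_1)

lemma lin_lat: "lin \<subseteq> lat" using lin_eq by auto

lemma holomorphic_D: "D holomorphic_on - lat"
proof -
  have "(\<lambda>\<xi>. frakE \<xi> x y \<omega>1 \<omega>2) holomorphic_on - lat" by (rule analytic_imp_holomorphic[OF analytic_frakE])
  moreover have "(\<lambda>\<xi>. frakF \<xi> z \<omega>2) holomorphic_on - lat"
    by (rule holomorphic_on_subset[OF holomorphic_frakF]) (use lin_lat in auto)
  ultimately show ?thesis unfolding D_def frakD_def by (intro holomorphic_intros)
qed

lemma holomorphic_G: "G holomorphic_on - lin"
  unfolding G_def by (rule holomorphic_frakF)

lemma lat_separation:
  obtains c where "c > 0" "\<And>\<xi>. \<xi> \<in> lat \<Longrightarrow> \<xi> \<noteq> 0 \<Longrightarrow> norm \<xi> \<ge> c" "\<And>\<xi>. c * (\<bar>cA \<xi>\<bar> + \<bar>cB \<xi>\<bar>) \<le> norm \<xi>"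
proof -
  obtain c where c: "c > 0" "\<And>a b. c * (\<bar>a\<bar> + \<bar>b\<bar>) \<le> norm (pt a b)" using norm_pt_ge by blast
  have b: "c * (\<bar>cA \<xi>\<bar> + \<bar>cB \<xi>\<bar>) \<le> norm \<xi>" for \<xi> using c(2)[of "cA \<xi>" "cB \<xi>"] by simp
  have "norm \<xi> \<ge> c" if l: "\<xi> \<in> lat" "\<xi> \<noteq> 0" for \<xi>
  proof -
    obtain m n :: int where mn: "\<xi> = pt (of_int m) (of_int n)" using l by (auto simp: lat_def)
    have "m \<noteq> 0 \<or> n \<noteq> 0" using l mn by (auto simp: pt_def)
    then have "1 \<le> \<bar>m\<bar> + \<bar>n\<bar>" by linarith
    then have "(1::real) \<le> \<bar>of_int m\<bar> + \<bar>of_int n\<bar>" by (metis of_int_1_le_iff of_int_abs of_int_add)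
    then have "c * 1 \<le> c * (\<bar>of_int m\<bar> + \<bar>of_int n\<bar>)" using c(1) by (intro mult_left_mono) auto
    then show ?thesis using c(2)[of "of_int m" "of_int n"] mn by simp
  qed
  then show ?thesis using that c(1) b by blast
qed

lemma eventually_not_lat: "\<forall>\<^sub>F \<xi> in at p. \<xi> \<notin> lat"
proof (cases "p \<in> lat")
  case True
  obtain c where c: "c > 0" "\<And>\<xi>. \<xi> \<in> lat \<Longrightarrow> \<xi> \<noteq> 0 \<Longrightarrow> norm \<xi> \<ge> c" using lat_separation by metis
  have "\<forall>\<^sub>F \<xi> in at p. \<xi> \<in> ball p c - {p}" using eventually_at_in_open[of "ball p c" p] c by auto
  then show ?thesis
  proof eventually_elim
    case (elim \<xi>)
    show ?case
    proof
      assume "\<xi> \<in> lat"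
      then have "\<xi> - p \<in> lat"
        using True cA_add[of "\<xi> - p" p] cB_add[of "\<xi> - p" p] by (auto simp: lat_iff)
      then have "norm (\<xi> - p) \<ge> c" using elim c(2) by auto
      then show False using elim by (simp add: dist_norm norm_minus_commute)
    qed
  qed
next
  case False
  have "\<forall>\<^sub>F \<xi> in at p. \<xi> \<in> - lat"
    using closed_lat False by (intro eventually_at_in_open') (auto simp: open_closed)
  then show ?thesis by simp
qed

text \<open>One pole order comes from \<open>frakE\<close> and r from the power of
  \<open>frakF\<close>.\<close>

lemma D_principal_part:
  obtains d h where "h analytic_on {0}" "\<forall>\<^sub>F \<eta> in at 0. D \<eta> = (\<Sum>j<Suc r. d j / \<eta> ^ Suc j) + h \<eta>"
proof -
  obtain e where e: "e analytic_on {0}" "\<forall>\<^sub>F \<eta> in at 0. frakE \<eta> x y \<omega>1 \<omega>2 = e \<eta> / \<eta>"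
    using simple_pole_at_0_D[OF simple_pole_frakE_0[OF xy]] by blast
  obtain f where f: "f analytic_on {0}" "\<forall>\<^sub>F \<eta> in at 0. frakF \<eta> z \<omega>2 = f \<eta> / \<eta>"
    using simple_pole_at_0_D[OF simple_pole_frakF] by blast
  have "(\<lambda>\<eta>. e \<eta> * f \<eta> ^ r) analytic_on {0}" using e f by (intro analytic_intros)
  from principal_part_exists[OF this, of "Suc r"] obtain d h where dh: "h analytic_on {0}"
    "\<forall>\<^sub>F \<eta> in at 0. (e \<eta> * f \<eta> ^ r) / \<eta> ^ Suc r = (\<Sum>j<Suc r. d j / \<eta> ^ Suc j) + h \<eta>" by blast
  have "\<forall>\<^sub>F \<eta> in at 0. D \<eta> = (\<Sum>j<Suc r. d j / \<eta> ^ Suc j) + h \<eta>"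
    using e(2) f(2) dh(2) by eventually_elim (simp add: D_def frakD_def power_divide)
  then show ?thesis using dh(1) that by blast
qed

lemma analytic_G_reflected:
  assumes "\<xi> \<notin> lin" shows "(\<lambda>\<eta>. G (\<xi> - \<eta>)) analytic_on {0}"
proof -
  have "G analytic_on (\<lambda>\<eta>. \<xi> - \<eta>) ` {0}"
    using holomorphic_G assms closed_lin by (auto simp: analytic_at intro!: exI[of _ "- lin"])
  moreover have "(\<lambda>\<eta>. \<xi> - \<eta>) analytic_on {0}" by (intro analytic_intros)
  ultimately show ?thesis using analytic_on_compose[of "\<lambda>\<eta>. \<xi> - \<eta>" "{0}" G] by (simp add: o_def)
qed

text \<open>The coefficients do not depend on \<xi>, so \<open>P\<close> is a fixed differential
  operator applied to \<open>G\<close>; the sign arises from differentiating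
  \<open>G (\<xi> - \<eta>)\<close> in \<eta>.\<close>

lemma P_eq_sum:
  obtains d h where "h analytic_on {0}" "\<forall>\<^sub>F \<eta> in at 0. D \<eta> = (\<Sum>j<Suc r. d j / \<eta> ^ Suc j) + h \<eta>"
    "\<And>\<xi>. \<xi> \<notin> lin \<Longrightarrow> P \<xi> = (\<Sum>j<Suc r. d j * ((-1) ^ j * (deriv ^^ j) G \<xi>) / fact j)"
proof -
  obtain d h where dh: "h analytic_on {0}" "\<forall>\<^sub>F \<eta> in at 0. D \<eta> = (\<Sum>j<Suc r. d j / \<eta> ^ Suc j) + h \<eta>"
    using D_principal_part by blast
  have "P \<xi> = (\<Sum>j<Suc r. d j * ((-1) ^ j * (deriv ^^ j) G \<xi>) / fact j)" if "\<xi> \<notin> lin" for \<xi>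
  proof -
    have "(deriv ^^ j) (\<lambda>\<eta>. G (\<xi> - \<eta>)) 0 = (-1) ^ j * (deriv ^^ j) G \<xi>" for j
    proof -
      have "open ((\<lambda>\<eta>. \<xi> - \<eta>) -` (- lin))"
        using closed_lin by (intro continuous_open_vimage continuous_intros) auto
      then have "(deriv ^^ j) (\<lambda>w. G ((-1) * w + \<xi>)) 0 = (-1) ^ j * (deriv ^^ j) G ((-1) * 0 + \<xi>)"
        by (intro higher_deriv_compose_linear'[OF holomorphic_G, of "(\<lambda>\<eta>. \<xi> - \<eta>) -` (- lin)"])
          (use closed_lin that in auto)
      then show ?thesis by simp
    qed
    then show ?thesis unfolding P_def
      using residue_principal_part[OF dh(1) analytic_G_reflected[OF that] dh(2)] by simp
  qed
  from that[OF dh this] show ?thesis .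
qed

lemma analytic_P: "P analytic_on - lin"
proof -
  obtain d h where d: "\<And>\<xi>. \<xi> \<notin> lin \<Longrightarrow> P \<xi> = (\<Sum>j<Suc r. d j * ((-1) ^ j * (deriv ^^ j) G \<xi>) / fact j)"
    by (rule P_eq_sum) (rule that)
  have "(\<lambda>\<xi>. \<Sum>j<Suc r. d j * ((-1) ^ j * (deriv ^^ j) G \<xi>) / fact j) holomorphic_on - lin"
    using closed_lin by (intro holomorphic_intros holomorphic_G) auto
  then have "P holomorphic_on - lin" by (rule holomorphic_transform) (use d in auto)
  then show ?thesis using closed_lin by (simp add: analytic_on_open open_Compl)
qed

text \<open>\<open>D \<xi>\<close> is a constant with respect to \<eta>, so the first summand has
  residue \<open>D \<xi>\<close>, and residues are additive.\<close>

lemma K_eq: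
  assumes "\<xi> \<notin> lin"
  shows "K \<xi> = D \<xi> - P \<xi>"
proof -
  obtain c where c: "c > 0" "\<And>\<xi>. \<xi> \<in> lat \<Longrightarrow> \<xi> \<noteq> 0 \<Longrightarrow> norm \<xi> \<ge> c" using lat_separation by metis
  obtain S where S: "open S" "0 \<in> S" "(\<lambda>\<eta>. G (\<xi> - \<eta>)) holomorphic_on S"
    using analytic_G_reflected[OF assms] by (auto simp: analytic_at)
  define T where "T = S \<inter> ball 0 c"
  have T: "open T" "0 \<in> T" using S c by (auto simp: T_def)
  have "T - {0} \<subseteq> - lat"
  proof
    fix \<eta> assume "\<eta> \<in> T - {0}"
    then have "norm \<eta> < c" "\<eta> \<noteq> 0" by (simp_all add: T_def)
    then show "\<eta> \<in> - lat" using c(2)[of \<eta>] by auto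
  qed
  then have DT: "D holomorphic_on T - {0}" using holomorphic_D holomorphic_on_subset by blast
  have GT: "(\<lambda>\<eta>. G (\<xi> - \<eta>)) holomorphic_on T - {0}" by (rule holomorphic_on_subset[OF S(3)]) (auto simp: T_def)
  have "K \<xi> = residue (\<lambda>\<eta>. D \<xi> / \<eta> - D \<eta> * G (\<xi> - \<eta>)) 0"
    by (simp add: K_def frakK_res_def D_def G_def \<beta>_def)
  also have "\<dots> = residue (\<lambda>\<eta>. D \<xi> / \<eta>) 0 - residue (\<lambda>\<eta>. D \<eta> * G (\<xi> - \<eta>)) 0"
    by (rule residue_diff[OF T]) (intro holomorphic_intros DT GT; simp)+
  also have "residue (\<lambda>\<eta>. D \<xi> / \<eta>) 0 = D \<xi>"
    using residue_simple[of UNIV 0 "\<lambda>_. D \<xi>"] by simp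
  finally show ?thesis by (simp add: P_def)
qed

text \<open>Since \<open>G\<close> is 1/\<xi> plus an analytic function, (-1)^j/j! times its j-th
  derivative has principal part exactly \<xi>^(-j-1). The principal part of \<open>P\<close>
  therefore has the same coefficients \<open>d j\<close> as that of \<open>D\<close>.\<close>

lemma K_extends_0:
  obtains k where "k analytic_on {0}" "\<forall>\<^sub>F \<xi> in at 0. K \<xi> = k \<xi>"
proof -
  obtain d h where dh: "h analytic_on {0}" "\<forall>\<^sub>F \<eta> in at 0. D \<eta> = (\<Sum>j<Suc r. d j / \<eta> ^ Suc j) + h \<eta>"
    "\<And>\<xi>. \<xi> \<notin> lin \<Longrightarrow> P \<xi> = (\<Sum>j<Suc r. d j * ((-1) ^ j * (deriv ^^ j) G \<xi>) / fact j)"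
    by (rule P_eq_sum) (rule that)
  obtain g where g: "g analytic_on {0}" "\<forall>\<^sub>F \<xi> in at 0. G \<xi> = 1 / (\<xi> - 0) + g \<xi>"
    using simple_pole_frakF[of \<beta>] unfolding simple_pole_at_def G_def by blast
  obtain S where S: "open S" "0 \<in> S" "g holomorphic_on S" using g(1) by (auto simp: analytic_at)
  obtain U where U: "open U" "0 \<in> U" "\<And>\<xi>. \<xi> \<in> U \<Longrightarrow> \<xi> \<noteq> 0 \<Longrightarrow> G \<xi> = 1 / \<xi> + g \<xi>"
    using g(2) by (auto simp: eventually_at_topological)
  define T where "T = S \<inter> U"
  have T: "open T" "0 \<in> T" using S U by (auto simp: T_def)
  define k where "k \<xi> = h \<xi> - (\<Sum>j<Suc r. d j * ((-1) ^ j * (deriv ^^ j) g \<xi>) / fact j)" for \<xi>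
  have "k analytic_on {0}" unfolding k_def using dh(1) g(1) by (intro analytic_intros) auto
  moreover have "\<forall>\<^sub>F \<xi> in at 0. \<xi> \<in> T - {0}" using eventually_at_in_open[OF T] by simp
  with dh(2) eventually_not_lat[of 0] have "\<forall>\<^sub>F \<xi> in at 0. K \<xi> = k \<xi>"
  proof eventually_elim
    case (elim \<xi>)
    then have l: "\<xi> \<notin> lin" using lin_lat by auto
    have gT: "g holomorphic_on T - {0}" by (rule holomorphic_on_subset[OF S(3)]) (auto simp: T_def)
    have oT: "open (T - {0})" using T by auto
    have iT: "(\<lambda>\<xi>. 1 / \<xi>) holomorphic_on T - {0}" by (intro holomorphic_intros) auto
    have "(\<lambda>\<xi>. 1 / \<xi> + g \<xi>) holomorphic_on T - {0}" by (intro holomorphic_intros gT iT)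
    moreover have "G holomorphic_on T - {0}"
      by (rule holomorphic_transform[OF calculation]) (use U in \<open>auto simp: T_def\<close>)
    ultimately have "(deriv ^^ j) G \<xi> = (deriv ^^ j) (\<lambda>\<xi>. 1 / \<xi> + g \<xi>) \<xi>" for j
      using oT elim(3) by (intro higher_deriv_transform_within_open[of _ "T - {0}"]) (use U in \<open>auto simp: T_def\<close>)
    also have "(deriv ^^ j) (\<lambda>\<xi>. 1 / \<xi> + g \<xi>) \<xi> = (-1) ^ j * fact j / \<xi> ^ Suc j + (deriv ^^ j) g \<xi>" for j
      using higher_deriv_add[OF iT gT oT elim(3)] higher_deriv_reciprocal[of \<xi>] elim(3) by simp
    finally have dG: "(deriv ^^ j) G \<xi> = (-1) ^ j * fact j / \<xi> ^ Suc j + (deriv ^^ j) g \<xi>" for j .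
    have e: "d j * ((-1) ^ j * ((-1) ^ j * fact j / \<xi> ^ Suc j + (deriv ^^ j) g \<xi>)) / fact j
        = d j / \<xi> ^ Suc j + d j * ((-1) ^ j * (deriv ^^ j) g \<xi>) / fact j" for j
    proof -
      have "(-1) ^ j * (-1) ^ j = (1::complex)" by (simp flip: power_mult_distrib)
      then have "(-1) ^ j * ((-1) ^ j * fact j / \<xi> ^ Suc j) = (fact j / \<xi> ^ Suc j :: complex)"
        by (simp flip: mult.assoc)
      then show ?thesis by (simp only: distrib_left add_divide_distrib) simp
    qed
    have "P \<xi> = (\<Sum>j<Suc r. d j / \<xi> ^ Suc j) + (\<Sum>j<Suc r. d j * ((-1) ^ j * (deriv ^^ j) g \<xi>) / fact j)"
      unfolding dh(3)[OF l] dG e sum.distrib ..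
    then show ?case using K_eq[OF l] elim(1) by (simp add: k_def)
  qed
  ultimately show ?thesis using that by blast
qed

lemma holomorphic_K: "K holomorphic_on - lat"
proof -
  have "P holomorphic_on - lat" using analytic_imp_holomorphic[OF analytic_P] lin_lat holomorphic_on_subset by blast
  then have "(\<lambda>\<xi>. D \<xi> - P \<xi>) holomorphic_on - lat" using holomorphic_D by (intro holomorphic_intros)
  then show ?thesis by (rule holomorphic_transform) (metis ComplD K_eq lin_lat subsetD)
qed

definition q where "q = exp (2 * of_real pi * \<i> * of_real \<beta>)"

text \<open>Passing to the fractional part changes the exponent by a multiple of 2 \<pi> i; this is
  why \<open>G\<close> with parameter \<beta> has the multiplier of \<open>D\<close>.\<close>

lemma q_eq: "q = exp (2 * of_real pi * \<i> * (of_real y + of_nat r * of_real z))"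
proof -
  have "of_real y + of_nat r * of_real z = complex_of_real \<beta> + of_int \<lfloor>y + real r * z\<rfloor>"
    unfolding \<beta>_def frac_def by simp
  then have "exp (2 * of_real pi * \<i> * (of_real y + of_nat r * of_real z)) =
      q * exp (2 * of_real pi * \<i> * of_int \<lfloor>y + real r * z\<rfloor>)"
    by (simp only: q_def exp_add[symmetric]) (simp add: algebra_simps)
  also have "exp (2 * of_real pi * \<i> * of_int \<lfloor>y + real r * z\<rfloor>) = 1"
    using exp_integer_2pi[of "of_int \<lfloor>y + real r * z\<rfloor>"] by (simp add: mult_ac)
  finally show ?thesis by simp
qed

lemma lat_add2: "\<xi> + \<omega>2 \<in> lat \<longleftrightarrow> \<xi> \<in> lat"
  using lat_add[of \<xi> 0 1] by (simp add: pt_def)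

lemma K_shift:
  assumes "\<xi> \<notin> lat"
  shows "K (\<xi> + \<omega>2) = q * K \<xi>"
proof -
  have "D (\<xi> + \<omega>2) = q * D \<xi>"
  proof -
    have "q = exp (2 * of_real pi * \<i> * of_real y) * exp (2 * of_real pi * \<i> * of_real z) ^ r"
      unfolding q_eq char_mult by (simp add: exp_add[symmetric] algebra_simps)
    then show ?thesis unfolding D_def frakD_def frakE_shift2[OF assms] frakF_shift
      by (simp add: power_mult_distrib mult_ac)
  qed
  moreover have "P (\<xi> + \<omega>2) = q * P \<xi>"
  proof -
    obtain c where c: "c > 0" "\<And>\<xi>. \<xi> \<in> lat \<Longrightarrow> \<xi> \<noteq> 0 \<Longrightarrow> norm \<xi> \<ge> c" using lat_separation by metis
    have "\<xi> \<notin> lin" using assms lin_lat by auto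
    obtain S where S: "open S" "0 \<in> S" "(\<lambda>\<eta>. G (\<xi> - \<eta>)) holomorphic_on S"
      using analytic_G_reflected[OF \<open>\<xi> \<notin> lin\<close>] by (auto simp: analytic_at)
    have "S \<inter> ball 0 c - {0} \<subseteq> - lat"
    proof
      fix \<eta> assume "\<eta> \<in> S \<inter> ball 0 c - {0}"
      then have "norm \<eta> < c" "\<eta> \<noteq> 0" by simp_all
      then show "\<eta> \<in> - lat" using c(2)[of \<eta>] by auto
    qed
    then have "D holomorphic_on S \<inter> ball 0 c - {0}" by (rule holomorphic_on_subset[OF holomorphic_D])
    moreover have "(\<lambda>\<eta>. G (\<xi> - \<eta>)) holomorphic_on S \<inter> ball 0 c - {0}"
      by (rule holomorphic_on_subset[OF S(3)]) auto
    ultimately have hol: "(\<lambda>\<eta>. D \<eta> * G (\<xi> - \<eta>)) holomorphic_on S \<inter> ball 0 c - {0}" by (intro holomorphic_intros)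
    have "G (\<xi> + \<omega>2 - \<eta>) = q * G (\<xi> - \<eta>)" for \<eta>
      using frakF_shift[of "\<xi> - \<eta>" \<beta>] by (simp add: G_def q_def algebra_simps)
    then have "P (\<xi> + \<omega>2) = residue (\<lambda>\<eta>. q * (D \<eta> * G (\<xi> - \<eta>))) 0"
      unfolding P_def by (simp add: mult_ac)
    also have "\<dots> = q * P \<xi>"
      unfolding P_def by (rule residue_lmul[of "S \<inter> ball 0 c"]) (use S c hol in auto)
    finally show ?thesis .
  qed
  moreover have "\<xi> \<notin> lin" "\<xi> + \<omega>2 \<notin> lin" using assms lin_lat lat_add2 by auto
  ultimately show ?thesis by (simp add: K_eq algebra_simps)
qed

lemma K_shift_int:
  assumes "\<xi> \<notin> lat"
  shows "K (\<xi> + of_int n * \<omega>2) = exp (2 * of_real pi * \<i> * (of_int n * of_real \<beta>)) * K \<xi>"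
proof -
  have up: "K (\<xi> + of_nat n * \<omega>2) = exp (2 * of_real pi * \<i> * (of_nat n * of_real \<beta>)) * K \<xi>" if "\<xi> \<notin> lat" for \<xi> n
  proof (induction n)
    case (Suc n)
    have nl: "\<xi> + of_nat n * \<omega>2 \<notin> lat" using lat_add[of \<xi> 0 "int n"] that by (simp add: pt_def)
    have "\<xi> + of_nat (Suc n) * \<omega>2 = (\<xi> + of_nat n * \<omega>2) + \<omega>2" by (simp add: algebra_simps)
    moreover have "exp (2 * of_real pi * \<i> * (of_nat (Suc n) * of_real \<beta>)) = q * exp (2 * of_real pi * \<i> * (of_nat n * of_real \<beta>))"
      unfolding q_def by (simp add: exp_add[symmetric] algebra_simps)
    ultimately show ?case using Suc K_shift[OF nl] by (simp add: add.assoc)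
  qed simp
  show ?thesis
  proof (cases "n \<ge> 0")
    case True
    then show ?thesis using up[OF assms, of "nat n"] by simp
  next
    case False
    define m where "m = nat (- n)"
    have n: "of_int n = - (of_nat m :: complex)" using False by (simp add: m_def)
    have "\<xi> + of_int n * \<omega>2 \<notin> lat" using lat_add[of \<xi> 0 n] assms by (simp add: pt_def)
    from up[OF this, of m] have "K \<xi> = exp (2 * of_real pi * \<i> * (of_nat m * of_real \<beta>)) * K (\<xi> + of_int n * \<omega>2)"
      by (simp add: n)
    then show ?thesis unfolding n by (simp add: exp_minus)
  qed
qed

text \<open>Translation by n \<omega>2 multiplies \<open>K\<close> by a constant, which carries the
  extension at 0 to every other point of \<open>lin\<close>.\<close>

lemma K_extends:
  obtains k where "k analytic_on {of_int n * \<omega>2}" "\<forall>\<^sub>F \<xi> in at (of_int n * \<omega>2). K \<xi> = k \<xi>"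
proof -
  let ?p = "of_int n * \<omega>2" and ?c = "exp (2 * of_real pi * \<i> * (of_int n * of_real \<beta>))"
  obtain k where k: "k analytic_on {0}" "\<forall>\<^sub>F \<xi> in at 0. K \<xi> = k \<xi>" using K_extends_0 by blast
  have "(k \<circ> (\<lambda>\<xi>. \<xi> - ?p)) analytic_on {?p}"
    using k(1) by (intro analytic_on_compose analytic_intros) auto
  then have "(\<lambda>\<xi>. ?c * k (\<xi> - ?p)) analytic_on {?p}" unfolding o_def by (intro analytic_intros)
  moreover have "\<forall>\<^sub>F \<xi> in at 0. K (\<xi> + ?p) = ?c * k ((\<xi> + ?p) - ?p)"
    using k(2) eventually_not_lat[of 0] by eventually_elim (simp add: K_shift_int)
  then have "\<forall>\<^sub>F \<xi> in filtermap (\<lambda>\<xi>. \<xi> + ?p) (at 0). K \<xi> = ?c * k (\<xi> - ?p)"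
    by (simp add: eventually_filtermap)
  then have "\<forall>\<^sub>F \<xi> in at ?p. K \<xi> = ?c * k (\<xi> - ?p)"
    using filtermap_at_shift[of "- ?p" 0] by simp
  ultimately show ?thesis using that by blast
qed

text \<open>On \<open>lin\<close> the analytic extension is used. Elsewhere \<open>frakF\<close> and
  \<open>P\<close> are analytic, and \<open>frakE\<close> has at most a simple pole.\<close>

lemma meromorphic_K: "K meromorphic_on UNIV"
proof (subst meromorphic_on_meromorphic_at, rule ballI)
  fix p :: complex
  show "K meromorphic_on {p}"
  proof (cases "p \<in> lin")
    case True
    then obtain n where n: "p = of_int n * \<omega>2" by (auto simp: lin_def)
    obtain k where "k analytic_on {p}" "\<forall>\<^sub>F \<xi> in at p. K \<xi> = k \<xi>"
      by (rule K_extends[of n, folded n])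
    then show ?thesis using meromorphic_on_cong[of "{p}" K k "{p}"] analytic_on_imp_meromorphic_on by auto
  next
    case False
    have an: "f analytic_on {p}" if "f holomorphic_on - lin" for f
      using that False closed_lin by (auto simp: analytic_at intro!: exI[of _ "- lin"])
    have E: "(\<lambda>\<xi>. frakE \<xi> x y \<omega>1 \<omega>2) meromorphic_on {p}"
    proof (cases "p \<in> lat")
      case True
      then obtain m n :: int where "p = pt (of_int m) (of_int n)" by (auto simp: lat_def)
      with simple_pole_frakE[OF xy] obtain c h where h: "h analytic_on {p}"
        "\<forall>\<^sub>F \<xi> in at p. frakE \<xi> x y \<omega>1 \<omega>2 = c / (\<xi> - p) + h \<xi>" unfolding simple_pole_at_def by blast
      have "(\<lambda>\<xi>. c / (\<xi> - p) + h \<xi>) meromorphic_on {p}"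
        using h(1) by (intro meromorphic_intros analytic_on_imp_meromorphic_on)
      then show ?thesis
        using meromorphic_on_cong[of "{p}" "\<lambda>\<xi>. frakE \<xi> x y \<omega>1 \<omega>2" "\<lambda>\<xi>. c / (\<xi> - p) + h \<xi>" "{p}"] h(2) by auto
    next
      case False
      then show ?thesis using analytic_frakE[of x y] by (intro analytic_on_imp_meromorphic_on) (auto elim: analytic_on_subset)
    qed
    have "(\<lambda>\<xi>. frakE \<xi> x y \<omega>1 \<omega>2 * frakF \<xi> z \<omega>2 ^ r - P \<xi>) meromorphic_on {p}"
      using an[OF holomorphic_frakF] an[OF analytic_imp_holomorphic[OF analytic_P]]
      by (intro meromorphic_intros E analytic_on_imp_meromorphic_on)
    moreover have "\<forall>\<^sub>F \<xi> in at p. K \<xi> = frakE \<xi> x y \<omega>1 \<omega>2 * frakF \<xi> z \<omega>2 ^ r - P \<xi>"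
      using eventually_not_lat[of p] by eventually_elim (metis K_eq D_def frakD_def lin_lat subsetD)
    ultimately show ?thesis
      using meromorphic_on_cong[of "{p}" K "\<lambda>\<xi>. frakE \<xi> x y \<omega>1 \<omega>2 * frakF \<xi> z \<omega>2 ^ r - P \<xi>" "{p}"] by auto
  qed
qed

end

text \<open>Taylor coefficients require equality on a full neighbourhood. Near each w close to p the
  functions \<open>f\<close> and \<open>g\<close> agree off p, so removing singularities at w gives
  the value of \<open>g\<close>.\<close>

lemma remove_sings_eq_analytic_nhds:
  assumes g: "g analytic_on {p}" and fg: "\<forall>\<^sub>F w in at p. f w = g w"
  shows "\<forall>\<^sub>F w in nhds p. remove_sings f w = g w"
proof -
  obtain A where A: "open A" "p \<in> A" "g holomorphic_on A" using g by (auto simp: analytic_at)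
  obtain U where U: "open U" "p \<in> U" "\<And>w. w \<in> U \<Longrightarrow> w \<noteq> p \<Longrightarrow> f w = g w"
    using fg by (auto simp: eventually_at_topological)
  have "\<forall>\<^sub>F w in nhds p. w \<in> A \<inter> U" using A U by (intro eventually_nhds_in_open) auto
  then show ?thesis
  proof eventually_elim
    case (elim w)
    have "\<forall>\<^sub>F v in at w. v \<in> U - {p}"
    proof (cases "w = p")
      case True
      then show ?thesis using eventually_at_in_open[OF U(1,2)] by simp
    next
      case False
      then show ?thesis using U elim by (intro eventually_at_in_open') auto
    qed
    then have "\<forall>\<^sub>F v in at w. f v = g v" by eventually_elim (use U(3) in auto)
    then have "remove_sings f w = remove_sings g w" by (intro remove_sings_cong) auto
    also have "\<dots> = g w" using A elim by (intro remove_sings_at_analytic) (auto simp: analytic_at)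
    finally show ?case .
  qed
qed

lemma minus_one_powi_eq_exp: "(-1) powi n = exp (of_int n * (of_real pi * \<i>))"
proof -
  have "exp (of_int n * (of_real pi * \<i>)) = exp (of_real pi * \<i>) powi n"
    by (simp only: exp_power_int)
  then show ?thesis by simp
qed

text \<open>The n-th power of the inequality 1 + u \<le> exp u, with u a small multiple of
  t.\<close>

lemma polynomial_times_exp_decay:
  assumes "lam > (0::real)"
  obtains Q where "Q > 0" "\<And>t. t \<ge> 0 \<Longrightarrow> (1 + t) ^ n * exp (- lam * t) \<le> Q"
proof -
  \<comment> \<open>Dividing by n + 1 keeps n s \<le> lam and covers n = 0; \<open>\<mu>\<close> is
    at most 1 and at most s, so that \<mu> (1 + t) \<le> 1 + s t.\<close>
  define s where "s = lam / real (Suc n)"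
  define \<mu> where "\<mu> = min 1 s"
  have s: "s > 0" using assms by (simp add: s_def)
  then have \<mu>: "\<mu> > 0" "\<mu> \<le> 1" "\<mu> \<le> s" by (auto simp: \<mu>_def)
  have "(1 + t) ^ n * exp (- lam * t) \<le> 1 / \<mu> ^ n" if t: "t \<ge> 0" for t
  proof -
    have "\<mu> * (1 + t) \<le> 1 + s * t" using \<mu> t by (simp add: distrib_left add_mono mult_right_mono)
    also have "\<dots> \<le> exp (s * t)" by (rule exp_ge_add_one_self)
    finally have "(\<mu> * (1 + t)) ^ n \<le> exp (s * t) ^ n" using \<mu> t by (intro power_mono) auto
    also have "\<dots> = exp (real n * (s * t))" by (simp add: exp_of_nat_mult)
    also have "\<dots> \<le> exp (lam * t)"
    proof -
      have "real n * s \<le> real (Suc n) * s" using s by (intro mult_right_mono) auto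
      also have "\<dots> = lam" by (simp add: s_def)
      finally have "real n * s * t \<le> lam * t" using t by (rule mult_right_mono)
      then show ?thesis by (simp add: mult.assoc)
    qed
    finally have "\<mu> ^ n * (1 + t) ^ n \<le> exp (lam * t)" by (simp add: power_mult_distrib)
    then show ?thesis using \<mu> by (simp add: exp_minus field_simps)
  qed
  then show ?thesis using that \<mu> by (metis zero_less_divide_1_iff zero_less_power)
qed

context period_pair
begin

lemma pt_notin_lin: "m \<noteq> 0 \<Longrightarrow> pt (of_int m) (of_int n) \<notin> lin"
  by (simp add: lin_eq)

text \<open>With w = m \<pi> i/\<tau> one has exp(2w) - 1 = 2 exp(w) sinh(w). Cancelling exp(w)
  produces the shift z - 1/2 in the m-part of the exponent; in the n-part the same shift is undone
  by the sign (-1)^(rn).\<close>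

lemma termT_eq:
  assumes "m \<noteq> 0"
  shows "(of_real pi * \<i> / \<omega>2) ^ r * termT r k x y z \<omega>1 \<omega>2 m n =
    exp (2 * of_real pi * \<i> * (of_int m * of_real x + of_int n * of_real y))
    * frakF (pt (of_int m) (of_int n)) z \<omega>2 ^ r / pt (of_int m) (of_int n) ^ k"
proof -
  let ?p = "pt (of_int m) (of_int n)"
  define w where "w = of_int m * of_real pi * \<i> / (\<omega>2 / \<omega>1)"
  have W: "2 * of_real pi * \<i> * ?p / \<omega>2 = 2 * w + of_int n * (2 * of_real pi * \<i>)"
    using nz1 nz2 by (simp add: w_def pt_def field_simps)
  have e1: "exp (2 * of_real pi * \<i> * ?p / \<omega>2) = exp (2 * w)"
    unfolding W exp_add using exp_integer_2pi[of "of_int n"] by (simp add: mult_ac)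
  have e2: "2 * of_real pi * \<i> * ?p * of_real z / \<omega>2 = w + (w * (2 * of_real z - 1) + 2 * of_real pi * \<i> * of_int n * of_real z)"
  proof -
    have "2 * of_real pi * \<i> * ?p * of_real z / \<omega>2 = (2 * of_real pi * \<i> * ?p / \<omega>2) * of_real z" by simp
    then show ?thesis unfolding W by (simp add: algebra_simps)
  qed
  have sh: "exp (2 * w) - 1 = exp w * (2 * sinh w)"
  proof -
    have "exp (2 * w) = exp w * exp w" "exp w * exp (- w) = 1" by (simp_all add: exp_add[symmetric])
    then show ?thesis by (simp add: sinh_field_def right_diff_distrib)
  qed
  have F: "frakF ?p z \<omega>2 = of_real pi * \<i> / \<omega>2 * (exp (w * (2 * of_real z - 1) + 2 * of_real pi * \<i> * of_int n * of_real z) / sinh w)"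
    unfolding frakF_def e1 e2 sh exp_add[of w] by simp
  have "exp (of_nat r * (w * (2 * of_real z - 1) + 2 * of_real pi * \<i> * of_int n * of_real z)) =
      exp (w * (2 * of_real z - 1) + 2 * of_real pi * \<i> * of_int n * of_real z) ^ r"
    by (rule exp_of_nat_mult)
  then have Fr: "frakF ?p z \<omega>2 ^ r = (of_real pi * \<i> / \<omega>2) ^ r *
      (exp (of_nat r * (w * (2 * of_real z - 1) + 2 * of_real pi * \<i> * of_int n * of_real z)) / sinh w ^ r)"
    unfolding F power_mult_distrib power_divide by simp
  have "(-1) powi (int r * n) * exp (2 * of_real pi * \<i> *
            (of_int m * (of_real x + of_nat r * (of_real z - 1/2) / (\<omega>2 / \<omega>1))
             + of_int n * (of_real y + of_nat r * (of_real z - 1/2))))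
      = exp (2 * of_real pi * \<i> * (of_int m * of_real x + of_int n * of_real y)) *
        exp (of_nat r * (w * (2 * of_real z - 1) + 2 * of_real pi * \<i> * of_int n * of_real z))"
    unfolding minus_one_powi_eq_exp exp_add[symmetric] w_def
    by (rule arg_cong[of _ _ exp]) (use nz1 nz2 in \<open>simp add: field_simps\<close>)
  then show ?thesis unfolding termT_def Let_def Fr w_def[symmetric] by (simp add: pt_def mult_ac)
qed

text \<open>The widths stay free: for k \<ge> 2 they are the distances \<open>B\<close> and
  \<open>A\<close> of the sides from the axes, while for k = 1 the sides along \<omega>1 use width
  1, their integrability coming from the decay of \<open>K\<close>.\<close>

lemma contour_integral_box_bound:
  assumes f: "f holomorphic_on - lat" and "A > 0" "B > 0" and AB: "A - 1/2 \<in> \<int>" "B - 1/2 \<in> \<int>"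
    and h: "\<And>a. \<bar>a\<bar> \<le> A \<Longrightarrow> norm (f (pt a B)) \<le> Q1 / (h1\<^sup>2 + a\<^sup>2)"
      "\<And>a. \<bar>a\<bar> \<le> A \<Longrightarrow> norm (f (pt a (- B))) \<le> Q1 / (h1\<^sup>2 + a\<^sup>2)" "h1 > 0"
    and v: "\<And>b. \<bar>b\<bar> \<le> B \<Longrightarrow> norm (f (pt A b)) \<le> Q2 / (h2\<^sup>2 + b\<^sup>2)"
      "\<And>b. \<bar>b\<bar> \<le> B \<Longrightarrow> norm (f (pt (- A) b)) \<le> Q2 / (h2\<^sup>2 + b\<^sup>2)" "h2 > 0"
  shows "norm (contour_integral (par (- A) A (- B) B) f) \<le> 2 * pi * (Q1 * norm \<omega>1 / h1 + Q2 * norm \<omega>2 / h2)"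
proof -
  have c: "continuous_on S f" if "S \<subseteq> grid" for S
    using that grid_lat by (intro holomorphic_on_imp_continuous_on holomorphic_on_subset[OF f]) auto
  have segh: "closed_segment (pt (- A) b) (pt A b) \<subseteq> grid" if "b - 1/2 \<in> \<int>" for b
    using coords_segment1[of _ "- A" b A] that by (auto simp: grid_def)
  have segv: "closed_segment (pt a (- B)) (pt a B) \<subseteq> grid" if "a - 1/2 \<in> \<int>" for a
    using coords_segment2[of _ a "- B" B] that by (auto simp: grid_def)
  have H: "norm (contour_integral (linepath (pt (- A) b) (pt A b)) f) \<le> Q1 * norm \<omega>1 * pi / h1"
    if "b - 1/2 \<in> \<int>" "\<And>a. \<bar>a\<bar> \<le> A \<Longrightarrow> norm (f (pt a b)) \<le> Q1 / (h1\<^sup>2 + a\<^sup>2)" for b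
  proof -
    have e: "pt (- A) b = pt 0 b - of_real A * \<omega>1" "pt A b = pt 0 b + of_real A * \<omega>1"
      "\<And>t. pt t b = pt 0 b + of_real t * \<omega>1" by (simp_all add: pt_def)
    show ?thesis
      by (rule contour_integral_segment_arctan_bound[of "pt 0 b" A \<omega>1 f h1 Q1, folded e(1) e(3)])
        (use c[OF segh[OF that(1)]] that(2) \<open>A > 0\<close> \<open>h1 > 0\<close> in auto)
  qed
  have V: "norm (contour_integral (linepath (pt a (- B)) (pt a B)) f) \<le> Q2 * norm \<omega>2 * pi / h2"
    if "a - 1/2 \<in> \<int>" "\<And>b. \<bar>b\<bar> \<le> B \<Longrightarrow> norm (f (pt a b)) \<le> Q2 / (h2\<^sup>2 + b\<^sup>2)" for a
  proof -
    have e: "pt a (- B) = pt a 0 - of_real B * \<omega>2" "pt a B = pt a 0 + of_real B * \<omega>2"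
      "\<And>t. pt a t = pt a 0 + of_real t * \<omega>2" by (simp_all add: pt_def)
    show ?thesis
      by (rule contour_integral_segment_arctan_bound[of "pt a 0" B \<omega>2 f h2 Q2, folded e(1) e(3)])
        (use c[OF segv[OF that(1)]] that(2) \<open>B > 0\<close> \<open>h2 > 0\<close> in auto)
  qed
  have "path_image (par (- A) A (- B) B) \<subseteq> grid"
  proof
    fix \<xi> assume "\<xi> \<in> path_image (par (- A) A (- B) B)"
    from path_image_par(5)[OF _ _ this] show "\<xi> \<in> grid"
      using AB minus_half_Int[of A] minus_half_Int[of B] \<open>A > 0\<close> \<open>B > 0\<close> by (auto simp: grid_def)
  qed
  then have eq: "contour_integral (par (- A) A (- B) B) f =
      contour_integral (linepath (pt (- A) (- B)) (pt A (- B))) f + contour_integral (linepath (pt A (- B)) (pt A B)) f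
    - contour_integral (linepath (pt (- A) B) (pt A B)) f - contour_integral (linepath (pt (- A) (- B)) (pt (- A) B)) f"
    (is "_ = ?a + ?b - ?c - ?d")
    by (intro contour_integral_par c)
  have "norm (?a + ?b - ?c - ?d) \<le> norm ?a + norm ?b + norm ?c + norm ?d"
    using norm_triangle_ineq[of ?a ?b] norm_triangle_ineq4[of "?a + ?b" ?c] norm_triangle_ineq4[of "?a + ?b - ?c" ?d]
    by linarith
  also have "\<dots> \<le> Q1 * norm \<omega>1 * pi / h1 + Q2 * norm \<omega>2 * pi / h2 + Q1 * norm \<omega>1 * pi / h1 + Q2 * norm \<omega>2 * pi / h2"
  proof (intro add_mono)
    show "norm ?a \<le> Q1 * norm \<omega>1 * pi / h1" by (rule H[OF minus_half_Int[OF AB(2)]]) (rule h)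
    show "norm ?b \<le> Q2 * norm \<omega>2 * pi / h2" by (rule V[OF AB(1)]) (rule v)
    show "norm ?c \<le> Q1 * norm \<omega>1 * pi / h1" by (rule H[OF AB(2)]) (rule h)
    show "norm ?d \<le> Q2 * norm \<omega>2 * pi / h2" by (rule V[OF minus_half_Int[OF AB(1)]]) (rule v)
  qed
  also have "\<dots> = 2 * pi * (Q1 * norm \<omega>1 / h1 + Q2 * norm \<omega>2 / h2)"
    by (simp add: distrib_left mult_ac)
  finally show ?thesis unfolding eq .
qed

text \<open>Either \<open>cA \<xi>\<close> or \<open>cB \<xi> - n\<close> is a half-integer, hence
  at least 1/2 in modulus.\<close>

lemma grid_far_from_lin:
  assumes "\<And>\<xi>. c * (\<bar>cA \<xi>\<bar> + \<bar>cB \<xi>\<bar>) \<le> norm \<xi>" "c > 0" "\<xi> \<in> grid"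
  shows "norm (\<xi> - of_int n * \<omega>2) \<ge> c / 2"
proof -
  have co: "cA (\<xi> - of_int n * \<omega>2) = cA \<xi>" "cB (\<xi> - of_int n * \<omega>2) = cB \<xi> - of_int n"
  proof -
    have e: "\<xi> = (\<xi> - of_int n * \<omega>2) + pt 0 (of_int n)" by (simp add: pt_def)
    show "cA (\<xi> - of_int n * \<omega>2) = cA \<xi>" "cB (\<xi> - of_int n * \<omega>2) = cB \<xi> - of_int n"
      by (subst (2) e, simp only: cA_add cB_add, simp)+
  qed
  have "\<bar>cA \<xi>\<bar> + \<bar>cB \<xi> - of_int n\<bar> \<ge> 1/2"
  proof (cases "cA \<xi> - 1/2 \<in> \<int>")
    case True
    show ?thesis using abs_ge_half[OF True] by linarith
  next
    case False
    then have "cB \<xi> - 1/2 \<in> \<int>" using assms(3) by (simp add: grid_def)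
    then have "cB \<xi> - 1/2 - of_int n \<in> \<int>" by (rule Ints_diff[OF _ Ints_of_int])
    then have "cB \<xi> - of_int n - 1/2 \<in> \<int>" by (simp add: algebra_simps)
    from abs_ge_half[OF this] show ?thesis by linarith
  qed
  then have "c * (1/2) \<le> c * (\<bar>cA \<xi>\<bar> + \<bar>cB \<xi> - of_int n\<bar>)" using assms(2) by (intro mult_left_mono) auto
  also have "\<dots> \<le> norm (\<xi> - of_int n * \<omega>2)" using assms(1)[of "\<xi> - of_int n * \<omega>2"] by (simp only: co)
  finally show ?thesis by simp
qed

end

section \<open>Size of \<open>P\<close> and \<open>D\<close> on the contours, and the residues of
  \<open>K\<close>\<close>

context kernel
begin

text \<open>\<open>P\<close> is a contour integral over a small circle about 0 that does not move
  with \<xi>. There \<open>D\<close> is bounded, and \<xi> - \<eta> differs from \<xi> by at most 1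
  in the first coordinate, which costs a factor exp \<mu>.\<close>

lemma P_grid_bound:
  obtains C where "C > 0" "\<And>\<xi>. \<xi> \<in> grid \<Longrightarrow> norm (P \<xi>) \<le> C * exp (- (min \<beta> (1 - \<beta>) * \<kappa> * \<bar>cA \<xi>\<bar>))"
proof -
  obtain c where c: "c > 0" "\<And>\<xi>. \<xi> \<in> lat \<Longrightarrow> \<xi> \<noteq> 0 \<Longrightarrow> norm \<xi> \<ge> c" "\<And>\<xi>. c * (\<bar>cA \<xi>\<bar> + \<bar>cB \<xi>\<bar>) \<le> norm \<xi>"
    using lat_separation by metis
  \<comment> \<open>Grid points keep distance c/2 from \<open>lin\<close>, so a radius of c/4 leaves
    c/4 between \<xi> - \<eta> and the poles of \<open>G\<close>; no nonzero lattice point lies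
    within c of 0.\<close>
  define \<epsilon> where "\<epsilon> = c / 4"
  have \<epsilon>: "\<epsilon> > 0" using c by (simp add: \<epsilon>_def)
  define \<mu> where "\<mu> = min \<beta> (1 - \<beta>) * \<kappa>"
  have \<mu>: "\<mu> \<ge> 0" using beta01 kappa_pos by (simp add: \<mu>_def)
  have sub: "ball (0::complex) c - {0} \<subseteq> - lat"
  proof
    fix \<eta> :: complex assume "\<eta> \<in> ball 0 c - {0}"
    then have "norm \<eta> < c" "\<eta> \<noteq> 0" by simp_all
    then show "\<eta> \<in> - lat" using c(2)[of \<eta>] by auto
  qed
  have "sphere (0::complex) \<epsilon> \<subseteq> ball 0 c - {0}" using \<epsilon> c(1) by (auto simp: \<epsilon>_def)
  then have "continuous_on (sphere 0 \<epsilon>) D"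
    using sub by (intro holomorphic_on_imp_continuous_on holomorphic_on_subset[OF holomorphic_D]) auto
  then have "bounded (D ` sphere 0 \<epsilon>)" by (intro compact_imp_bounded compact_continuous_image) auto
  then obtain B where B: "B > 0" "\<And>\<eta>. norm \<eta> = \<epsilon> \<Longrightarrow> norm (D \<eta>) \<le> B"
    by (auto simp: bounded_pos dist_norm)
  obtain C where C: "C > 0" "\<forall>s \<xi>. 0 \<le> s \<longrightarrow> s \<le> 1 \<longrightarrow> (\<forall>n::int. norm (\<xi> - of_int n * \<omega>2) \<ge> \<epsilon>) \<longrightarrow>
    norm (frakF \<xi> s \<omega>2) \<le> C * exp (- (min s (1 - s) * \<kappa> * \<bar>cA \<xi>\<bar>))"
    using frakF_bound[OF \<epsilon>] by blast
  have "norm (P \<xi>) \<le> (B * C * exp \<mu> * \<epsilon>) * exp (- (\<mu> * \<bar>cA \<xi>\<bar>))" if g: "\<xi> \<in> grid" for \<xi>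
  proof -
    have far: "norm ((\<xi> - \<eta>) - of_int n * \<omega>2) \<ge> c / 2 - norm \<eta>" for n :: int and \<eta>
      using grid_far_from_lin[OF c(3,1) g, of n] norm_triangle_ineq2[of "\<xi> - of_int n * \<omega>2" \<eta>]
      by (simp add: algebra_simps)
    define S where "S = ball (0::complex) (c / 2)"
    have Gh: "(\<lambda>\<eta>. G (\<xi> - \<eta>)) holomorphic_on S - {0}"
    proof (rule holomorphic_on_compose_gen[of "\<lambda>\<eta>. \<xi> - \<eta>" _ G "- lin", unfolded o_def])
      show "(\<lambda>\<eta>. \<xi> - \<eta>) ` (S - {0}) \<subseteq> - lin"
      proof
        fix \<zeta> assume "\<zeta> \<in> (\<lambda>\<eta>. \<xi> - \<eta>) ` (S - {0})"
        then obtain \<eta> where \<eta>: "\<zeta> = \<xi> - \<eta>" "norm \<eta> < c / 2" by (auto simp: S_def)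
        show "\<zeta> \<in> - lin"
        proof
          assume "\<zeta> \<in> lin"
          then obtain n :: int where "\<zeta> = of_int n * \<omega>2" by (auto simp: lin_def)
          then show False using far[of \<eta> n] \<eta> by simp
        qed
      qed
    qed (intro holomorphic_intros holomorphic_G)+
    have Dh: "D holomorphic_on S - {0}"
      by (rule holomorphic_on_subset[OF holomorphic_D order_trans[OF _ sub]]) (use c(1) in \<open>auto simp: S_def\<close>)
    have "((\<lambda>\<eta>. D \<eta> * G (\<xi> - \<eta>)) has_contour_integral 2 * pi * \<i> * P \<xi>) (circlepath 0 \<epsilon>)"
      unfolding P_def
    proof (rule base_residue)
      show "open S" "0 \<in> S" using c(1) by (simp_all add: S_def)
      show "(\<lambda>\<eta>. D \<eta> * G (\<xi> - \<eta>)) holomorphic_on S - {0}" by (intro holomorphic_on_mult Dh Gh)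
      show "cball 0 \<epsilon> \<subseteq> S" using c(1) by (auto simp: S_def \<epsilon>_def)
    qed (fact \<epsilon>)
    then have "norm (2 * pi * \<i> * P \<xi>) \<le> (B * (C * exp \<mu> * exp (- (\<mu> * \<bar>cA \<xi>\<bar>)))) * (2 * pi * \<epsilon>)"
    proof (rule has_contour_integral_bound_circlepath)
      show "0 \<le> B * (C * exp \<mu> * exp (- (\<mu> * \<bar>cA \<xi>\<bar>)))" using B C by simp
      show "0 < \<epsilon>" by (fact \<epsilon>)
      fix \<eta> :: complex assume "norm (\<eta> - 0) = \<epsilon>"
      then have \<eta>: "norm \<eta> = \<epsilon>" by simp
      have "norm ((\<xi> - \<eta>) - of_int n * \<omega>2) \<ge> \<epsilon>" for n :: int using far[of \<eta> n] \<eta> by (simp add: \<epsilon>_def)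
      then have "norm (G (\<xi> - \<eta>)) \<le> C * exp (- (\<mu> * \<bar>cA (\<xi> - \<eta>)\<bar>))"
        using C(2)[rule_format, of \<beta> "\<xi> - \<eta>"] beta01 by (simp add: G_def \<mu>_def mult_ac)
      also have "\<dots> \<le> C * (exp \<mu> * exp (- (\<mu> * \<bar>cA \<xi>\<bar>)))"
      proof -
        have "c * \<bar>cA \<eta>\<bar> \<le> c * (\<bar>cA \<eta>\<bar> + \<bar>cB \<eta>\<bar>)" using c(1) by (intro mult_left_mono) auto
        also have "\<dots> \<le> c * 1" using c(3)[of \<eta>] \<eta> c(1) by (simp add: \<epsilon>_def)
        finally have "c * \<bar>cA \<eta>\<bar> \<le> c * 1" .
        then have "\<bar>cA \<eta>\<bar> \<le> 1" using c(1) by simp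
        moreover have "cA \<xi> = cA (\<xi> - \<eta>) + cA \<eta>" using cA_add[of "\<xi> - \<eta>" \<eta>] by simp
        ultimately have "\<bar>cA \<xi>\<bar> \<le> 1 + \<bar>cA (\<xi> - \<eta>)\<bar>" by linarith
        then have "\<mu> * \<bar>cA \<xi>\<bar> \<le> \<mu> * (1 + \<bar>cA (\<xi> - \<eta>)\<bar>)" using \<mu> by (rule mult_left_mono)
        then have "- (\<mu> * \<bar>cA (\<xi> - \<eta>)\<bar>) \<le> \<mu> + - (\<mu> * \<bar>cA \<xi>\<bar>)" by (simp add: distrib_left)
        then show ?thesis using C(1) by (simp flip: exp_add)
      qed
      finally have "norm (G (\<xi> - \<eta>)) \<le> C * exp \<mu> * exp (- (\<mu> * \<bar>cA \<xi>\<bar>))" by simp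
      then show "norm (D \<eta> * G (\<xi> - \<eta>)) \<le> B * (C * exp \<mu> * exp (- (\<mu> * \<bar>cA \<xi>\<bar>)))"
        unfolding norm_mult using B(2)[OF \<eta>] B(1) by (intro mult_mono) auto
    qed
    then show ?thesis by (simp add: norm_mult mult_ac)
  qed
  moreover have "B * C * exp \<mu> * \<epsilon> > 0" using B C \<epsilon> by simp
  ultimately show ?thesis using that by (simp add: \<mu>_def)
qed

lemma D_grid_bound:
  obtains C where "C > 0"
    "\<And>\<xi>. \<xi> \<in> grid \<Longrightarrow> norm (D \<xi>) \<le> C * (1 + \<bar>cA \<xi>\<bar>) * decay r z \<bar>cA \<xi>\<bar>"
    "\<And>\<xi>. (x, y) \<noteq> (0, 0) \<Longrightarrow> \<xi> \<in> grid \<Longrightarrow> norm (D \<xi>) \<le> C"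
proof -
  obtain c where c: "c > 0" "\<And>\<xi>. c * (\<bar>cA \<xi>\<bar> + \<bar>cB \<xi>\<bar>) \<le> norm \<xi>"
    using lat_separation by metis
  obtain C where C: "C > 0" "\<forall>s \<xi>. 0 \<le> s \<longrightarrow> s \<le> 1 \<longrightarrow> (\<forall>n::int. norm (\<xi> - of_int n * \<omega>2) \<ge> c / 2) \<longrightarrow>
    norm (frakF \<xi> s \<omega>2) \<le> C * exp (- (min s (1 - s) * \<kappa> * \<bar>cA \<xi>\<bar>))"
    using frakF_bound[OF half_gt_zero[OF c(1)]] by blast
  obtain B where B: "B > 0" "\<And>\<xi>. \<xi> \<in> grid \<Longrightarrow> norm (frakE \<xi> x y \<omega>1 \<omega>2) \<le> B * (1 + \<bar>cA \<xi>\<bar>)"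
    "\<And>\<xi>. (x, y) \<noteq> (0, 0) \<Longrightarrow> \<xi> \<in> grid \<Longrightarrow> norm (frakE \<xi> x y \<omega>1 \<omega>2) \<le> B"
    using frakE_grid_bound[of x y] by blast
  have F: "norm (frakF \<xi> z \<omega>2 ^ r) \<le> C ^ r * decay r z \<bar>cA \<xi>\<bar>" if "\<xi> \<in> grid" for \<xi>
  proof -
    have "norm (frakF \<xi> z \<omega>2) \<le> C * exp (- (min z (1 - z) * \<kappa> * \<bar>cA \<xi>\<bar>))"
      using z01 grid_far_from_lin[OF c(2,1) that] by (intro C(2)[rule_format])
    then have "norm (frakF \<xi> z \<omega>2) ^ r \<le> (C * exp (- (min z (1 - z) * \<kappa> * \<bar>cA \<xi>\<bar>))) ^ r"
      by (intro power_mono) auto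
    then show ?thesis by (simp add: norm_power power_mult_distrib exp_of_nat_mult[symmetric] mult_ac)
  qed
  have "norm (D \<xi>) \<le> (B * C ^ r) * (1 + \<bar>cA \<xi>\<bar>) * decay r z \<bar>cA \<xi>\<bar>" if "\<xi> \<in> grid" for \<xi>
  proof -
    have "norm (D \<xi>) \<le> (B * (1 + \<bar>cA \<xi>\<bar>)) * (C ^ r * decay r z \<bar>cA \<xi>\<bar>)"
      unfolding D_def frakD_def norm_mult using B(1) by (intro mult_mono B(2) F that) auto
    then show ?thesis by (simp add: mult_ac)
  qed
  moreover have "norm (D \<xi>) \<le> B * C ^ r" if "(x, y) \<noteq> (0, 0)" "\<xi> \<in> grid" for \<xi>
  proof -
    have "norm (D \<xi>) \<le> B * (C ^ r * decay r z \<bar>cA \<xi>\<bar>)"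
      unfolding D_def frakD_def norm_mult using B(1) by (intro mult_mono B(3) F that) auto
    also have "\<dots> \<le> B * (C ^ r * 1)"
      using B C z01 kappa_pos by (intro mult_left_mono) auto
    finally show ?thesis by simp
  qed
  moreover have "B * C ^ r > 0" using B C by simp
  ultimately show ?thesis using that by blast
qed

lemma K_ext_eq:
  obtains k where "k analytic_on {0}" "\<forall>\<^sub>F \<xi> in at 0. K \<xi> = k \<xi>" "\<forall>\<^sub>F \<xi> in nhds 0. remove_sings K \<xi> = k \<xi>"
proof -
  obtain k where k: "k analytic_on {0}" "\<forall>\<^sub>F \<xi> in at 0. K \<xi> = k \<xi>" using K_extends_0 by blast
  from that[OF k remove_sings_eq_analytic_nhds[OF k]] show ?thesis .
qed

lemma residue_K_0: "residue (\<lambda>\<xi>. K \<xi> / \<xi> ^ Suc j) 0 = fps_nth (fps_expansion (remove_sings K) 0) j"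
proof -
  obtain k where k: "k analytic_on {0}" "\<forall>\<^sub>F \<xi> in at 0. K \<xi> = k \<xi>" "\<forall>\<^sub>F \<xi> in nhds 0. remove_sings K \<xi> = k \<xi>"
    by (rule K_ext_eq)
  obtain S where S: "open S" "0 \<in> S" "k holomorphic_on S" using k(1) by (auto simp: analytic_at)
  have "residue (\<lambda>\<xi>. K \<xi> / \<xi> ^ Suc j) 0 = residue (\<lambda>\<xi>. k \<xi> / \<xi> ^ Suc j) 0"
    by (rule residue_cong) (use k(2) in \<open>auto elim: eventually_mono\<close>)
  also have "\<dots> = (deriv ^^ j) k 0 / fact j" by (rule residue_holomorphic_over_power'[OF S])
  also have "\<dots> = fps_nth (fps_expansion k 0) j" by (simp add: fps_expansion_def)
  also have "fps_expansion k 0 = fps_expansion (remove_sings K) 0"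
    using k(3) by (intro fps_expansion_cong) (auto elim: eventually_mono)
  finally show ?thesis .
qed

text \<open>The singularity of \<open>K\<close> is removable and \<xi>^(-k) is regular away from 0;
  this is why the lattice sum runs over m \<noteq> 0 only.\<close>

lemma residue_K_lin:
  assumes "n \<noteq> 0"
  shows "residue (\<lambda>\<xi>. K \<xi> / \<xi> ^ k) (pt 0 (of_int n)) = 0"
proof -
  have p: "pt 0 (of_int n) = of_int n * \<omega>2" by (simp add: pt_def)
  obtain g where g: "g analytic_on {of_int n * \<omega>2}" "\<forall>\<^sub>F \<xi> in at (of_int n * \<omega>2). K \<xi> = g \<xi>" by (rule K_extends)
  have "(\<lambda>\<xi>. g \<xi> / \<xi> ^ k) analytic_on {of_int n * \<omega>2}" using g(1) nz2 assms by (intro analytic_intros) auto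
  then have "residue (\<lambda>\<xi>. g \<xi> / \<xi> ^ k) (of_int n * \<omega>2) = 0" by (auto simp: analytic_at intro: residue_holo)
  moreover have "residue (\<lambda>\<xi>. K \<xi> / \<xi> ^ k) (of_int n * \<omega>2) = residue (\<lambda>\<xi>. g \<xi> / \<xi> ^ k) (of_int n * \<omega>2)"
    by (rule residue_cong) (use g(2) in \<open>auto elim: eventually_mono\<close>)
  ultimately show ?thesis by (simp add: p)
qed

text \<open>Off \<open>lin\<close> the power of \<open>frakF\<close> and \<open>P\<close> are
  analytic, so the pole of \<open>frakE\<close> is the only one; its residue is a character value,
  and \<open>termT_eq\<close> recognises the product.\<close>

lemma residue_K_pole:
  assumes "m \<noteq> 0"
  shows "residue (\<lambda>\<xi>. K \<xi> / \<xi> ^ k) (pt (of_int m) (of_int n)) = (of_real pi * \<i> / \<omega>2) ^ r * termT r k x y z \<omega>1 \<omega>2 m n"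
proof -
  let ?p = "pt (of_int m) (of_int n)"
  define e where "e = exp (2 * of_real pi * \<i> * (of_int m * of_real x + of_int n * of_real y))"
  have nl: "?p \<notin> lin" by (rule pt_notin_lin[OF assms])
  have "pt 0 0 = 0" by (simp add: pt_def)
  then have p0: "?p \<noteq> 0" using assms pt_inj[of "of_int m" "of_int n" 0 0] by auto
  obtain h where h: "h analytic_on {?p}" "\<forall>\<^sub>F \<xi> in at ?p. frakE \<xi> x y \<omega>1 \<omega>2 = e / (\<xi> - ?p) + h \<xi>"
    using simple_pole_frakE[OF xy] unfolding simple_pole_at_def e_def by blast
  have an: "f analytic_on {?p}" if "f holomorphic_on - lin" for f
    using that nl closed_lin by (auto simp: analytic_at intro!: exI[of _ "- lin"])
  have Fa: "(\<lambda>\<xi>. frakF \<xi> z \<omega>2) analytic_on {?p}" by (rule an[OF holomorphic_frakF])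
  have Pa: "P analytic_on {?p}" by (rule an[OF analytic_imp_holomorphic[OF analytic_P]])
  define N where "N \<xi> = e * frakF \<xi> z \<omega>2 ^ r / \<xi> ^ k" for \<xi>
  define H where "H \<xi> = (h \<xi> * frakF \<xi> z \<omega>2 ^ r - P \<xi>) / \<xi> ^ k" for \<xi>
  have "N analytic_on {?p}" "H analytic_on {?p}"
    unfolding N_def H_def using Fa Pa h(1) p0 by (intro analytic_intros; simp)+
  then obtain S where S: "open S" "?p \<in> S" "N holomorphic_on S" "H holomorphic_on S"
    using analytic_at_two[of N ?p H] by blast
  have "\<forall>\<^sub>F \<xi> in at ?p. K \<xi> / \<xi> ^ k = N \<xi> / (\<xi> - ?p) + H \<xi>"
    using h(2) eventually_not_lat[of ?p]
  proof eventually_elim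
    case (elim \<xi>)
    then have "\<xi> \<notin> lin" using lin_lat by auto
    then have "K \<xi> = (e / (\<xi> - ?p) + h \<xi>) * frakF \<xi> z \<omega>2 ^ r - P \<xi>"
      by (simp add: K_eq D_def frakD_def elim(1))
    moreover have "((e / d + g) * F - b) / c = e * F / c / d + (g * F - b) / c" for d g F b c :: complex
      by (simp add: distrib_right add_divide_distrib diff_divide_distrib mult.commute[of c d])
    ultimately show ?case unfolding N_def H_def by simp
  qed
  then have "residue (\<lambda>\<xi>. K \<xi> / \<xi> ^ k) ?p = residue (\<lambda>\<xi>. N \<xi> / (\<xi> - ?p) + H \<xi>) ?p"
    by (rule residue_cong) simp
  also have "\<dots> = residue (\<lambda>\<xi>. N \<xi> / (\<xi> - ?p)) ?p + residue H ?p"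
    by (rule residue_add[OF S(1,2)]) (intro holomorphic_intros holomorphic_on_subset[OF S(3)] holomorphic_on_subset[OF S(4)]; auto)+
  also have "\<dots> = N ?p" using residue_simple[OF S(1,2,3)] residue_holo[OF S(1,2,4)] by simp
  finally show ?thesis using termT_eq[OF assms, of r k x y z n] by (simp add: N_def e_def)
qed

text \<open>Indexed by the power of \<xi>, so that outside (0, 0, 1) \<open>coef (k - 1)\<close> is
  \<open>calK\<close> divided by k!.\<close>

definition coef :: "nat \<Rightarrow> complex" where
  "coef j = fps_nth (fps_expansion (remove_sings K) 0) j"

lemma contour_integral_K:
  "contour_integral (par (- (real M + 1/2)) (real M + 1/2) (- (real N + 1/2)) (real N + 1/2)) (\<lambda>\<xi>. K \<xi> / \<xi> ^ Suc j) =
    2 * of_real pi * \<i> * (coef j + (of_real pi * \<i> / \<omega>2) ^ r * box_sum r (Suc j) x y z \<omega>1 \<omega>2 M N)"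
proof -
  let ?box = "{- int M..int M} \<times> {- int N..int N}"
  let ?f = "\<lambda>\<xi>. K \<xi> / \<xi> ^ Suc j"
  let ?R = "\<lambda>(m, n). residue ?f (pt (of_int m) (of_int n))"
  have "0 \<in> lat" using pt_in_lat[of 0 0] by (simp add: pt_def)
  then have hol: "?f holomorphic_on - lat" by (intro holomorphic_intros holomorphic_K) auto
  \<comment> \<open>In the column m = 0 only the origin has a residue, and this residue is the
    Taylor coefficient sought.\<close>
  have split: "?box = (index_set \<inter> ?box) \<union> {0} \<times> {- int N..int N}" by (auto simp: index_set_def)
  have "(\<Sum>mn\<in>?box. ?R mn) = (\<Sum>mn\<in>index_set \<inter> ?box. ?R mn) + (\<Sum>mn\<in>{0} \<times> {- int N..int N}. ?R mn)"
    by (subst split, rule sum.union_disjoint) (auto simp: index_set_def)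
  also have "(\<Sum>mn\<in>index_set \<inter> ?box. ?R mn) = (\<Sum>(m, n)\<in>index_set \<inter> ?box. (of_real pi * \<i> / \<omega>2) ^ r * termT r (Suc j) x y z \<omega>1 \<omega>2 m n)"
    by (rule sum.cong) (auto simp: index_set_def residue_K_pole simp del: power_Suc)
  also have "\<dots> = (of_real pi * \<i> / \<omega>2) ^ r * box_sum r (Suc j) x y z \<omega>1 \<omega>2 M N"
    by (simp add: box_sum_def sum_distrib_left case_prod_unfold)
  also have "(\<Sum>mn\<in>{0} \<times> {- int N..int N}. ?R mn) = (\<Sum>mn\<in>{(0, 0)}. ?R mn)"
    by (rule sum.mono_neutral_right) (use residue_K_lin[of _ "Suc j"] in \<open>force simp del: power_Suc\<close>)+
  also have "\<dots> = coef j" using residue_K_0[of j] by (simp add: coef_def pt_def del: power_Suc)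
  finally show ?thesis using residue_theorem_box[OF hol, of M N] by (simp add: case_prod_unfold add.commute del: power_Suc)
qed

end

subsection \<open>Box sums\<close>

lemma filterlim_finite_subsets_at_topI:
  assumes "\<And>i. finite (A i)" "\<And>i. A i \<subseteq> X" "\<And>x. x \<in> X \<Longrightarrow> \<forall>\<^sub>F i in F. x \<in> A i"
  shows "filterlim A (finite_subsets_at_top X) F"
  unfolding filterlim_iff eventually_finite_subsets_at_top
proof safe
  fix P Y assume Y: "finite Y" "Y \<subseteq> X" "\<forall>Z. finite Z \<and> Y \<subseteq> Z \<and> Z \<subseteq> X \<longrightarrow> P Z"
  have "\<forall>\<^sub>F i in F. \<forall>y\<in>Y. y \<in> A i" using Y assms(3) by (intro eventually_ball_finite) auto
  then show "\<forall>\<^sub>F i in F. P (A i)" by eventually_elim (use Y(3) assms(1,2) in blast)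
qed

text \<open>A limit along the product filter passes to an iterated limit as soon as the inner limits
  exist, and it composes with any pair of sequences tending to infinity.\<close>

lemma has_LimI:
  assumes lim: "((\<lambda>(M, N). S M N) \<longlongrightarrow> L) (sequentially \<times>\<^sub>F sequentially)"
    and rows: "\<And>M. convergent (\<lambda>N. S M N)" and cols: "\<And>N. convergent (\<lambda>M. S M N)"
  shows "has_Lim S L"
proof -
  have it: "has_iterated_limit S L"
    if lim: "\<And>\<epsilon>. \<epsilon> > 0 \<Longrightarrow> \<exists>K. \<forall>M\<ge>K. \<forall>N\<ge>K. dist (S M N) L < \<epsilon>" and rows: "\<And>M. convergent (\<lambda>N. S M N)"
    for S :: "nat \<Rightarrow> nat \<Rightarrow> complex"
  proof -
    define s where "s M = lim (\<lambda>N. S M N)" for M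
    have s: "(\<lambda>N. S M N) \<longlonglongrightarrow> s M" for M using rows[of M] by (simp add: s_def convergent_LIMSEQ_iff)
    have "s \<longlonglongrightarrow> L"
    proof (rule metric_LIMSEQ_I)
      fix \<epsilon> :: real assume "\<epsilon> > 0"
      then obtain K where K: "\<And>M N. M \<ge> K \<Longrightarrow> N \<ge> K \<Longrightarrow> dist (S M N) L < \<epsilon> / 2"
        using lim[of "\<epsilon> / 2"] by auto
      have "dist (s M) L < \<epsilon>" if "M \<ge> K" for M
      proof -
        have "(\<lambda>N. dist (S M N) L) \<longlonglongrightarrow> dist (s M) L" by (intro tendsto_intros s)
        then have "dist (s M) L \<le> \<epsilon> / 2"
          by (rule LIMSEQ_le_const2) (use K[OF that] less_imp_le in blast)
        then show ?thesis using \<open>\<epsilon> > 0\<close> by simp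
      qed
      then show "\<exists>K. \<forall>M\<ge>K. dist (s M) L < \<epsilon>" by blast
    qed
    with s show ?thesis unfolding has_iterated_limit_def by blast
  qed
  have e: "\<exists>K. \<forall>M\<ge>K. \<forall>N\<ge>K. dist (S N M) L < \<epsilon>" if "\<epsilon> > 0" for \<epsilon>
    using tendstoD[OF lim that] unfolding eventually_prod_sequentially by auto
  have e': "\<exists>K. \<forall>M\<ge>K. \<forall>N\<ge>K. dist (S M N) L < \<epsilon>" if "\<epsilon> > 0" for \<epsilon>
    using e[OF that] by blast
  have "has_joint_limit S L"
    unfolding has_joint_limit_def
  proof (intro allI impI)
    fix Ms Ns :: "nat \<Rightarrow> nat"
    assume "filterlim Ms at_top sequentially" "filterlim Ns at_top sequentially"
    then have "filterlim (\<lambda>j. (Ms j, Ns j)) (sequentially \<times>\<^sub>F sequentially) sequentially"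
      by (rule filterlim_Pair)
    from filterlim_compose[OF lim this] show "(\<lambda>j. S (Ms j) (Ns j)) \<longlonglongrightarrow> L" by simp
  qed
  moreover have "has_iterated_limit S L" by (rule it[OF e' rows])
  moreover have "has_iterated_limit (\<lambda>N M. S M N) L" by (rule it[OF e cols])
  ultimately show ?thesis by (simp add: has_Lim_def)
qed

lemma has_iterated_limit_lim:
  assumes "has_iterated_limit S L"
  shows "lim (\<lambda>M. lim (\<lambda>N. S M N)) = L"
proof -
  obtain s where s: "\<And>M. (\<lambda>N. S M N) \<longlonglongrightarrow> s M" "s \<longlonglongrightarrow> L"
    using assms unfolding has_iterated_limit_def by blast
  have "(\<lambda>M. lim (\<lambda>N. S M N)) = s" using limI[OF s(1)] by auto
  then show ?thesis using limI[OF s(2)] by simp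
qed

abbreviation ibox :: "nat \<Rightarrow> nat \<Rightarrow> (int \<times> int) set" where
  "ibox M N \<equiv> {- int M..int M} \<times> {- int N..int N}"

text \<open>The boxes eventually contain every finite subset, so unconditional summation forces
  convergence along them, whatever the relation between M and N.\<close>

lemma filterlim_box:
  "filterlim (\<lambda>(M, N). I \<inter> ibox M N) (finite_subsets_at_top I) (sequentially \<times>\<^sub>F sequentially)"
proof (rule filterlim_finite_subsets_at_topI)
  fix x assume "x \<in> I"
  obtain m n where x: "x = (m, n)" by force
  show "\<forall>\<^sub>F i in sequentially \<times>\<^sub>F sequentially. x \<in> (case i of (M, N) \<Rightarrow> I \<inter> ibox M N)"
    unfolding eventually_prod_sequentially using \<open>x \<in> I\<close>
    by (intro exI[of _ "nat \<bar>m\<bar> + nat \<bar>n\<bar>"]) (auto simp: x)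
qed auto

lemma tendsto_box_sum:
  fixes f :: "int \<times> int \<Rightarrow> complex"
  assumes "(f has_sum s) I"
  shows "((\<lambda>(M, N). \<Sum>x\<in>I \<inter> ibox M N. f x) \<longlongrightarrow> s) (sequentially \<times>\<^sub>F sequentially)"
proof -
  have "(sum f \<longlongrightarrow> s) (finite_subsets_at_top I)" using assms by (simp add: has_sum_def)
  from filterlim_compose[OF this filterlim_box] show ?thesis by (simp add: case_prod_unfold)
qed

lemma filterlim_diag: "filterlim (\<lambda>N::nat. (N, N)) (sequentially \<times>\<^sub>F sequentially) sequentially"
  by (intro filterlim_Pair filterlim_ident)

lemma convergent_box_rows:
  fixes f :: "int \<times> int \<Rightarrow> complex"
  assumes "f summable_on (I \<inter> {- int M..int M} \<times> UNIV)"
  shows "convergent (\<lambda>N. \<Sum>x\<in>I \<inter> ibox M N. f x)"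
proof -
  have "(sum f \<longlongrightarrow> infsum f (I \<inter> {- int M..int M} \<times> UNIV)) (finite_subsets_at_top (I \<inter> {- int M..int M} \<times> UNIV))"
    using has_sum_infsum[OF assms] by (simp add: has_sum_def)
  moreover have "filterlim (\<lambda>N. I \<inter> ibox M N) (finite_subsets_at_top (I \<inter> {- int M..int M} \<times> UNIV)) sequentially"
  proof (rule filterlim_finite_subsets_at_topI)
    fix x assume x: "x \<in> I \<inter> {- int M..int M} \<times> UNIV"
    show "\<forall>\<^sub>F N in sequentially. x \<in> I \<inter> ibox M N"
      using eventually_ge_at_top[of "nat \<bar>snd x\<bar>"] by eventually_elim (use x in auto)
  qed auto
  ultimately show ?thesis by (rule convergentI[OF filterlim_compose])
qed

lemma convergent_box_cols:
  fixes f :: "int \<times> int \<Rightarrow> complex"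
  assumes "f summable_on (I \<inter> UNIV \<times> {- int N..int N})"
  shows "convergent (\<lambda>M. \<Sum>x\<in>I \<inter> ibox M N. f x)"
proof -
  have "(sum f \<longlongrightarrow> infsum f (I \<inter> UNIV \<times> {- int N..int N})) (finite_subsets_at_top (I \<inter> UNIV \<times> {- int N..int N}))"
    using has_sum_infsum[OF assms] by (simp add: has_sum_def)
  moreover have "filterlim (\<lambda>M. I \<inter> ibox M N) (finite_subsets_at_top (I \<inter> UNIV \<times> {- int N..int N})) sequentially"
  proof (rule filterlim_finite_subsets_at_topI)
    fix x assume x: "x \<in> I \<inter> UNIV \<times> {- int N..int N}"
    show "\<forall>\<^sub>F M in sequentially. x \<in> I \<inter> ibox M N"
      using eventually_ge_at_top[of "nat \<bar>fst x\<bar>"] by eventually_elim (use x in auto)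
  qed auto
  ultimately show ?thesis by (rule convergentI[OF filterlim_compose])
qed

text \<open>The exponent 3/2 exceeds 1, so that \<open>wt m * wt n\<close> is summable over the
  pairs, and two factors together still dominate the third inverse power of |m| + |n|.\<close>

definition wt :: "int \<Rightarrow> real" where "wt n = (1 + \<bar>of_int n\<bar>) powr (- 3 / 2)"

lemma wt_pos: "wt n > 0" by (simp add: wt_def)

lemma summable_wt: "wt summable_on UNIV"
proof -
  have "summable (\<lambda>n. real n powr (- 3 / 2))" by (simp add: summable_real_powr_iff)
  then have "summable (\<lambda>n. real (Suc n) powr (- 3 / 2))" by (subst summable_Suc_iff)
  then have "(\<lambda>n. (1 + real n) powr (- 3 / 2)) summable_on UNIV"
    by (intro norm_summable_imp_summable_on) (simp add: add.commute)
  from summable_on_int_abs[OF this] show ?thesis by (simp add: wt_def[abs_def])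
qed

lemma summable_wt_product: "(\<lambda>(m, n). wt m * wt n) summable_on UNIV"
proof -
  have "(\<lambda>x. norm (case x of (m, n) \<Rightarrow> wt m * wt n)) summable_on Sigma UNIV (\<lambda>_. UNIV)"
    unfolding Infinite_Sum.abs_summable_on_Sigma_iff
    using summable_wt wt_pos
    by (auto simp: abs_mult abs_of_pos infsum_cmult_right' infsum_nonneg less_imp_le
        intro!: summable_on_cmult_right summable_on_cmult_left)
  then have "(\<lambda>(m, n). wt m * wt n) summable_on Sigma UNIV (\<lambda>_. UNIV)" by (rule Infinite_Sum.abs_summable_summable)
  then show ?thesis by (simp flip: UNIV_Times_UNIV)
qed

lemma summable_on_bounded_by_wt:
  fixes f :: "int \<times> int \<Rightarrow> complex"
  assumes "\<And>m n. (m, n) \<in> I \<Longrightarrow> norm (f (m, n)) \<le> C * (wt m * wt n)"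
  shows "(\<lambda>x. norm (f x)) summable_on I"
proof (rule summable_on_comparison_test)
  have "(\<lambda>(m, n). wt m * wt n) summable_on I"
    by (rule summable_on_subset_banach[OF summable_wt_product]) auto
  then have "(\<lambda>x. C * (case x of (m, n) \<Rightarrow> wt m * wt n)) summable_on I" by (rule summable_on_cmult_right)
  then show "(\<lambda>(m, n). C * (wt m * wt n)) summable_on I" by (simp add: case_prod_unfold)
  show "norm (f x) \<le> (case x of (m, n) \<Rightarrow> C * (wt m * wt n))" if "x \<in> I" for x
    using assms that by (cases x) auto
qed auto

lemma wt_ge: "1 / (1 + \<bar>of_int n\<bar>)\<^sup>2 \<le> wt n"
proof -
  have "(1 + \<bar>real_of_int n\<bar>) powr (- 2) \<le> (1 + \<bar>of_int n\<bar>) powr (- 3 / 2)" by (rule powr_mono) auto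
  moreover have "(1 + \<bar>real_of_int n\<bar>) powr (- 2) = 1 / (1 + \<bar>of_int n\<bar>)\<^sup>2"
    by (rule powr_neg_numeral) linarith
  ultimately show ?thesis unfolding wt_def by linarith
qed

text \<open>For m \<noteq> 0 both 1 + |m| and 1 + |n| are at most 2s with s = |m| + |n|; the
  constant is 2^3.\<close>

lemma wt_product_ge:
  assumes "m \<noteq> 0"
  shows "1 / (\<bar>of_int m\<bar> + \<bar>of_int n\<bar>) ^ 3 \<le> 8 * (wt m * wt n)"
proof -
  define s where "s = \<bar>real_of_int m\<bar> + \<bar>of_int n\<bar>"
  have "\<bar>real_of_int m\<bar> \<ge> 1" using assms by linarith
  then have s: "1 + \<bar>of_int m\<bar> \<le> 2 * s" "1 + \<bar>of_int n\<bar> \<le> 2 * s" "s \<ge> 1"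
    using abs_ge_zero[of "real_of_int n"] by (simp_all add: s_def)
  have "(2 * s) powr (- 3 / 2) \<le> wt m" "(2 * s) powr (- 3 / 2) \<le> wt n"
    unfolding wt_def using s by (intro powr_mono2'; simp)+
  then have "(2 * s) powr (- 3 / 2) * (2 * s) powr (- 3 / 2) \<le> wt m * wt n"
    using wt_pos by (intro mult_mono) (auto simp: less_imp_le)
  also have "(2 * s) powr (- 3 / 2) * (2 * s) powr (- 3 / 2) = (2 * s) powr (- 3)"
    by (simp flip: powr_add)
  also have "\<dots> = 1 / (2 * s) ^ 3" by (rule powr_neg_numeral) (use s in linarith)
  also have "\<dots> = (1 / s ^ 3) / 8" by (simp add: power_mult_distrib)
  finally have le: "1 / s ^ 3 / 8 \<le> wt m * wt n" .
  have "1 / s ^ 3 = 8 * (1 / s ^ 3 / 8)" by simp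
  also have "\<dots> \<le> 8 * (wt m * wt n)" by (rule mult_left_mono[OF le]) simp
  finally show ?thesis by (simp only: s_def)
qed

section \<open>Majorants for the terms of the series\<close>

context period_pair
begin

text \<open>Combines \<open>termT_eq\<close> with the bound for \<open>frakF\<close>, whose poles
  are at distance at least \<open>c\<close> because |m| \<ge> 1. The order of the quantifiers
  matters: the constants serve all x, y, z and k.\<close>

lemma termT_bound:
  "\<exists>C>0. \<exists>c>0. \<forall>x y z k m n. 0 \<le> z \<longrightarrow> z \<le> 1 \<longrightarrow> m \<noteq> 0 \<longrightarrow>
    norm (termT r k x y z \<omega>1 \<omega>2 m n) \<le>
      C * decay r z \<bar>of_int m\<bar> / (c * (\<bar>of_int m\<bar> + \<bar>of_int n\<bar>)) ^ k"
proof -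
  obtain c where c: "c > 0" "\<And>a b. c * (\<bar>a\<bar> + \<bar>b\<bar>) \<le> norm (pt a b)" using norm_pt_ge by blast
  obtain C where C: "C > 0" "\<forall>s \<xi>. 0 \<le> s \<longrightarrow> s \<le> 1 \<longrightarrow> (\<forall>n::int. norm (\<xi> - of_int n * \<omega>2) \<ge> c) \<longrightarrow>
    norm (frakF \<xi> s \<omega>2) \<le> C * exp (- (min s (1 - s) * \<kappa> * \<bar>cA \<xi>\<bar>))"
    using frakF_bound[OF c(1)] by blast
  define d where "d = norm ((of_real pi * \<i> / \<omega>2) ^ r)"
  have d: "d > 0" using nz2 by (simp add: d_def)
  have main: "norm (termT r k x y z \<omega>1 \<omega>2 m n) \<le>
      (C ^ r / d) * decay r z \<bar>of_int m\<bar> / (c * (\<bar>of_int m\<bar> + \<bar>of_int n\<bar>)) ^ k"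
    if z: "0 \<le> z" "z \<le> 1" and m: "m \<noteq> 0" for x y z k m n
  proof -
    let ?p = "pt (of_int m) (of_int n)" and ?s = "\<bar>real_of_int m\<bar> + \<bar>of_int n\<bar>"
    have m1: "\<bar>real_of_int m\<bar> \<ge> 1" using m by linarith
    have far: "norm (?p - of_int j * \<omega>2) \<ge> c" for j :: int
    proof -
      have "?p - of_int j * \<omega>2 = pt (of_int m) (of_int n - of_int j)" by (simp add: pt_def algebra_simps)
      moreover have "c * 1 \<le> c * (\<bar>of_int m\<bar> + \<bar>of_int n - of_int j\<bar>)"
        using c(1) m1 by (intro mult_left_mono) auto
      ultimately show ?thesis using c(2)[of "of_int m" "of_int n - of_int j"] by simp
    qed
    have "norm (frakF ?p z \<omega>2) \<le> C * exp (- (min z (1 - z) * \<kappa> * \<bar>of_int m\<bar>))"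
      using C(2)[rule_format, of z ?p] z far by simp
    then have "norm (frakF ?p z \<omega>2) ^ r \<le> (C * exp (- (min z (1 - z) * \<kappa> * \<bar>of_int m\<bar>))) ^ r"
      by (intro power_mono) auto
    then have F: "norm (frakF ?p z \<omega>2) ^ r \<le> C ^ r * decay r z \<bar>of_int m\<bar>"
      by (simp add: power_mult_distrib exp_of_nat_mult[symmetric] mult_ac)
    have cs: "0 < (c * ?s) ^ k" "(c * ?s) ^ k \<le> norm ?p ^ k"
      using c m1 by (auto intro!: power_mono zero_less_power mult_pos_pos add_pos_nonneg)
    have "d * norm (termT r k x y z \<omega>1 \<omega>2 m n) = norm ((of_real pi * \<i> / \<omega>2) ^ r * termT r k x y z \<omega>1 \<omega>2 m n)"
      by (simp add: d_def norm_mult)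
    also have "\<dots> = norm (frakF ?p z \<omega>2) ^ r / norm ?p ^ k"
      unfolding termT_eq[OF m] by (simp add: norm_mult norm_divide norm_power norm_exp_eq_Re)
    also have "\<dots> \<le> (C ^ r * decay r z \<bar>of_int m\<bar>) / (c * ?s) ^ k"
      by (intro frac_le F cs) (use C in auto)
    finally have "norm (termT r k x y z \<omega>1 \<omega>2 m n) \<le>
        (C ^ r * decay r z \<bar>of_int m\<bar>) / (c * ?s) ^ k / d"
      by (subst pos_le_divide_eq[OF d]) (simp only: mult.commute)
    then show ?thesis by (simp add: mult.commute)
  qed
  have "C ^ r / d > 0" using C d by simp
  with main c(1) show ?thesis by blast
qed

text \<open>For k \<ge> 3 the denominator alone is enough. For k = 2 it only controls the sum over
  n, and the exponential decay in m supplies the rest, uniformly as long as z stays in [a, b] inside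
  (0, 1).\<close>

lemma termT_majorant:
  assumes "r \<ge> 1" "k \<ge> 3 \<or> k = 2 \<and> 0 < a \<and> b < 1"
  shows "\<exists>C. \<forall>x y z m n. 0 \<le> z \<longrightarrow> z \<le> 1 \<longrightarrow> (k = 2 \<longrightarrow> a \<le> z \<and> z \<le> b) \<longrightarrow> m \<noteq> 0 \<longrightarrow>
    norm (termT r k x y z \<omega>1 \<omega>2 m n) \<le> C * (wt m * wt n)"
proof -
  obtain C c where C: "C > 0" "c > 0" "\<forall>x y z k m n. 0 \<le> z \<longrightarrow> z \<le> 1 \<longrightarrow> m \<noteq> 0 \<longrightarrow>
    norm (termT r k x y z \<omega>1 \<omega>2 m n) \<le>
      C * decay r z \<bar>of_int m\<bar> / (c * (\<bar>of_int m\<bar> + \<bar>of_int n\<bar>)) ^ k"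
    using termT_bound[of r] by blast
  show ?thesis
  proof (cases "k \<ge> 3")
    case True
    have "norm (termT r k x y z \<omega>1 \<omega>2 m n) \<le> C / c ^ k * 8 * (wt m * wt n)"
      if z: "0 \<le> z" "z \<le> 1" and m: "m \<noteq> 0" for x y z m n
    proof -
      let ?s = "\<bar>real_of_int m\<bar> + \<bar>of_int n\<bar>"
      have s: "?s \<ge> 1" using m by linarith
      have "norm (termT r k x y z \<omega>1 \<omega>2 m n) \<le> C * decay r z \<bar>of_int m\<bar> / (c * ?s) ^ k"
        using C(3) z m by blast
      also have "\<dots> \<le> C * 1 / (c * ?s) ^ k"
        using C(1,2) s z kappa_pos by (intro divide_right_mono mult_left_mono) auto
      also have "\<dots> = C / c ^ k * (1 / ?s ^ k)" by (simp add: power_mult_distrib)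
      also have "\<dots> \<le> C / c ^ k * (1 / ?s ^ 3)"
        using C(1,2) s True by (intro mult_left_mono divide_left_mono power_increasing mult_pos_pos zero_less_power) auto
      also have "\<dots> \<le> C / c ^ k * (8 * (wt m * wt n))"
        using C(1,2) by (intro mult_left_mono wt_product_ge m) auto
      finally show ?thesis by simp
    qed
    with True show ?thesis by blast
  next
    case False
    then have k: "k = 2" "0 < a" "b < 1" using assms by auto
    \<comment> \<open>The slowest rate over z in [a, b]; the factor r \<ge> 1 only improves
      it.\<close>
    define \<delta> where "\<delta> = min a (1 - b) * \<kappa>"
    have \<delta>: "\<delta> > 0" using k kappa_pos by (simp add: \<delta>_def)
    obtain Q where Q: "Q > 0" "\<And>t. t \<ge> 0 \<Longrightarrow> (1 + t) ^ 2 * exp (- \<delta> * t) \<le> Q"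
      using polynomial_times_exp_decay[OF \<delta>] by metis
    have "norm (termT r k x y z \<omega>1 \<omega>2 m n) \<le> C / c ^ k * Q * (wt m * wt n)"
      if z: "0 \<le> z" "z \<le> 1" "a \<le> z" "z \<le> b" and m: "m \<noteq> 0" for x y z m n
    proof -
      let ?s = "\<bar>real_of_int m\<bar> + \<bar>of_int n\<bar>"
      have m1: "\<bar>real_of_int m\<bar> \<ge> 1" using m by linarith
      then have s: "1 + \<bar>real_of_int n\<bar> \<le> ?s" by linarith
      have "\<delta> \<le> min z (1 - z) * \<kappa>" unfolding \<delta>_def using z kappa_pos by (intro mult_right_mono) auto
      also have "\<dots> = 1 * (min z (1 - z) * \<kappa>)" by simp
      also have "\<dots> \<le> real r * (min z (1 - z) * \<kappa>)" using assms(1) z kappa_pos by (intro mult_right_mono) auto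
      finally have "\<delta> * \<bar>of_int m\<bar> \<le> real r * (min z (1 - z) * \<kappa>) * \<bar>of_int m\<bar>" by (rule mult_right_mono) auto
      then have e: "decay r z \<bar>of_int m\<bar> \<le> exp (- \<delta> * \<bar>of_int m\<bar>)" by simp
      have "exp (- \<delta> * \<bar>of_int m\<bar>) \<le> Q * (1 / (1 + \<bar>of_int m\<bar>)\<^sup>2)"
        using Q(2)[of "\<bar>of_int m\<bar>"] by (simp add: field_simps add_pos_nonneg)
      also have "\<dots> \<le> Q * wt m" using Q(1) by (intro mult_left_mono wt_ge) auto
      finally have e2: "decay r z \<bar>of_int m\<bar> \<le> Q * wt m"
        using e by (rule order_trans[rotated])
      have "norm (termT r k x y z \<omega>1 \<omega>2 m n) \<le> C * decay r z \<bar>of_int m\<bar> / (c * ?s) ^ k"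
        using C(3) z m by blast
      also have "\<dots> \<le> C * (Q * wt m) / (c * ?s) ^ k"
        using C(1,2) e2 by (intro divide_right_mono mult_left_mono) auto
      also have "\<dots> = C / c ^ k * Q * (wt m * (1 / ?s\<^sup>2))" by (simp add: power_mult_distrib k)
      also have "\<dots> \<le> C / c ^ k * Q * (wt m * wt n)"
      proof -
        have "1 / ?s\<^sup>2 \<le> 1 / (1 + \<bar>of_int n\<bar>)\<^sup>2" using s by (intro divide_left_mono power_mono) (auto simp: add_pos_nonneg)
        also have "\<dots> \<le> wt n" by (rule wt_ge)
        finally have "wt m * (1 / ?s\<^sup>2) \<le> wt m * wt n" using wt_pos[of m] by (intro mult_left_mono) auto
        then show ?thesis by (rule mult_left_mono) (use C(1,2) Q(1) in simp)
      qed
      finally show ?thesis .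
    qed
    with k(1) show ?thesis by blast
  qed
qed

lemma abs_summable_termT:
  assumes "r \<ge> 1" "0 \<le> z" "z \<le> 1" "abs_case k z"
  shows "(\<lambda>mn. norm (case mn of (m, n) \<Rightarrow> termT r k x y z \<omega>1 \<omega>2 m n)) summable_on index_set"
proof -
  have "k \<ge> 3 \<or> k = 2 \<and> 0 < z \<and> z < 1" using assms(4) by (auto simp: abs_case_def)
  \<comment> \<open>For a single z the interval degenerates to a = b = z.\<close>
  from termT_majorant[OF assms(1) this] obtain C where
    C: "\<forall>x y z' m n. 0 \<le> z' \<longrightarrow> z' \<le> 1 \<longrightarrow> (k = 2 \<longrightarrow> z \<le> z' \<and> z' \<le> z) \<longrightarrow> m \<noteq> 0 \<longrightarrow>
      norm (termT r k x y z' \<omega>1 \<omega>2 m n) \<le> C * (wt m * wt n)" by blast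
  show ?thesis
    by (rule summable_on_bounded_by_wt[of _ _ C]) (use C assms in \<open>auto simp: index_set_def\<close>)
qed

text \<open>The majorant is free of the parameters, so the Weierstrass test applies along the net of
  finite subsets.\<close>

lemma uniform_limit_termT:
  assumes "r \<ge> 1" "k \<ge> 3 \<or> k = 2 \<and> 0 < a \<and> b < 1"
    and Y: "\<And>x y z. (x, y, z) \<in> Y \<Longrightarrow> 0 \<le> z \<and> z \<le> 1 \<and> (k = 2 \<longrightarrow> a \<le> z \<and> z \<le> b)"
  shows "uniform_limit Y (\<lambda>A (x, y, z). \<Sum>(m, n)\<in>A. termT r k x y z \<omega>1 \<omega>2 m n)
        (\<lambda>(x, y, z). calG r k x y z \<omega>1 \<omega>2) (finite_subsets_at_top index_set)"
proof -
  obtain C where C: "\<forall>x y z m n. 0 \<le> z \<longrightarrow> z \<le> 1 \<longrightarrow> (k = 2 \<longrightarrow> a \<le> z \<and> z \<le> b) \<longrightarrow> m \<noteq> 0 \<longrightarrow>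
      norm (termT r k x y z \<omega>1 \<omega>2 m n) \<le> C * (wt m * wt n)"
    using termT_majorant[OF assms(1,2)] by blast
  define f where "f = (\<lambda>mn p. case mn of (m, n) \<Rightarrow> case p of (x, y, z) \<Rightarrow> termT r k x y z \<omega>1 \<omega>2 m n)"
  have "uniform_limit Y (\<lambda>A p. \<Sum>mn\<in>A. f mn p) (\<lambda>p. \<Sum>\<^sub>\<infinity>mn\<in>index_set. f mn p) (finite_subsets_at_top index_set)"
  proof (rule Weierstrass_m_test_general)
    have "(\<lambda>(m, n). wt m * wt n) summable_on index_set"
      by (rule summable_on_subset_banach[OF summable_wt_product]) auto
    then show "(\<lambda>mn. C * (case mn of (m, n) \<Rightarrow> wt m * wt n)) summable_on index_set" by (rule summable_on_cmult_right)
    fix mn p assume "mn \<in> index_set" "p \<in> Y"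
    moreover obtain m n x y z where "mn = (m, n)" "p = (x, y, z)" by (metis prod_cases3 surj_pair)
    ultimately show "norm (f mn p) \<le> C * (case mn of (m, n) \<Rightarrow> wt m * wt n)"
      using C Y by (auto simp: f_def index_set_def)
  qed
  also have "?this \<longleftrightarrow> ?thesis"
  proof (intro uniform_limit_cong always_eventually allI ballI)
    fix A p show "(\<Sum>mn\<in>A. f mn p) = (case p of (x, y, z) \<Rightarrow> \<Sum>(m, n)\<in>A. termT r k x y z \<omega>1 \<omega>2 m n)"
      by (simp add: f_def case_prod_unfold)
  next
    fix p assume p: "p \<in> Y"
    obtain x y z where xyz: "p = (x, y, z)" by (metis prod_cases3)
    have "abs_case k z" using Y[of x y z] p xyz assms(2) by (auto simp: abs_case_def)
    then show "(\<Sum>\<^sub>\<infinity>mn\<in>index_set. f mn p) = (case p of (x, y, z) \<Rightarrow> calG r k x y z \<omega>1 \<omega>2)"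
      by (simp add: xyz calG_def f_def)
  qed
  finally show ?thesis .
qed

end

subsection \<open>Evaluation of the limits\<close>

lemma inverse_half_le: "1 / (real N + 1/2) \<le> 2 * inverse (real (Suc N))"
  by (simp add: field_simps)

lemma tendsto_inverse_Suc_prod:
  "((\<lambda>(M, N). C * (inverse (real (Suc M)) + inverse (real (Suc N)))) \<longlongrightarrow> 0) (sequentially \<times>\<^sub>F sequentially)"
proof -
  have "((\<lambda>p. inverse (real (Suc (fst p)))) \<longlongrightarrow> 0) (sequentially \<times>\<^sub>F sequentially)"
    by (rule filterlim_compose[OF LIMSEQ_inverse_real_of_nat filterlim_fst])
  moreover have "((\<lambda>p. inverse (real (Suc (snd p)))) \<longlongrightarrow> 0) (sequentially \<times>\<^sub>F sequentially)"
    by (rule filterlim_compose[OF LIMSEQ_inverse_real_of_nat filterlim_snd])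
  ultimately have "((\<lambda>p. C * (inverse (real (Suc (fst p))) + inverse (real (Suc (snd p))))) \<longlongrightarrow> C * (0 + 0)) (sequentially \<times>\<^sub>F sequentially)"
    by (intro tendsto_intros)
  then show ?thesis by (simp add: case_prod_unfold)
qed

lemma half_integers: "real N + 1/2 - 1/2 \<in> \<int>" by simp

lemma sum_telescope_int:
  fixes g :: "int \<Rightarrow> complex"
  shows "(\<Sum>n\<in>{- int N..int N}. g (n + 1) - g n) = g (int N + 1) - g (- int N)"
proof (induction N)
  case (Suc N)
  have "{- int (Suc N)..int (Suc N)} = insert (- int (Suc N)) (insert (int (Suc N)) {- int N..int N})" by auto
  then have "(\<Sum>n\<in>{- int (Suc N)..int (Suc N)}. g (n + 1) - g n) =
      (g (- int (Suc N) + 1) - g (- int (Suc N))) + ((g (int (Suc N) + 1) - g (int (Suc N))) + (g (int N + 1) - g (- int N)))"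
    using Suc by simp
  also have "- int (Suc N) + 1 = - int N" by simp
  finally show ?case by (simp add: add.commute)
qed simp

lemma wt_antimono: "\<bar>m\<bar> \<le> int M \<Longrightarrow> wt (int M) \<le> wt m"
  unfolding wt_def by (intro powr_mono2') auto

section \<open>Size of \<open>K\<close> on the contours and the limits of box sums\<close>

context kernel
begin

abbreviation "cc \<equiv> (of_real pi * \<i> / \<omega>2) ^ r"
abbreviation "S k M N \<equiv> box_sum r k x y z \<omega>1 \<omega>2 M N"

lemma cc_nz: "cc \<noteq> 0" using nz2 by simp

lemma grid_s: "\<xi> \<in> grid \<Longrightarrow> 1/2 \<le> \<bar>cA \<xi>\<bar> + \<bar>cB \<xi>\<bar>"
proof -
  assume g: "\<xi> \<in> grid"
  from g consider "cA \<xi> - 1/2 \<in> \<int>" | "cB \<xi> - 1/2 \<in> \<int>" by (auto simp: grid_def)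
  then show ?thesis
  proof cases
    case 1 show ?thesis using abs_ge_half[OF 1] abs_ge_zero[of "cB \<xi>"] by linarith
  next
    case 2 show ?thesis using abs_ge_half[OF 2] abs_ge_zero[of "cA \<xi>"] by linarith
  qed
qed

lemma grid_not_lin: "\<xi> \<in> grid \<Longrightarrow> \<xi> \<notin> lin" using grid_lat lin_lat by blast

lemma K_grid_linear: "\<exists>C>0. \<forall>\<xi>\<in>grid. norm (K \<xi>) \<le> C * (1 + \<bar>cA \<xi>\<bar>)"
proof -
  obtain C1 where C1: "C1 > 0"
    "\<And>\<xi>. \<xi> \<in> grid \<Longrightarrow> norm (D \<xi>) \<le> C1 * (1 + \<bar>cA \<xi>\<bar>) * decay r z \<bar>cA \<xi>\<bar>"
    using D_grid_bound by metis
  obtain C2 where C2: "C2 > 0" "\<And>\<xi>. \<xi> \<in> grid \<Longrightarrow> norm (P \<xi>) \<le> C2 * exp (- (min \<beta> (1 - \<beta>) * \<kappa> * \<bar>cA \<xi>\<bar>))"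
    using P_grid_bound by metis
  have "norm (K \<xi>) \<le> (C1 + C2) * (1 + \<bar>cA \<xi>\<bar>)" if g: "\<xi> \<in> grid" for \<xi>
  proof -
    have "norm (D \<xi>) \<le> C1 * (1 + \<bar>cA \<xi>\<bar>) * decay r z \<bar>cA \<xi>\<bar>" by (rule C1(2)[OF g])
    also have "\<dots> \<le> C1 * (1 + \<bar>cA \<xi>\<bar>) * 1"
      using C1(1) z01 kappa_pos by (intro mult_left_mono) auto
    finally have d: "norm (D \<xi>) \<le> C1 * (1 + \<bar>cA \<xi>\<bar>)" by simp
    have "norm (P \<xi>) \<le> C2 * exp (- (min \<beta> (1 - \<beta>) * \<kappa> * \<bar>cA \<xi>\<bar>))" by (rule C2(2)[OF g])
    also have "\<dots> \<le> C2 * (1 + \<bar>cA \<xi>\<bar>)"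
    proof -
      have "exp (- (min \<beta> (1 - \<beta>) * \<kappa> * \<bar>cA \<xi>\<bar>)) \<le> 1" using beta01 kappa_pos by simp
      then have "exp (- (min \<beta> (1 - \<beta>) * \<kappa> * \<bar>cA \<xi>\<bar>)) \<le> 1 + \<bar>cA \<xi>\<bar>" by linarith
      then show ?thesis using C2(1) by (intro mult_left_mono) auto
    qed
    finally have "norm (P \<xi>) \<le> C2 * (1 + \<bar>cA \<xi>\<bar>)" .
    then show ?thesis using d norm_triangle_ineq4[of "D \<xi>" "P \<xi>"] K_eq[OF grid_not_lin[OF g]]
      by (simp add: distrib_right)
  qed
  moreover have "C1 + C2 > 0" using C1 C2 by simp
  ultimately show ?thesis by blast
qed

text \<open>There are two ways to remove the linear factor of \<open>frakE\<close>: it is absent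
  when \<open>(x, y) \<noteq> (0, 0)\<close>, and otherwise the exponential decay of the power of
  \<open>frakF\<close> absorbs it.\<close>

lemma K_grid_bounded:
  assumes "(x, y) \<noteq> (0, 0) \<or> 0 < z \<and> z < 1" "r \<ge> 1"
  shows "\<exists>C>0. \<forall>\<xi>\<in>grid. norm (K \<xi>) \<le> C"
proof -
  obtain C1 where C1: "C1 > 0"
    "\<And>\<xi>. \<xi> \<in> grid \<Longrightarrow> norm (D \<xi>) \<le> C1 * (1 + \<bar>cA \<xi>\<bar>) * decay r z \<bar>cA \<xi>\<bar>"
    "\<And>\<xi>. (x, y) \<noteq> (0, 0) \<Longrightarrow> \<xi> \<in> grid \<Longrightarrow> norm (D \<xi>) \<le> C1"
    using D_grid_bound by metis
  obtain C2 where C2: "C2 > 0" "\<And>\<xi>. \<xi> \<in> grid \<Longrightarrow> norm (P \<xi>) \<le> C2 * exp (- (min \<beta> (1 - \<beta>) * \<kappa> * \<bar>cA \<xi>\<bar>))"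
    using P_grid_bound by metis
  have d: "\<exists>C>0. \<forall>\<xi>\<in>grid. norm (D \<xi>) \<le> C"
  proof (cases "(x, y) = (0, 0)")
    case False
    then show ?thesis using C1(1,3) by blast
  next
    case True
    then have l: "real r * (min z (1 - z) * \<kappa>) > 0" using assms kappa_pos by (intro mult_pos_pos) auto
    obtain Q where Q: "Q > 0" "\<And>t. t \<ge> 0 \<Longrightarrow> (1 + t) ^ 1 * exp (- (real r * (min z (1 - z) * \<kappa>)) * t) \<le> Q"
      using polynomial_times_exp_decay[OF l] by metis
    have "norm (D \<xi>) \<le> C1 * Q" if "\<xi> \<in> grid" for \<xi>
    proof -
      have "norm (D \<xi>) \<le> C1 * ((1 + \<bar>cA \<xi>\<bar>) ^ 1 * exp (- (real r * (min z (1 - z) * \<kappa>)) * \<bar>cA \<xi>\<bar>))"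
        using C1(2)[OF that] by simp
      also have "\<dots> \<le> C1 * Q" using C1(1) by (intro mult_left_mono Q(2)) auto
      finally show ?thesis .
    qed
    moreover have "C1 * Q > 0" using C1 Q by simp
    ultimately show ?thesis by blast
  qed
  then obtain C where C: "C > 0" "\<And>\<xi>. \<xi> \<in> grid \<Longrightarrow> norm (D \<xi>) \<le> C" by blast
  have "norm (K \<xi>) \<le> C + C2" if g: "\<xi> \<in> grid" for \<xi>
  proof -
    have "norm (P \<xi>) \<le> C2 * exp (- (min \<beta> (1 - \<beta>) * \<kappa> * \<bar>cA \<xi>\<bar>))" by (rule C2(2)[OF g])
    also have "\<dots> \<le> C2 * 1" using C2(1) beta01 kappa_pos by (intro mult_left_mono) auto
    finally show ?thesis using C(2)[OF g] norm_triangle_ineq4[of "D \<xi>" "P \<xi>"] K_eq[OF grid_not_lin[OF g]] by simp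
  qed
  moreover have "C + C2 > 0" using C C2 by simp
  ultimately show ?thesis by blast
qed

text \<open>An interior z makes \<open>D\<close> decay, and \<beta> in (0, 1) makes \<open>P\<close>
  decay. Both decay exponentially; only the form required by the arctangent bound is
  recorded.\<close>

lemma K_grid_decay:
  assumes "0 < z" "z < 1" "0 < \<beta>" "r \<ge> 1"
  shows "\<exists>Q>0. \<forall>\<xi>\<in>grid. norm (K \<xi>) \<le> Q / (1 + (cA \<xi>)\<^sup>2)"
proof -
  obtain C1 where C1: "C1 > 0"
    "\<And>\<xi>. \<xi> \<in> grid \<Longrightarrow> norm (D \<xi>) \<le> C1 * (1 + \<bar>cA \<xi>\<bar>) * decay r z \<bar>cA \<xi>\<bar>"
    using D_grid_bound by metis
  obtain C2 where C2: "C2 > 0" "\<And>\<xi>. \<xi> \<in> grid \<Longrightarrow> norm (P \<xi>) \<le> C2 * exp (- (min \<beta> (1 - \<beta>) * \<kappa> * \<bar>cA \<xi>\<bar>))"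
    using P_grid_bound by metis
  have l1: "real r * (min z (1 - z) * \<kappa>) > 0" using assms kappa_pos by (intro mult_pos_pos) auto
  have l2: "min \<beta> (1 - \<beta>) * \<kappa> > 0" using assms beta01 kappa_pos by (intro mult_pos_pos) auto
  \<comment> \<open>Power 3: one for the linear growth of \<open>frakE\<close>, two for 1 + a^2
    \<le> (1 + |a|)^2.\<close>
  obtain Q1 where Q1: "Q1 > 0" "\<And>t. t \<ge> 0 \<Longrightarrow> (1 + t) ^ 3 * exp (- (real r * (min z (1 - z) * \<kappa>)) * t) \<le> Q1"
    using polynomial_times_exp_decay[OF l1] by metis
  obtain Q2 where Q2: "Q2 > 0" "\<And>t. t \<ge> 0 \<Longrightarrow> (1 + t) ^ 2 * exp (- (min \<beta> (1 - \<beta>) * \<kappa>) * t) \<le> Q2"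
    using polynomial_times_exp_decay[OF l2] by metis
  have "norm (K \<xi>) \<le> (C1 * Q1 + C2 * Q2) / (1 + (cA \<xi>)\<^sup>2)" if g: "\<xi> \<in> grid" for \<xi>
  proof -
    let ?t = "\<bar>cA \<xi>\<bar>"
    have sq: "1 + (cA \<xi>)\<^sup>2 \<le> (1 + ?t)\<^sup>2" by (simp add: power2_eq_square algebra_simps flip: abs_mult)
    have "norm (D \<xi>) * (1 + (cA \<xi>)\<^sup>2) \<le> (C1 * (1 + ?t) * exp (- (real r * (min z (1 - z) * \<kappa>)) * ?t)) * (1 + ?t)\<^sup>2"
      using C1(1) C1(2)[OF g] by (intro mult_mono sq) auto
    also have "\<dots> = C1 * ((1 + ?t) ^ 3 * exp (- (real r * (min z (1 - z) * \<kappa>)) * ?t))"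
      by (simp add: power3_eq_cube power2_eq_square)
    also have "\<dots> \<le> C1 * Q1" using C1(1) by (intro mult_left_mono Q1(2)) auto
    finally have d: "norm (D \<xi>) * (1 + (cA \<xi>)\<^sup>2) \<le> C1 * Q1" .
    have "norm (P \<xi>) * (1 + (cA \<xi>)\<^sup>2) \<le> (C2 * exp (- (min \<beta> (1 - \<beta>) * \<kappa>) * ?t)) * (1 + ?t)\<^sup>2"
      using C2(1) C2(2)[OF g] by (intro mult_mono sq) auto
    also have "\<dots> = C2 * ((1 + ?t) ^ 2 * exp (- (min \<beta> (1 - \<beta>) * \<kappa>) * ?t))" by simp
    also have "\<dots> \<le> C2 * Q2" using C2(1) by (intro mult_left_mono Q2(2)) auto
    finally have p: "norm (P \<xi>) * (1 + (cA \<xi>)\<^sup>2) \<le> C2 * Q2" .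
    have "norm (K \<xi>) * (1 + (cA \<xi>)\<^sup>2) \<le> (norm (D \<xi>) + norm (P \<xi>)) * (1 + (cA \<xi>)\<^sup>2)"
      using norm_triangle_ineq4[of "D \<xi>" "P \<xi>"] K_eq[OF grid_not_lin[OF g]] by (intro mult_right_mono) auto
    also have "\<dots> \<le> C1 * Q1 + C2 * Q2" using d p by (simp add: distrib_right)
    finally show ?thesis by (subst pos_le_divide_eq) (auto simp: add_pos_nonneg)
  qed
  moreover have "C1 * Q1 + C2 * Q2 > 0" using C1 C2 Q1 Q2 by (simp add: add_pos_pos)
  ultimately show ?thesis by blast
qed

lemma holomorphic_K_over_power: "(\<lambda>\<xi>. K \<xi> / \<xi> ^ k) holomorphic_on - lat"
proof -
  have "0 \<in> lat" using pt_in_lat[of 0 0] by (simp add: pt_def)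
  then show ?thesis by (intro holomorphic_intros holomorphic_K) auto
qed

lemma box_sum_from_contour:
  assumes "norm (contour_integral (par (- (real M + 1/2)) (real M + 1/2) (- (real N + 1/2)) (real N + 1/2)) (\<lambda>\<xi>. K \<xi> / \<xi> ^ Suc j)) \<le> 2 * pi * B"
  shows "norm (S (Suc j) M N - (- coef j / cc)) \<le> B / norm cc"
proof -
  have "norm (2 * of_real pi * \<i> * (coef j + cc * S (Suc j) M N)) \<le> 2 * pi * B"
    using assms unfolding contour_integral_K .
  then have *: "norm (coef j + cc * S (Suc j) M N) \<le> B" by (simp add: norm_mult)
  have "S (Suc j) M N - (- coef j / cc) = (coef j + cc * S (Suc j) M N) / cc"
    using cc_nz by (simp add: field_simps)
  then show ?thesis using * by (simp add: norm_divide divide_right_mono)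
qed

text \<open>Here k = j + 2. With s = |a| + |b|, growth of degree j leaves a multiple of s^(-2) after
  division by \<xi>^k, and a^2 + b^2 \<le> s^2 gives a bound that suits all four sides.\<close>

lemma tendsto_box_sum_contour:
  assumes Q: "Q > 0" "\<And>\<xi>. \<xi> \<in> grid \<Longrightarrow> norm (K \<xi>) \<le> Q * (\<bar>cA \<xi>\<bar> + \<bar>cB \<xi>\<bar>) ^ j"
  shows "((\<lambda>(M, N). S (Suc (Suc j)) M N) \<longlongrightarrow> - coef (Suc j) / cc) (sequentially \<times>\<^sub>F sequentially)"
proof -
  obtain c where c: "c > 0" "\<And>\<xi>. c * (\<bar>cA \<xi>\<bar> + \<bar>cB \<xi>\<bar>) \<le> norm \<xi>" using lat_separation by metis
  define R where "R = Q / c ^ Suc (Suc j)"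
  have R: "R > 0" using Q c by (simp add: R_def)
  have f: "norm (K \<xi> / \<xi> ^ Suc (Suc j)) \<le> R / ((cA \<xi>)\<^sup>2 + (cB \<xi>)\<^sup>2)" if g: "\<xi> \<in> grid" for \<xi>
  proof -
    define s where "s = \<bar>cA \<xi>\<bar> + \<bar>cB \<xi>\<bar>"
    have s: "s \<ge> 1/2" using grid_s[OF g] by (simp add: s_def)
    have nz: "(cA \<xi>)\<^sup>2 + (cB \<xi>)\<^sup>2 > 0" using s unfolding s_def by (auto simp: sum_power2_gt_zero_iff)
    have "norm (K \<xi> / \<xi> ^ Suc (Suc j)) = norm (K \<xi>) / norm \<xi> ^ Suc (Suc j)"
      by (simp only: norm_divide norm_power)
    also have "\<dots> \<le> (Q * s ^ j) / (c * s) ^ Suc (Suc j)"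
      using Q(2)[OF g] c s unfolding s_def[symmetric]
      by (intro frac_le power_mono zero_less_power mult_pos_pos) (use c(2)[of \<xi>] Q(1) in \<open>auto simp: s_def\<close>)
    also have "\<dots> = R / s\<^sup>2" using s c by (simp add: R_def power_mult_distrib power2_eq_square)
    also have "\<dots> \<le> R / ((cA \<xi>)\<^sup>2 + (cB \<xi>)\<^sup>2)"
    proof -
      have "(cA \<xi>)\<^sup>2 + (cB \<xi>)\<^sup>2 \<le> s\<^sup>2" unfolding s_def power2_sum by simp
      then show ?thesis using R nz by (intro divide_left_mono mult_pos_pos) auto
    qed
    finally show ?thesis .
  qed
  define B where "B = R * (norm \<omega>1 + norm \<omega>2) * 2"
  have "norm (S (Suc (Suc j)) M N - (- coef (Suc j) / cc)) \<le> B * (inverse (real (Suc M)) + inverse (real (Suc N))) / norm cc" for M N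
  proof (rule box_sum_from_contour)
    let ?A = "real M + 1/2" and ?B = "real N + 1/2"
    have gh: "pt a b \<in> grid" if "b \<in> {?B, - ?B}" for a b
    proof -
      have "- ?B - 1/2 \<in> \<int>" by (rule minus_half_Int[OF half_integers])
      then show ?thesis using that half_integers[of N] by (auto simp: grid_def)
    qed
    have gv: "pt a b \<in> grid" if "a \<in> {?A, - ?A}" for a b
    proof -
      have "- ?A - 1/2 \<in> \<int>" by (rule minus_half_Int[OF half_integers])
      then show ?thesis using that half_integers[of M] by (auto simp: grid_def)
    qed
    have "norm (contour_integral (par (- ?A) ?A (- ?B) ?B) (\<lambda>\<xi>. K \<xi> / \<xi> ^ Suc (Suc j))) \<le> 2 * pi * (R * norm \<omega>1 / ?B + R * norm \<omega>2 / ?A)"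
    proof (rule contour_integral_box_bound[OF holomorphic_K_over_power])
      show "norm (K (pt a ?B) / pt a ?B ^ Suc (Suc j)) \<le> R / (?B\<^sup>2 + a\<^sup>2)" for a
        using f[OF gh[of ?B a]] by (simp add: add.commute del: power_Suc)
      show "norm (K (pt a (- ?B)) / pt a (- ?B) ^ Suc (Suc j)) \<le> R / (?B\<^sup>2 + a\<^sup>2)" for a
        using f[OF gh[of "- ?B" a]] by (simp only: cA_pt cB_pt power2_minus add.commute) simp
      show "norm (K (pt ?A b) / pt ?A b ^ Suc (Suc j)) \<le> R / (?A\<^sup>2 + b\<^sup>2)" for b
        using f[OF gv[of ?A b]] by (simp del: power_Suc)
      show "norm (K (pt (- ?A) b) / pt (- ?A) b ^ Suc (Suc j)) \<le> R / (?A\<^sup>2 + b\<^sup>2)" for b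
        using f[OF gv[of "- ?A" b]] by (simp only: cA_pt cB_pt power2_minus) simp
    qed auto
    also have "\<dots> \<le> 2 * pi * (B * (inverse (real (Suc M)) + inverse (real (Suc N))))"
    proof (intro mult_left_mono)
      have "R * norm \<omega>1 / ?B + R * norm \<omega>2 / ?A = R * norm \<omega>1 * (1 / ?B) + R * norm \<omega>2 * (1 / ?A)" by simp
      also have "\<dots> \<le> R * norm \<omega>1 * (2 * inverse (real (Suc N))) + R * norm \<omega>2 * (2 * inverse (real (Suc M)))"
        using R by (intro add_mono mult_left_mono inverse_half_le) auto
      also have "\<dots> \<le> B * inverse (real (Suc N)) + B * inverse (real (Suc M))"
      proof -
        have "R * norm \<omega>1 * 2 \<le> B" "R * norm \<omega>2 * 2 \<le> B" using R by (simp_all add: B_def)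
        then have "(R * norm \<omega>1 * 2) * inverse (real (Suc N)) + (R * norm \<omega>2 * 2) * inverse (real (Suc M)) \<le> B * inverse (real (Suc N)) + B * inverse (real (Suc M))"
          by (intro add_mono mult_right_mono) auto
        then show ?thesis by (simp only: mult.assoc)
      qed
      finally show "R * norm \<omega>1 / ?B + R * norm \<omega>2 / ?A \<le> B * (inverse (real (Suc M)) + inverse (real (Suc N)))"
        by (simp only: distrib_left add.commute)
    qed auto
    finally show "norm (contour_integral (par (- ?A) ?A (- ?B) ?B) (\<lambda>\<xi>. K \<xi> / \<xi> ^ Suc (Suc j))) \<le> 2 * pi * (B * (inverse (real (Suc M)) + inverse (real (Suc N))))" .
  qed
  then have "\<forall>\<^sub>F p in sequentially \<times>\<^sub>F sequentially. norm ((case p of (M, N) \<Rightarrow> S (Suc (Suc j)) M N) - (- coef (Suc j) / cc))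
      \<le> (case p of (M, N) \<Rightarrow> (B / norm cc) * (inverse (real (Suc M)) + inverse (real (Suc N))))"
    by (intro always_eventually) auto
  then have "((\<lambda>p. (case p of (M, N) \<Rightarrow> S (Suc (Suc j)) M N) - (- coef (Suc j) / cc)) \<longlongrightarrow> 0) (sequentially \<times>\<^sub>F sequentially)"
    by (rule Lim_null_comparison[OF _ tendsto_inverse_Suc_prod])
  then show ?thesis by (simp only: LIM_zero_iff)
qed

text \<open>On the sides along \<omega>1 the factor 1/|\<xi>| is O(1/N), and \<open>K\<close> is
  integrable along them. The sides along \<omega>2 have length of order N, and the decay of
  \<open>K\<close> at |a| = N + 1/2 outweighs it.\<close>

lemma tendsto_box_sum_diag:
  assumes Q: "Q > 0" "\<And>\<xi>. \<xi> \<in> grid \<Longrightarrow> norm (K \<xi>) \<le> Q / (1 + (cA \<xi>)\<^sup>2)"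
  shows "(\<lambda>N. S 1 N N) \<longlonglongrightarrow> - coef 0 / cc"
proof -
  obtain c where c: "c > 0" "\<And>\<xi>. c * (\<bar>cA \<xi>\<bar> + \<bar>cB \<xi>\<bar>) \<le> norm \<xi>" using lat_separation by metis
  define B where "B = Q / c * norm \<omega>1 * 2 + Q / c * norm \<omega>2 * 8"
  have "norm (S (Suc 0) N N - (- coef 0 / cc)) \<le> B * inverse (real (Suc N)) / norm cc" for N
  proof (rule box_sum_from_contour)
    let ?A = "real N + 1/2"
    have A: "?A \<ge> 1/2" by simp
    have nA: "- ?A - 1/2 \<in> \<int>" by (rule minus_half_Int[OF half_integers])
    have gh: "pt a b \<in> grid" if "b \<in> {?A, - ?A}" for a b
      using that half_integers[of N] nA by (auto simp: grid_def)
    have gv: "pt a b \<in> grid" if "a \<in> {?A, - ?A}" for a b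
      using that half_integers[of N] nA by (auto simp: grid_def)
    have f: "norm (K (pt a b) / pt a b ^ Suc 0) \<le> (Q / (c * ?A)) / (1 + a\<^sup>2)"
      if "pt a b \<in> grid" "?A \<le> \<bar>a\<bar> \<or> ?A \<le> \<bar>b\<bar>" for a b
    proof -
      have "c * ?A \<le> c * (\<bar>a\<bar> + \<bar>b\<bar>)" using c(1) that(2) by (intro mult_left_mono) auto
      also have "\<dots> \<le> norm (pt a b)" using c(2)[of "pt a b"] by simp
      finally have n: "c * ?A \<le> norm (pt a b)" .
      have "norm (K (pt a b) / pt a b ^ Suc 0) = norm (K (pt a b)) / norm (pt a b)" by (simp add: norm_divide)
      also have "\<dots> \<le> (Q / (1 + a\<^sup>2)) / (c * ?A)"
        using Q(2)[OF that(1)] c(1) Q(1) by (intro frac_le n mult_pos_pos) (auto simp: add_pos_nonneg)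
      finally show ?thesis by (simp add: mult.commute)
    qed
    \<comment> \<open>This is where the square enters: |b| \<le> A allows 1/(1 + A^2) to be replaced
      by 2/(A^2 + b^2), the form of the arctangent bound.\<close>
    have v: "(Q / (c * ?A)) / (1 + ?A\<^sup>2) \<le> (2 * Q / (c * ?A)) / (?A\<^sup>2 + b\<^sup>2)" if "\<bar>b\<bar> \<le> ?A" for b
    proof -
      have "b\<^sup>2 \<le> ?A\<^sup>2" using that by (simp add: abs_le_square_iff[symmetric])
      moreover have "(X + Y) / 2 \<le> 1 + X" if "Y \<le> X" for X Y :: real using that by simp
      ultimately have "(?A\<^sup>2 + b\<^sup>2) / 2 \<le> 1 + ?A\<^sup>2" by blast
      moreover have pos: "?A\<^sup>2 + b\<^sup>2 > 0" by (simp add: add_pos_nonneg)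
      ultimately have "(Q / (c * ?A)) / (1 + ?A\<^sup>2) \<le> (Q / (c * ?A)) / ((?A\<^sup>2 + b\<^sup>2) / 2)"
        using Q c by (intro divide_left_mono mult_pos_pos) (auto simp: add_pos_nonneg)
      then show ?thesis by (simp add: mult_ac)
    qed
    have "norm (contour_integral (par (- ?A) ?A (- ?A) ?A) (\<lambda>\<xi>. K \<xi> / \<xi> ^ Suc 0)) \<le>
        2 * pi * ((Q / (c * ?A)) * norm \<omega>1 / 1 + (2 * Q / (c * ?A)) * norm \<omega>2 / ?A)"
    proof (rule contour_integral_box_bound[OF holomorphic_K_over_power])
      show "norm (K (pt a ?A) / pt a ?A ^ Suc 0) \<le> (Q / (c * ?A)) / (1\<^sup>2 + a\<^sup>2)" for a
        using f[OF gh[of ?A a]] by simp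
      show "norm (K (pt a (- ?A)) / pt a (- ?A) ^ Suc 0) \<le> (Q / (c * ?A)) / (1\<^sup>2 + a\<^sup>2)" for a
        using f[OF gh[of "- ?A" a]] by simp
      show "norm (K (pt ?A b) / pt ?A b ^ Suc 0) \<le> (2 * Q / (c * ?A)) / (?A\<^sup>2 + b\<^sup>2)" if "\<bar>b\<bar> \<le> ?A" for b
        by (rule order_trans[OF f[OF gv] v[OF that]]) auto
      show "norm (K (pt (- ?A) b) / pt (- ?A) b ^ Suc 0) \<le> (2 * Q / (c * ?A)) / (?A\<^sup>2 + b\<^sup>2)" if "\<bar>b\<bar> \<le> ?A" for b
      proof -
        have "norm (K (pt (- ?A) b) / pt (- ?A) b ^ Suc 0) \<le> (Q / (c * ?A)) / (1 + (- ?A)\<^sup>2)"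
          by (rule f[OF gv]) auto
        then show ?thesis using v[OF that] by (simp only: power2_minus)
      qed
    qed auto
    also have "\<dots> \<le> 2 * pi * (B * inverse (real (Suc N)))"
    proof (intro mult_left_mono)
      have "1 / ?A \<le> 2" using A by (simp add: field_simps)
      then have "(1 / ?A) * (1 / ?A) \<le> 2 * (1 / ?A)" by (intro mult_right_mono) auto
      then have a2: "(1 / ?A) * (1 / ?A) \<le> 4 * inverse (real (Suc N))" using inverse_half_le[of N] by linarith
      have "(Q / (c * ?A)) * norm \<omega>1 / 1 + (2 * Q / (c * ?A)) * norm \<omega>2 / ?A =
          (Q / c * norm \<omega>1) * (1 / ?A) + (Q / c * norm \<omega>2 * 2) * ((1 / ?A) * (1 / ?A))" by (simp add: mult_ac)
      also have "\<dots> \<le> (Q / c * norm \<omega>1) * (2 * inverse (real (Suc N))) + (Q / c * norm \<omega>2 * 2) * (4 * inverse (real (Suc N)))"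
        using Q(1) c(1) by (intro add_mono mult_left_mono inverse_half_le a2) auto
      also have "\<dots> = B * inverse (real (Suc N))" by (simp add: B_def algebra_simps)
      finally show "(Q / (c * ?A)) * norm \<omega>1 / 1 + (2 * Q / (c * ?A)) * norm \<omega>2 / ?A \<le> B * inverse (real (Suc N))" .
    qed auto
    finally show "norm (contour_integral (par (- ?A) ?A (- ?A) ?A) (\<lambda>\<xi>. K \<xi> / \<xi> ^ Suc 0)) \<le> 2 * pi * (B * inverse (real (Suc N)))" .
  qed
  then have "\<forall>\<^sub>F N in sequentially. norm (S 1 N N - (- coef 0 / cc)) \<le> (B / norm cc) * inverse (real (Suc N))"
    by (intro always_eventually) auto
  moreover have "(\<lambda>N. (B / norm cc) * inverse (real (Suc N))) \<longlonglongrightarrow> 0"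
    using tendsto_mult[OF tendsto_const LIMSEQ_inverse_real_of_nat, of "B / norm cc"] by simp
  ultimately have "(\<lambda>N. S 1 N N - (- coef 0 / cc)) \<longlonglongrightarrow> 0" by (rule Lim_null_comparison)
  then show ?thesis by (simp only: LIM_zero_iff)
qed

lemma box_sum_alt: "S k M N = (\<Sum>mn\<in>index_set \<inter> ibox M N. (\<lambda>(m, n). termT r k x y z \<omega>1 \<omega>2 m n) mn)"
  by (simp add: box_sum_def)

lemma tendsto_box_sum_ge3:
  assumes "k \<ge> 3"
  shows "((\<lambda>(M, N). S k M N) \<longlongrightarrow> - coef (k - 1) / cc) (sequentially \<times>\<^sub>F sequentially)"
proof -
  obtain C where C: "C > 0" "\<And>\<xi>. \<xi> \<in> grid \<Longrightarrow> norm (K \<xi>) \<le> C * (1 + \<bar>cA \<xi>\<bar>)" using K_grid_linear by blast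
  define i where "i = k - 3"
  have k: "k = Suc (Suc (Suc i))" using assms by (simp add: i_def)
  have "norm (K \<xi>) \<le> (C * 3 * 2 ^ i) * (\<bar>cA \<xi>\<bar> + \<bar>cB \<xi>\<bar>) ^ Suc i" if g: "\<xi> \<in> grid" for \<xi>
  proof -
    define s where "s = \<bar>cA \<xi>\<bar> + \<bar>cB \<xi>\<bar>"
    have s: "s \<ge> 1/2" using grid_s[OF g] by (simp add: s_def)
    \<comment> \<open>On the grid s \<ge> 1/2, whence 1 + |a| \<le> 3s, and (2s)^i \<ge> 1 raises
      the degree to k - 2 = i + 1.\<close>
    have "1 + A \<le> 3 * (A + B)" if "1/2 \<le> A + B" "0 \<le> B" for A B :: real using that by simp
    from this[of "\<bar>cA \<xi>\<bar>" "\<bar>cB \<xi>\<bar>"] have "1 + \<bar>cA \<xi>\<bar> \<le> 3 * s" using s by (simp only: s_def abs_ge_zero)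
    also have "\<dots> \<le> 3 * s * (2 * s) ^ i"
      using mult_left_mono[OF one_le_power[of "2 * s" i], of "3 * s"] s by simp
    finally have "C * (1 + \<bar>cA \<xi>\<bar>) \<le> C * (3 * s * (2 * s) ^ i)" using C(1) by (intro mult_left_mono) auto
    also have "\<dots> = (C * 3 * 2 ^ i) * s ^ Suc i" by (simp add: power_mult_distrib)
    finally show ?thesis using C(2)[OF g] unfolding s_def by linarith
  qed
  from tendsto_box_sum_contour[OF _ this] C(1) show ?thesis by (simp add: k)
qed

lemma tendsto_box_sum_2:
  assumes "(x, y) \<noteq> (0, 0) \<or> 0 < z \<and> z < 1" "r \<ge> 1"
  shows "((\<lambda>(M, N). S 2 M N) \<longlongrightarrow> - coef 1 / cc) (sequentially \<times>\<^sub>F sequentially)"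
proof -
  obtain C where C: "C > 0" "\<And>\<xi>. \<xi> \<in> grid \<Longrightarrow> norm (K \<xi>) \<le> C" using K_grid_bounded[OF assms] by blast
  have "norm (K \<xi>) \<le> C * (\<bar>cA \<xi>\<bar> + \<bar>cB \<xi>\<bar>) ^ 0" if "\<xi> \<in> grid" for \<xi> using C(2)[OF that] by simp
  from tendsto_box_sum_contour[OF C(1) this] show ?thesis by (simp add: numeral_2_eq_2)
qed

text \<open>For z = 0 or 1 nothing decays exponentially, but once one index is confined to a bounded
  range the terms are summable over the other.\<close>

lemma rows_cols_2:
  shows "convergent (\<lambda>N. S 2 M N)" and "convergent (\<lambda>M. S 2 M N)"
proof -
  obtain C c where C: "C > 0" "c > 0" "\<forall>x y z k m n. 0 \<le> z \<longrightarrow> z \<le> 1 \<longrightarrow> m \<noteq> 0 \<longrightarrow>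
    norm (termT r k x y z \<omega>1 \<omega>2 m n) \<le>
      C * decay r z \<bar>of_int m\<bar> / (c * (\<bar>of_int m\<bar> + \<bar>of_int n\<bar>)) ^ k"
    using termT_bound[of r] by blast
  have T: "norm (termT r 2 x y z \<omega>1 \<omega>2 m n) \<le> C / c\<^sup>2 * (1 / (\<bar>of_int m\<bar> + \<bar>of_int n\<bar>)\<^sup>2)" if "m \<noteq> 0" for m n
  proof -
    have "norm (termT r 2 x y z \<omega>1 \<omega>2 m n) \<le>
      C * decay r z \<bar>of_int m\<bar> / (c * (\<bar>of_int m\<bar> + \<bar>of_int n\<bar>)) ^ 2"
      using C(3) z01 that by blast
    also have "\<dots> \<le> C * 1 / (c * (\<bar>of_int m\<bar> + \<bar>of_int n\<bar>)) ^ 2"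
      using C(1,2) z01 kappa_pos by (intro divide_right_mono mult_left_mono) auto
    also have "\<dots> = C / c\<^sup>2 * (1 / (\<bar>of_int m\<bar> + \<bar>of_int n\<bar>)\<^sup>2)" by (simp add: power_mult_distrib)
    finally show ?thesis .
  qed
  have Cc: "C / c\<^sup>2 \<ge> 0" using C by simp
  have n: "norm (termT r 2 x y z \<omega>1 \<omega>2 m n) \<le> C / c\<^sup>2 * wt n" if "m \<noteq> 0" for m n
  proof -
    have "1 + \<bar>real_of_int n\<bar> \<le> \<bar>of_int m\<bar> + \<bar>of_int n\<bar>" using that by linarith
    then have "1 / (\<bar>real_of_int m\<bar> + \<bar>of_int n\<bar>)\<^sup>2 \<le> 1 / (1 + \<bar>of_int n\<bar>)\<^sup>2"
      by (intro divide_left_mono power_mono) (auto simp: add_pos_nonneg)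
    also have "\<dots> \<le> wt n" by (rule wt_ge)
    finally show ?thesis using T[OF that, of n] mult_left_mono[OF _ Cc] order_trans by blast
  qed
  have m: "norm (termT r 2 x y z \<omega>1 \<omega>2 m n) \<le> C / c\<^sup>2 * (4 * wt m)" if "m \<noteq> 0" for m n
  proof -
    have "\<bar>real_of_int m\<bar> \<ge> 1" using that by linarith
    then have "(1 + \<bar>real_of_int m\<bar>) / 2 \<le> \<bar>of_int m\<bar> + \<bar>of_int n\<bar>" using abs_ge_zero[of "real_of_int n"] by simp
    then have "1 / (\<bar>real_of_int m\<bar> + \<bar>of_int n\<bar>)\<^sup>2 \<le> 1 / ((1 + \<bar>of_int m\<bar>) / 2)\<^sup>2"
      using that by (intro divide_left_mono power_mono) (auto simp: add_pos_nonneg)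
    also have "\<dots> = 4 * (1 / (1 + \<bar>of_int m\<bar>)\<^sup>2)" by (simp add: power_divide)
    also have "\<dots> \<le> 4 * wt m" by (intro mult_left_mono wt_ge) auto
    finally show ?thesis using T[OF that, of n] mult_left_mono[OF _ Cc] order_trans by blast
  qed
  let ?f = "\<lambda>(m, n). termT r 2 x y z \<omega>1 \<omega>2 m n"
  \<comment> \<open>For |m| \<le> M the quotient of \<open>wt m\<close> by \<open>wt M\<close> is at
    least 1; inserting it produces the two-variable majorant.\<close>
  have "norm (?f (m, n)) \<le> (C / c\<^sup>2 / wt (int M)) * (wt m * wt n)" if mn: "(m, n) \<in> index_set \<inter> {- int M..int M} \<times> UNIV" for m n
  proof -
    have "m \<noteq> 0" "\<bar>m\<bar> \<le> int M" using mn by (auto simp: index_set_def)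
    then have "norm (?f (m, n)) \<le> C / c\<^sup>2 * wt n * 1" using n by simp
    also have "\<dots> \<le> C / c\<^sup>2 * wt n * (wt m / wt (int M))"
      using wt_pos[of "int M"] wt_antimono[OF \<open>\<bar>m\<bar> \<le> int M\<close>]
      by (intro mult_left_mono mult_nonneg_nonneg[OF Cc] less_imp_le[OF wt_pos]) simp
    finally show ?thesis by (simp add: mult_ac)
  qed
  then have "?f summable_on (index_set \<inter> {- int M..int M} \<times> UNIV)"
    by (rule Infinite_Sum.abs_summable_summable[OF summable_on_bounded_by_wt])
  then show "convergent (\<lambda>N. S 2 M N)" unfolding box_sum_alt by (rule convergent_box_rows)
  have "norm (?f (m, n)) \<le> (C / c\<^sup>2 * 4 / wt (int N)) * (wt m * wt n)" if mn: "(m, n) \<in> index_set \<inter> UNIV \<times> {- int N..int N}" for m n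
  proof -
    have "m \<noteq> 0" "\<bar>n\<bar> \<le> int N" using mn by (auto simp: index_set_def)
    then have "norm (?f (m, n)) \<le> C / c\<^sup>2 * (4 * wt m) * 1" using m by simp
    also have "\<dots> \<le> C / c\<^sup>2 * (4 * wt m) * (wt n / wt (int N))"
      using wt_pos[of "int N"] wt_antimono[OF \<open>\<bar>n\<bar> \<le> int N\<close>] less_imp_le[OF wt_pos[of m]]
      by (intro mult_left_mono mult_nonneg_nonneg[OF Cc]) simp_all
    finally show ?thesis by (simp add: mult_ac)
  qed
  then have "?f summable_on (index_set \<inter> UNIV \<times> {- int N..int N})"
    by (rule Infinite_Sum.abs_summable_summable[OF summable_on_bounded_by_wt])
  then show "convergent (\<lambda>M. S 2 M N)" unfolding box_sum_alt by (rule convergent_box_cols)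
qed

section \<open>The case k = 1: summation by parts\<close>

definition chi :: "int \<Rightarrow> complex" where
  "chi n = exp (2 * of_real pi * \<i> * (of_int n * (of_real y + of_nat r * of_real z)))"

text \<open>The part of the summand that depends on m only. The exponent k = 0 removes the
  denominator, so that \<open>termT_bound\<close> applies directly.\<close>

definition amp :: "int \<Rightarrow> complex" where
  "amp m = termT r 0 x y z \<omega>1 \<omega>2 m 0"

lemma norm_chi: "norm (chi n) = 1"
  by (simp add: chi_def norm_exp_eq_Re)

lemma chi_Suc: "chi (n + 1) = q * chi n"
  by (simp add: chi_def q_eq exp_add[symmetric] algebra_simps)

lemma termT_1: "termT r 1 x y z \<omega>1 \<omega>2 m n = amp m * chi n / pt (of_int m) (of_int n)"
proof -
  have "(-1) powi (int r * n) * exp (2 * of_real pi * \<i> *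
      (of_int m * (of_real x + of_nat r * (of_real z - 1/2) / (\<omega>2 / \<omega>1))
        + of_int n * (of_real y + of_nat r * (of_real z - 1/2)))) =
      exp (2 * of_real pi * \<i> * (of_int m * (of_real x + of_nat r * (of_real z - 1/2) / (\<omega>2 / \<omega>1)))) * chi n"
    unfolding minus_one_powi_eq_exp chi_def exp_add[symmetric] by (rule arg_cong[of _ _ exp]) (simp add: algebra_simps)
  then show ?thesis by (simp add: termT_def amp_def pt_def mult_ac Let_def)
qed

lemma norm_amp_le:
  assumes "0 < z" "z < 1" "r \<ge> 1"
  shows "\<exists>C>0. \<forall>m. m \<noteq> 0 \<longrightarrow> norm (amp m) \<le> C * wt m"
proof -
  obtain C c where C: "C > 0" "c > 0" "\<forall>x y z k m n. 0 \<le> z \<longrightarrow> z \<le> 1 \<longrightarrow> m \<noteq> 0 \<longrightarrow>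
    norm (termT r k x y z \<omega>1 \<omega>2 m n) \<le>
      C * decay r z \<bar>of_int m\<bar> / (c * (\<bar>of_int m\<bar> + \<bar>of_int n\<bar>)) ^ k"
    using termT_bound[of r] by blast
  have l: "real r * (min z (1 - z) * \<kappa>) > 0" using assms kappa_pos by (intro mult_pos_pos) auto
  obtain Q where Q: "Q > 0" "\<And>t. t \<ge> 0 \<Longrightarrow> (1 + t) ^ 2 * exp (- (real r * (min z (1 - z) * \<kappa>)) * t) \<le> Q"
    using polynomial_times_exp_decay[OF l] by metis
  have "norm (amp m) \<le> C * Q * wt m" if "m \<noteq> 0" for m
  proof -
    let ?e = "decay r z \<bar>real_of_int m\<bar>"
    have pos: "(1 + \<bar>real_of_int m\<bar>)\<^sup>2 > 0" by (simp add: add_pos_nonneg)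
    have "norm (amp m) \<le> C * ?e / (c * (\<bar>of_int m\<bar> + \<bar>of_int 0\<bar>)) ^ 0"
      unfolding amp_def using C(3) z01 that by blast
    then have "norm (amp m) \<le> C * ?e" by simp
    also have "?e \<le> Q * (1 / (1 + \<bar>of_int m\<bar>)\<^sup>2)"
    proof -
      have "(1 + \<bar>real_of_int m\<bar>)\<^sup>2 * ?e \<le> Q" using Q(2)[of "\<bar>real_of_int m\<bar>"] by simp
      then have "?e \<le> Q / (1 + \<bar>of_int m\<bar>)\<^sup>2" by (subst pos_le_divide_eq[OF pos]) (simp only: mult.commute)
      then show ?thesis by simp
    qed
    also have "Q * (1 / (1 + \<bar>of_int m\<bar>)\<^sup>2) \<le> Q * wt m" using Q(1) by (intro mult_left_mono wt_ge) auto
    finally show ?thesis using C(1) by simp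
  qed
  moreover have "C * Q > 0" using C Q by simp
  ultimately show ?thesis by blast
qed

lemma q_neq_1:
  assumes "y + real r * z \<notin> \<int>"
  shows "q \<noteq> 1" "\<beta> > 0"
proof -
  show b: "\<beta> > 0" using assms by (simp add: \<beta>_def frac_gt_0_iff)
  show "q \<noteq> 1"
  proof
    assume "q = 1"
    then obtain n :: int where "Im (2 * of_real pi * \<i> * of_real \<beta>) = of_int (2 * n) * pi"
      unfolding q_def exp_eq_1 by blast
    then have "\<beta> = of_int n" by simp
    then show False using b beta01 by simp
  qed
qed

lemma box_sum_1_limits:
  assumes z: "0 < z" "z < 1" and r: "r \<ge> 1" and nI: "y + real r * z \<notin> \<int>"
  shows "\<exists>L. ((\<lambda>(M, N). S 1 M N) \<longlongrightarrow> L) (sequentially \<times>\<^sub>F sequentially)"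
    and "convergent (\<lambda>N. S 1 M N)" and "convergent (\<lambda>M. S 1 M N)"
proof -
  obtain C where C: "C > 0" "\<And>m. m \<noteq> 0 \<Longrightarrow> norm (amp m) \<le> C * wt m" using norm_amp_le[OF z r] by blast
  obtain c where c: "c > 0" "\<And>a b. c * (\<bar>a\<bar> + \<bar>b\<bar>) \<le> norm (pt a b)" using norm_pt_ge by blast
  have q1: "q - 1 \<noteq> 0" using q_neq_1(1)[OF nI] by simp
  define p where "p m n = pt (of_int m) (of_int n)" for m n :: int
  define V where "V m n = amp m * chi n / p m (n - 1)" for m n
  define U where "U = (\<lambda>(m, n). amp m * chi n * (1 / p m (n - 1) - 1 / p m n))"
  let ?T = "\<lambda>(m, n). termT r 1 x y z \<omega>1 \<omega>2 m n"
  \<comment> \<open>summation by parts in \<open>n\<close>: \<open>U\<close> is absolutely summable, and \<open>V\<close> telescopes\<close>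
  have abel: "(q - 1) * ?T (m, n) = U (m, n) + (V m (n + 1) - V m n)" for m n
  proof -
    have "V m (n + 1) = q * (amp m * chi n / p m n)" unfolding V_def chi_Suc by simp
    moreover have "?T (m, n) = amp m * chi n / p m n" by (simp add: termT_1[unfolded One_nat_def] p_def)
    moreover have "U (m, n) = V m n - amp m * chi n / p m n" by (simp add: U_def V_def right_diff_distrib)
    ultimately show ?thesis by (simp only: left_diff_distrib) simp
  qed
  have pge: "norm (p m n) \<ge> c * (1 + \<bar>of_int n\<bar>)" if "m \<noteq> 0" for m n
  proof -
    have "\<bar>real_of_int m\<bar> \<ge> 1" using that by linarith
    then have "c * (1 + \<bar>of_int n\<bar>) \<le> c * (\<bar>of_int m\<bar> + \<bar>of_int n\<bar>)" using c(1) by (intro mult_left_mono) auto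
    then show ?thesis using c(2)[of "of_int m" "of_int n"] by (simp add: p_def)
  qed
  have ppos: "0 < c * (1 + \<bar>real_of_int n\<bar>)" for n :: int using c(1) by (intro mult_pos_pos) auto
  have Vb: "norm (V m n) \<le> C * wt m / (c * (1 + \<bar>of_int (n - 1)\<bar>))" if "m \<noteq> 0" for m n
  proof -
    have "norm (V m n) = norm (amp m) / norm (p m (n - 1))" by (simp add: V_def norm_mult norm_divide norm_chi)
    also have "\<dots> \<le> C * wt m / (c * (1 + \<bar>of_int (n - 1)\<bar>))"
      using C(1) less_imp_le[OF wt_pos[of m]] by (intro frac_le C(2) pge ppos that) auto
    finally show ?thesis .
  qed
  \<comment> \<open>The difference of reciprocals is \<omega>2 divided by
    \<open>p m (n - 1) * p m n\<close>, which gains a power of n; the decay of \<open>amp\<close>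
    handles m. Replacing n - 1 by n costs a factor 2.\<close>
  have Ub: "norm (U (m, n)) \<le> (C * norm \<omega>2 * 2 / c\<^sup>2) * (wt m * wt n)" if m: "m \<noteq> 0" for m n
  proof -
    have nz: "p m n \<noteq> 0" "p m (n - 1) \<noteq> 0" using pge[OF m] ppos by (metis norm_zero not_less)+
    have "1 / p m (n - 1) - 1 / p m n = \<omega>2 / (p m (n - 1) * p m n)"
    proof -
      have "p m n - p m (n - 1) = \<omega>2" by (simp add: p_def pt_def algebra_simps)
      then show ?thesis using nz by (simp add: diff_frac_eq)
    qed
    then have "norm (U (m, n)) = norm (amp m) * norm \<omega>2 / (norm (p m (n - 1)) * norm (p m n))"
      by (simp add: U_def norm_mult norm_divide norm_chi)
    also have "\<dots> \<le> (C * wt m) * norm \<omega>2 / ((c * ((1 + \<bar>of_int n\<bar>) / 2)) * (c * (1 + \<bar>of_int n\<bar>)))"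
    proof (intro frac_le mult_mono mult_right_mono C(2) m pge mult_pos_pos ppos)
      have "(1 + \<bar>real_of_int n\<bar>) / 2 \<le> 1 + \<bar>of_int (n - 1)\<bar>"
        by (cases "n \<ge> 1") auto
      then have "c * ((1 + \<bar>real_of_int n\<bar>) / 2) \<le> c * (1 + \<bar>of_int (n - 1)\<bar>)" using c(1) by (intro mult_left_mono) auto
      then show "c * ((1 + \<bar>of_int n\<bar>) / 2) \<le> norm (p m (n - 1))" using pge[OF m, of "n - 1"] by linarith
    qed (use C(1) c(1) less_imp_le[OF wt_pos[of m]] in auto)
    also have "\<dots> = (C * norm \<omega>2 * 2 / c\<^sup>2) * (wt m * (1 / (1 + \<bar>of_int n\<bar>)\<^sup>2))"
      by (simp add: power2_eq_square mult_ac)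
    also have "\<dots> \<le> (C * norm \<omega>2 * 2 / c\<^sup>2) * (wt m * wt n)"
      using C(1) less_imp_le[OF wt_pos[of m]] by (intro mult_left_mono wt_ge) auto
    finally show ?thesis .
  qed
  have Us: "U summable_on I" if "I \<subseteq> index_set" for I
    by (rule Infinite_Sum.abs_summable_summable[OF summable_on_bounded_by_wt[of _ _ "C * norm \<omega>2 * 2 / c\<^sup>2"]])
      (use Ub that in \<open>auto simp: index_set_def\<close>)
  \<comment> \<open>The end terms left by telescoping in n. They are O(1/N) uniformly in M, because
    the weights have the finite sum \<open>W\<close>.\<close>
  define R where "R M N = (\<Sum>m\<in>{- int M..int M} - {0}. V m (int N + 1) - V m (- int N))" for M N
  have S_eq: "S 1 M N = ((\<Sum>x\<in>index_set \<inter> ibox M N. U x) + R M N) / (q - 1)" for M N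
  proof -
    have ib: "index_set \<inter> ibox M N = ({- int M..int M} - {0}) \<times> {- int N..int N}" by (auto simp: index_set_def)
    have "(q - 1) * S 1 M N = (\<Sum>mn\<in>index_set \<inter> ibox M N. (q - 1) * ?T mn)"
      unfolding box_sum_alt by (rule sum_distrib_left)
    also have "\<dots> = (\<Sum>mn\<in>index_set \<inter> ibox M N. U mn + (case mn of (m, n) \<Rightarrow> V m (n + 1) - V m n))"
      by (rule sum.cong[OF refl]) (use abel in auto)
    also have "\<dots> = (\<Sum>x\<in>index_set \<inter> ibox M N. U x) + (\<Sum>mn\<in>index_set \<inter> ibox M N. case mn of (m, n) \<Rightarrow> V m (n + 1) - V m n)"
      by (rule sum.distrib)
    also have "(\<Sum>mn\<in>index_set \<inter> ibox M N. case mn of (m, n) \<Rightarrow> V m (n + 1) - V m n) = R M N"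
      unfolding ib R_def by (simp only: sum.cartesian_product[symmetric] sum_telescope_int)
    finally show ?thesis using q1 by (simp add: field_simps)
  qed
  define W where "W = infsum wt UNIV"
  have Rb: "norm (R M N) \<le> (2 * C * W / c) * inverse (real (Suc N))" for M N
  proof -
    have "norm (R M N) \<le> (\<Sum>m\<in>{- int M..int M} - {0}. norm (V m (int N + 1) - V m (- int N)))"
      unfolding R_def by (rule norm_sum)
    also have "\<dots> \<le> (\<Sum>m\<in>{- int M..int M} - {0}. (2 * C / c * inverse (real (Suc N))) * wt m)"
    proof (rule sum_mono)
      fix m assume "m \<in> {- int M..int M} - {0}"
      then have m: "m \<noteq> 0" by simp
      have "norm (V m (int N + 1)) \<le> C * wt m / (c * real (Suc N))"
        using Vb[OF m, of "int N + 1"] by (simp add: add.commute)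
      moreover have "norm (V m (- int N)) \<le> C * wt m / (c * real (Suc N))"
      proof -
        have "C * wt m / (c * (1 + \<bar>of_int (- int N - 1)\<bar>)) \<le> C * wt m / (c * real (Suc N))"
          using C(1) c(1) less_imp_le[OF wt_pos[of m]] by (intro frac_le mult_left_mono mult_pos_pos) auto
        then show ?thesis using Vb[OF m, of "- int N"] by linarith
      qed
      ultimately have "norm (V m (int N + 1) - V m (- int N)) \<le> C * wt m / (c * real (Suc N)) + C * wt m / (c * real (Suc N))"
        using norm_triangle_ineq4[of "V m (int N + 1)" "V m (- int N)"] by linarith
      also have "\<dots> = (2 * C / c * inverse (real (Suc N))) * wt m" by (simp add: divide_inverse)
      finally show "norm (V m (int N + 1) - V m (- int N)) \<le> (2 * C / c * inverse (real (Suc N))) * wt m" .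
    qed
    also have "\<dots> = (2 * C / c * inverse (real (Suc N))) * (\<Sum>m\<in>{- int M..int M} - {0}. wt m)"
      by (rule sum_distrib_left[symmetric])
    also have "\<dots> \<le> (2 * C / c * inverse (real (Suc N))) * W"
      unfolding W_def using C(1) c(1)
      by (intro mult_left_mono finite_sum_le_infsum summable_wt) (auto intro: less_imp_le[OF wt_pos])
    finally show ?thesis by (simp add: mult_ac)
  qed
  have W0: "2 * C * W / c \<ge> 0"
    unfolding W_def using C(1) c(1) infsum_nonneg[of UNIV wt] wt_pos by (simp add: less_imp_le)
  show "\<exists>L. ((\<lambda>(M, N). S 1 M N) \<longlongrightarrow> L) (sequentially \<times>\<^sub>F sequentially)"
  proof -
    have "((\<lambda>(M, N). \<Sum>x\<in>index_set \<inter> ibox M N. U x) \<longlongrightarrow> infsum U index_set) (sequentially \<times>\<^sub>F sequentially)"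
      by (rule tendsto_box_sum[OF has_sum_infsum[OF Us]]) simp
    moreover have "((\<lambda>(M, N). R M N) \<longlongrightarrow> 0) (sequentially \<times>\<^sub>F sequentially)"
    proof (rule Lim_null_comparison[OF _ tendsto_inverse_Suc_prod])
      have "norm (R M N) \<le> (2 * C * W / c) * (inverse (real (Suc M)) + inverse (real (Suc N)))" for M N
        by (rule order_trans[OF Rb mult_left_mono[OF _ W0]]) simp
      then show "\<forall>\<^sub>F p in sequentially \<times>\<^sub>F sequentially. norm (case p of (M, N) \<Rightarrow> R M N)
          \<le> (case p of (M, N) \<Rightarrow> (2 * C * W / c) * (inverse (real (Suc M)) + inverse (real (Suc N))))"
        by (intro always_eventually) auto
    qed
    ultimately have "((\<lambda>p. ((case p of (M, N) \<Rightarrow> \<Sum>x\<in>index_set \<inter> ibox M N. U x) + (case p of (M, N) \<Rightarrow> R M N)) / (q - 1))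
        \<longlongrightarrow> (infsum U index_set + 0) / (q - 1)) (sequentially \<times>\<^sub>F sequentially)"
      using q1 by (intro tendsto_intros)
    then show ?thesis unfolding S_eq by (auto simp: case_prod_unfold)
  qed
  show "convergent (\<lambda>N. S 1 M N)"
  proof -
    have "convergent (\<lambda>N. \<Sum>x\<in>index_set \<inter> ibox M N. U x)" by (rule convergent_box_rows[OF Us]) simp
    moreover have "(\<lambda>N. R M N) \<longlonglongrightarrow> 0"
    proof (rule Lim_null_comparison)
      show "\<forall>\<^sub>F N in sequentially. norm (R M N) \<le> (2 * C * W / c) * inverse (real (Suc N))"
        using Rb by (intro always_eventually) auto
      show "(\<lambda>N. (2 * C * W / c) * inverse (real (Suc N))) \<longlonglongrightarrow> 0"
        using tendsto_mult[OF tendsto_const LIMSEQ_inverse_real_of_nat, of "2 * C * W / c"] by simp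
    qed
    then have "convergent (\<lambda>N. R M N)" by (rule convergentI)
    ultimately have "convergent (\<lambda>N. (1 / (q - 1)) * ((\<Sum>x\<in>index_set \<inter> ibox M N. U x) + R M N))"
      by (intro convergent_mult convergent_add convergent_const)
    then show ?thesis unfolding S_eq by simp
  qed
  show "convergent (\<lambda>M. S 1 M N)"
  proof -
    \<comment> \<open>With n in a bounded range the decay of \<open>amp\<close> in m gives absolute
      convergence directly.\<close>
    have "norm (?T (m, n)) \<le> (C / c / wt (int N)) * (wt m * wt n)" if mn: "(m, n) \<in> index_set \<inter> UNIV \<times> {- int N..int N}" for m n
    proof -
      have m: "m \<noteq> 0" and n: "\<bar>n\<bar> \<le> int N" using mn by (auto simp: index_set_def)
      have "c * 1 \<le> c * (1 + \<bar>real_of_int n\<bar>)" using c(1) by (intro mult_left_mono) auto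
      then have pc: "c \<le> norm (p m n)" using pge[OF m, of n] by simp
      have "norm (?T (m, n)) = norm (amp m) / norm (p m n)"
        by (simp add: termT_1[unfolded One_nat_def] norm_mult norm_divide norm_chi p_def)
      also have "\<dots> \<le> C * wt m / c"
        using C(1) c(1) less_imp_le[OF wt_pos[of m]] by (intro frac_le C(2) m pc) auto
      also have "\<dots> = (C * wt m / c) * 1" by simp
      also have "\<dots> \<le> (C * wt m / c) * (wt n / wt (int N))"
        using wt_pos[of "int N"] wt_antimono[OF n] C(1) c(1) less_imp_le[OF wt_pos[of m]] by (intro mult_left_mono) auto
      finally show ?thesis by (simp add: mult_ac)
    qed
    then have "?T summable_on (index_set \<inter> UNIV \<times> {- int N..int N})"
      by (rule Infinite_Sum.abs_summable_summable[OF summable_on_bounded_by_wt])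
    then show ?thesis unfolding box_sum_alt by (rule convergent_box_cols)
  qed
qed

lemma prod_sequentially_neq_bot: "sequentially \<times>\<^sub>F sequentially \<noteq> bot"
  by (simp add: prod_filter_eq_bot)

text \<open>The box sums are evaluated twice: the contour integral gives the Taylor coefficient, and
  absolute summation or \<open>has_Lim\<close> gives \<open>calG\<close>. Uniqueness of limits
  equates the two.\<close>

lemma coef_eq_calG:
  assumes r: "r \<ge> 1" and k: "k \<ge> 1"
    and k2: "k = 2 \<and> z \<in> {0, 1} \<longrightarrow> (x, y) \<noteq> (0, 0)"
    and k1: "k = 1 \<longrightarrow> 0 < z \<and> z < 1 \<and> y + real r * z \<notin> \<int>"
  shows "coef (k - 1) = - cc * calG r k x y z \<omega>1 \<omega>2"
    and "\<not> abs_case k z \<Longrightarrow> has_Lim (box_sum r k x y z \<omega>1 \<omega>2) (calG r k x y z \<omega>1 \<omega>2)"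
proof -
  let ?L = "- coef (k - 1) / cc"
  have "calG r k x y z \<omega>1 \<omega>2 = ?L \<and> (\<not> abs_case k z \<longrightarrow> has_Lim (box_sum r k x y z \<omega>1 \<omega>2) ?L)"
  proof (cases "abs_case k z")
    case True
    have "((\<lambda>(M, N). S k M N) \<longlongrightarrow> ?L) (sequentially \<times>\<^sub>F sequentially)"
      using True tendsto_box_sum_ge3 tendsto_box_sum_2 r by (auto simp: abs_case_def)
    moreover have "((\<lambda>(M, N). S k M N) \<longlongrightarrow> calG r k x y z \<omega>1 \<omega>2) (sequentially \<times>\<^sub>F sequentially)"
    proof -
      have "((\<lambda>(m, n). termT r k x y z \<omega>1 \<omega>2 m n) has_sum calG r k x y z \<omega>1 \<omega>2) index_set"
        using has_sum_infsum[OF Infinite_Sum.abs_summable_summable[OF abs_summable_termT[OF r z01 True]]] True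
        by (simp add: calG_def)
      from tendsto_box_sum[OF this] show ?thesis by (simp only: box_sum_alt)
    qed
    ultimately show ?thesis using True tendsto_unique[OF prod_sequentially_neq_bot] by blast
  next
    case False
    then have cases: "k = 1 \<or> k = 2 \<and> z \<in> {0, 1}" using k z01 by (auto simp: abs_case_def)
    have "has_Lim (box_sum r k x y z \<omega>1 \<omega>2) ?L"
    proof (cases "k = 1")
      case True
      then have z: "0 < z" "z < 1" and nI: "y + real r * z \<notin> \<int>" using k1 by auto
      obtain L where L: "((\<lambda>(M, N). S 1 M N) \<longlongrightarrow> L) (sequentially \<times>\<^sub>F sequentially)"
        using box_sum_1_limits(1)[OF z r nI] by blast
      obtain Q where Q: "Q > 0" "\<And>\<xi>. \<xi> \<in> grid \<Longrightarrow> norm (K \<xi>) \<le> Q / (1 + (cA \<xi>)\<^sup>2)"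
        using K_grid_decay[OF z q_neq_1(2)[OF nI] r] by blast
      \<comment> \<open>Summation by parts has shown that a joint limit \<open>L\<close> exists; the
        contours with M = N then determine its value.\<close>
      have "(\<lambda>N. S 1 N N) \<longlonglongrightarrow> L" using filterlim_compose[OF L filterlim_diag] by simp
      then have "L = - coef 0 / cc" using tendsto_box_sum_diag[OF Q] LIMSEQ_unique by blast
      then show ?thesis
        using has_LimI[OF L box_sum_1_limits(2,3)[OF z r nI]] True by simp
    next
      case False
      then have k: "k = 2" "(x, y) \<noteq> (0, 0)" using cases k2 by auto
      then show ?thesis using has_LimI[OF tendsto_box_sum_2 rows_cols_2] r by simp
    qed
    moreover from this have "calG r k x y z \<omega>1 \<omega>2 = ?L"
      using has_iterated_limit_lim False by (auto simp: calG_def has_Lim_def)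
    ultimately show ?thesis by simp
  qed
  then show "coef (k - 1) = - cc * calG r k x y z \<omega>1 \<omega>2"
    and "\<not> abs_case k z \<Longrightarrow> has_Lim (box_sum r k x y z \<omega>1 \<omega>2) (calG r k x y z \<omega>1 \<omega>2)"
    using cc_nz by auto
qed

end

text \<open>Between z = 0 and z = 1 the shift z - 1/2 changes sign, which the reflection of (m, n)
  compensates. The sign (-1)^r comes from sinh being odd, (-1)^k from the denominator.\<close>

lemma termT_reflect:
  "termT r k 0 0 1 \<omega>1 \<omega>2 m n = (-1) ^ (r + k) * termT r k 0 0 0 \<omega>1 \<omega>2 (- m) (- n)"
proof -
  let ?w = "of_int m * of_real pi * \<i> / (\<omega>2 / \<omega>1)"
  have pw: "(- 1) powi (int r * - n) = ((- 1) powi (int r * n) :: complex)"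
    by (simp only: mult_minus_right power_int_minus_one_minus)
  have sh: "sinh (of_int (- m) * of_real pi * \<i> / (\<omega>2 / \<omega>1)) ^ r = (-1) ^ r * sinh ?w ^ r"
  proof -
    have e: "of_int (- m) * of_real pi * \<i> / (\<omega>2 / \<omega>1) = - ?w" by simp
    show ?thesis unfolding e sinh_minus by (rule power_minus)
  qed
  have d: "(of_int (- m) * \<omega>1 + of_int (- n) * \<omega>2) ^ k = (-1) ^ k * (of_int m * \<omega>1 + of_int n * \<omega>2) ^ k"
  proof -
    have "of_int (- m) * \<omega>1 + of_int (- n) * \<omega>2 = - (of_int m * \<omega>1 + of_int n * \<omega>2)" by simp
    then show ?thesis by (simp only: power_minus[of "of_int m * \<omega>1 + of_int n * \<omega>2"])
  qed
  show ?thesis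
    unfolding termT_def Let_def pw sh d
    by (simp add: power_add divide_simps) (simp add: algebra_simps)
qed

section \<open>The point (0, 0, 1) and the assembly\<close>

context period_pair
begin

lemma
  assumes r: "r \<ge> 1" and xy: "good x y" and z: "0 \<le> z" "z \<le> 1"
  shows meromorphic_frakK: "(\<lambda>\<xi>. frakK r \<xi> x y z \<omega>1 \<omega>2) meromorphic_on UNIV"
    and analytic_frakK_ext: "frakK_ext r x y z \<omega>1 \<omega>2 analytic_on {0}"
    and calK_eq_calG: "\<And>k. k \<ge> 1 \<Longrightarrow> k = 2 \<and> z \<in> {0, 1} \<longrightarrow> (x, y) \<noteq> (0, 0) \<Longrightarrow>
      k = 1 \<longrightarrow> 0 < z \<and> z < 1 \<and> y + real r * z \<notin> \<int> \<Longrightarrow>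
      calK k r x y z \<omega>1 \<omega>2 = - fact k * (of_real pi * \<i> / \<omega>2) ^ r * calG r k x y z \<omega>1 \<omega>2"
    and has_Lim_box_sum: "\<And>k. k \<ge> 1 \<Longrightarrow> k = 2 \<and> z \<in> {0, 1} \<longrightarrow> (x, y) \<noteq> (0, 0) \<Longrightarrow>
      k = 1 \<longrightarrow> 0 < z \<and> z < 1 \<and> y + real r * z \<notin> \<int> \<Longrightarrow> \<not> abs_case k z \<Longrightarrow>
      has_Lim (box_sum r k x y z \<omega>1 \<omega>2) (calG r k x y z \<omega>1 \<omega>2)"
proof -
  let ?K = "\<lambda>\<xi>. frakK r \<xi> x y z \<omega>1 \<omega>2"
  let ?cc = "(of_real pi * \<i> / \<omega>2) ^ r"
  \<comment> \<open>One case distinction serves all four claims. Regularity at 0 is phrased through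
    an analytic \<open>g\<close>, from which analyticity of \<open>frakK_ext\<close> follows by
    removing singularities.\<close>
  have main: "?K meromorphic_on UNIV \<and> (\<exists>g. g analytic_on {0} \<and> (\<forall>\<^sub>F \<xi> in at 0. ?K \<xi> = g \<xi>)) \<and>
      (\<forall>k\<ge>1. (k = 2 \<and> z \<in> {0, 1} \<longrightarrow> (x, y) \<noteq> (0, 0)) \<and>
         (k = 1 \<longrightarrow> 0 < z \<and> z < 1 \<and> y + real r * z \<notin> \<int>) \<longrightarrow>
         fps_nth (fps_expansion (remove_sings ?K) 0) (k - 1) = - ?cc * calG r k x y z \<omega>1 \<omega>2 \<and>
         (\<not> abs_case k z \<longrightarrow> has_Lim (box_sum r k x y z \<omega>1 \<omega>2) (calG r k x y z \<omega>1 \<omega>2)))"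
  proof (cases "(x, y, z) = (0, 0, 1)")
    case False
    interpret kernel \<omega>1 \<omega>2 r x y z by unfold_locales (use xy z in \<open>auto simp: good_def\<close>)
    have K: "frakK r \<xi> x y z \<omega>1 \<omega>2 = K \<xi>" for \<xi> using False by (auto simp: frakK_def K_def)
    obtain g where g: "g analytic_on {0}" "\<forall>\<^sub>F \<xi> in at 0. K \<xi> = g \<xi>" by (rule K_extends_0)
    show ?thesis
      unfolding K coef_def[symmetric] using meromorphic_K g coef_eq_calG[OF r] by blast
  next
    case True
    then have xyz0: "x = 0" "y = 0" "z = 1" by auto
    \<comment> \<open>here only \<open>k \<ge> 3\<close> is possible, and \<open>T\<close> at \<open>z = 1\<close> is a reflection of \<open>T\<close> at \<open>z = 0\<close>\<close>
    interpret kernel \<omega>1 \<omega>2 r 0 0 0 by unfold_locales (auto simp: good_def)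
    let ?s = "(-1) ^ (r + 1) :: complex"
    have K: "frakK r \<xi> x y z \<omega>1 \<omega>2 = ?s * K (- \<xi>)" for \<xi> by (simp add: frakK_def K_def xyz0)
    obtain g where g: "g analytic_on {0}" "\<forall>\<^sub>F \<xi> in at 0. K \<xi> = g \<xi>" "\<forall>\<^sub>F \<xi> in nhds 0. remove_sings K \<xi> = g \<xi>"
      by (rule K_ext_eq)
    have mero: "?K meromorphic_on UNIV"
      unfolding K by (intro meromorphic_intros meromorphic_on_compose[OF meromorphic_K] analytic_intros) auto
    have "(g \<circ> uminus) analytic_on {0}" using g(1) by (intro analytic_on_compose analytic_intros) auto
    then have an: "(\<lambda>\<xi>. ?s * g (- \<xi>)) analytic_on {0}" unfolding o_def by (intro analytic_intros)
    have "\<forall>\<^sub>F \<xi> in filtermap uminus (at 0). K \<xi> = g \<xi>" using g(2) by (simp add: filtermap_at_minus)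
    then have ev: "\<forall>\<^sub>F \<xi> in at 0. ?K \<xi> = ?s * g (- \<xi>)"
      unfolding K eventually_filtermap by eventually_elim simp
    have nth: "fps_nth (fps_expansion (remove_sings ?K) 0) n = ?s * (-1) ^ n * coef n" for n
    proof -
      have "fps_expansion (remove_sings ?K) 0 = fps_expansion (\<lambda>\<xi>. ?s * g (- \<xi>)) 0"
        by (rule fps_expansion_cong[OF remove_sings_eq_analytic_nhds[OF an ev]])
      moreover have "fps_expansion (remove_sings K) 0 = fps_expansion g 0"
        by (rule fps_expansion_cong[OF g(3)])
      moreover have "(deriv ^^ n) (\<lambda>\<xi>. ?s * g (- \<xi>)) 0 = ?s * ((-1) ^ n * (deriv ^^ n) g 0)"
      proof -
        obtain T where T: "open T" "0 \<in> T" "g holomorphic_on T" using g(1) by (auto simp: analytic_at)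
        have oT: "open (uminus ` T)" "0 \<in> uminus ` T" using T by (auto simp: open_negations intro: image_eqI[of _ _ 0])
        have "(deriv ^^ n) (\<lambda>w. g ((-1) * w)) 0 = (-1) ^ n * (deriv ^^ n) g ((-1) * 0)"
          by (rule higher_deriv_compose_linear[OF T(3) oT(1) T(1) oT(2)]) auto
        moreover have hol: "(\<lambda>\<xi>. g (- \<xi>)) holomorphic_on uminus ` T"
          by (rule holomorphic_on_compose_gen[of uminus _ g T, unfolded o_def])
            (use T(3) in \<open>auto intro!: holomorphic_intros\<close>)
        ultimately show ?thesis unfolding higher_deriv_cmult[OF hol oT(2,1)] by simp
      qed
      ultimately show ?thesis by (simp add: coef_def fps_expansion_def)
    qed
    have G: "calG r k 0 0 1 \<omega>1 \<omega>2 = (-1) ^ (r + k) * calG r k 0 0 0 \<omega>1 \<omega>2" if "k \<ge> 3" for k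
    proof -
      have "calG r k 0 0 1 \<omega>1 \<omega>2 = (\<Sum>\<^sub>\<infinity>mn\<in>index_set. (-1) ^ (r + k) * (case mn of (m, n) \<Rightarrow> termT r k 0 0 0 \<omega>1 \<omega>2 (- m) (- n)))"
        using that by (simp add: calG_def abs_case_def termT_reflect case_prod_unfold)
      also have "\<dots> = (-1) ^ (r + k) * (\<Sum>\<^sub>\<infinity>mn\<in>index_set. case mn of (m, n) \<Rightarrow> termT r k 0 0 0 \<omega>1 \<omega>2 (- m) (- n))"
        by (rule infsum_cmult_right')
      also have "(\<Sum>\<^sub>\<infinity>mn\<in>index_set. case mn of (m, n) \<Rightarrow> termT r k 0 0 0 \<omega>1 \<omega>2 (- m) (- n)) =
          (\<Sum>\<^sub>\<infinity>mn\<in>index_set. (\<lambda>(m, n). termT r k 0 0 0 \<omega>1 \<omega>2 m n) ((\<lambda>(m, n). (- m, - n)) mn))"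
        by (simp add: case_prod_unfold)
      also have "\<dots> = (\<Sum>\<^sub>\<infinity>mn\<in>index_set. (\<lambda>(m, n). termT r k 0 0 0 \<omega>1 \<omega>2 m n) mn)"
        by (rule infsum_reindex_bij_betw, rule bij_betwI[where g = "\<lambda>(m, n). (- m, - n)"]) (auto simp: index_set_def)
      finally show ?thesis using that by (simp add: calG_def abs_case_def)
    qed
    show ?thesis
    proof (intro conjI)
      show "\<exists>g. g analytic_on {0} \<and> (\<forall>\<^sub>F \<xi> in at 0. ?K \<xi> = g \<xi>)" using an ev by blast
      show "\<forall>k\<ge>1. (k = 2 \<and> z \<in> {0, 1} \<longrightarrow> (x, y) \<noteq> (0, 0)) \<and>
         (k = 1 \<longrightarrow> 0 < z \<and> z < 1 \<and> y + real r * z \<notin> \<int>) \<longrightarrow>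
         fps_nth (fps_expansion (remove_sings ?K) 0) (k - 1) = - ?cc * calG r k x y z \<omega>1 \<omega>2 \<and>
         (\<not> abs_case k z \<longrightarrow> has_Lim (box_sum r k x y z \<omega>1 \<omega>2) (calG r k x y z \<omega>1 \<omega>2))"
      proof (intro allI impI)
        fix k :: nat
        assume "1 \<le> k" and "(k = 2 \<and> z \<in> {0, 1} \<longrightarrow> (x, y) \<noteq> (0, 0)) \<and>
          (k = 1 \<longrightarrow> 0 < z \<and> z < 1 \<and> y + real r * z \<notin> \<int>)"
        then have k: "k \<ge> 3" using xyz0 by (cases "k = 1"; cases "k = 2") auto
        \<comment> \<open>The sign (-1)^(r + 1) of the reflected definition and the sign (-1)^(k -
          1) that the Taylor coefficient acquires under \<xi> to -\<xi> combine to the sign in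
          \<open>termT_reflect\<close>.\<close>
        have "(r + 1) + (k - 1) = r + k" using k by simp
        then have "?s * (-1) ^ (k - 1) = (-1) ^ (r + k)" by (simp only: power_add[symmetric])
        moreover have "coef (k - 1) = - ?cc * calG r k 0 0 0 \<omega>1 \<omega>2"
          by (rule coef_eq_calG(1)[OF r]) (use k in auto)
        ultimately have "fps_nth (fps_expansion (remove_sings ?K) 0) (k - 1) = (-1) ^ (r + k) * (- ?cc * calG r k 0 0 0 \<omega>1 \<omega>2)"
          unfolding nth by simp
        also have "\<dots> = - ?cc * calG r k x y z \<omega>1 \<omega>2" unfolding xyz0 G[OF k] by simp
        finally have "fps_nth (fps_expansion (remove_sings ?K) 0) (k - 1) = - ?cc * calG r k x y z \<omega>1 \<omega>2" .
        moreover have "abs_case k z" using k by (simp add: abs_case_def)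
        ultimately show "fps_nth (fps_expansion (remove_sings ?K) 0) (k - 1) = - ?cc * calG r k x y z \<omega>1 \<omega>2 \<and>
          (\<not> abs_case k z \<longrightarrow> has_Lim (box_sum r k x y z \<omega>1 \<omega>2) (calG r k x y z \<omega>1 \<omega>2))" by simp
      qed
    qed (fact mero)
  qed
  then obtain g where g: "g analytic_on {0}" "\<forall>\<^sub>F \<xi> in at 0. ?K \<xi> = g \<xi>" by blast
  show "frakK_ext r x y z \<omega>1 \<omega>2 analytic_on {0}"
    unfolding frakK_ext_def using analytic_at_cong[OF remove_sings_eq_analytic_nhds[OF g] refl] g(1) by simp
  show "?K meromorphic_on UNIV" using main by blast
  fix k :: nat
  assume k: "k \<ge> 1" "k = 2 \<and> z \<in> {0, 1} \<longrightarrow> (x, y) \<noteq> (0, 0)"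
    "k = 1 \<longrightarrow> 0 < z \<and> z < 1 \<and> y + real r * z \<notin> \<int>"
  then have "fps_nth (fps_expansion (remove_sings ?K) 0) (k - 1) = - ?cc * calG r k x y z \<omega>1 \<omega>2"
    using main by blast
  then show "calK k r x y z \<omega>1 \<omega>2 = - fact k * ?cc * calG r k x y z \<omega>1 \<omega>2"
    by (simp add: calK_def frakK_ext_def)
  show "has_Lim (box_sum r k x y z \<omega>1 \<omega>2) (calG r k x y z \<omega>1 \<omega>2)" if "\<not> abs_case k z"
    using main k that by blast
qed

end

text \<open>For k = 2 uniformity is asserted for z in closed subintervals of (0, 1), because the
  decay rate in m, proportional to min(z, 1 - z), degenerates at both ends. Limits over finite
  subsets express that the order of summation is irrelevant.\<close>

theorem theorem3p1:
  fixes \<omega>1 \<omega>2 :: complex and r :: nat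
  assumes "\<omega>1 \<noteq> 0" and "\<omega>2 \<noteq> 0" and "Im (\<omega>2 / \<omega>1) > 0" and "r \<ge> 1"
  shows
    "(\<forall>x y z :: real. -1 < x \<and> x < 1 \<and> -1 < y \<and> y < 1 \<and> 0 \<le> z \<and> z \<le> 1 \<longrightarrow>
        (\<lambda>\<xi>. frakK r \<xi> x y z \<omega>1 \<omega>2) meromorphic_on UNIV \<and>
        frakK_ext r x y z \<omega>1 \<omega>2 analytic_on {0} \<and>
        frakK_ext r x y z \<omega>1 \<omega>2 has_fps_expansion
          Abs_fps (\<lambda>j. calK (j + 1) r x y z \<omega>1 \<omega>2 / fact (j + 1)) \<and>
        (\<forall>k\<ge>1.
           (k = 2 \<and> z \<in> {0, 1} \<longrightarrow> (x, y) \<noteq> (0, 0)) \<and>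
           (k = 1 \<longrightarrow> 0 < z \<and> z < 1 \<and> y + real r * z \<notin> \<int>) \<longrightarrow>
             calK k r x y z \<omega>1 \<omega>2
               = - fact k * (of_real pi * \<i> / \<omega>2) ^ r * calG r k x y z \<omega>1 \<omega>2 \<and>
             (abs_case k z \<longrightarrow>
                (\<lambda>(m, n). norm (termT r k x y z \<omega>1 \<omega>2 m n)) summable_on index_set) \<and>
             (\<not> abs_case k z \<longrightarrow>
                has_Lim (box_sum r k x y z \<omega>1 \<omega>2) (calG r k x y z \<omega>1 \<omega>2)))) \<and>
     (\<forall>k\<ge>3. uniform_limit ({-1<..<1} \<times> {-1<..<1} \<times> {0..1})
        (\<lambda>A (x, y, z). \<Sum>(m, n)\<in>A. termT r k x y z \<omega>1 \<omega>2 m n)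
        (\<lambda>(x, y, z). calG r k x y z \<omega>1 \<omega>2)
        (finite_subsets_at_top index_set)) \<and>
     (\<forall>a b :: real. 0 < a \<and> b < 1 \<longrightarrow> uniform_limit ({-1<..<1} \<times> {-1<..<1} \<times> {a..b})
        (\<lambda>A (x, y, z). \<Sum>(m, n)\<in>A. termT r 2 x y z \<omega>1 \<omega>2 m n)
        (\<lambda>(x, y, z). calG r 2 x y z \<omega>1 \<omega>2)
        (finite_subsets_at_top index_set))"
proof -
  interpret period_pair \<omega>1 \<omega>2 by unfold_locales (fact assms(3))
  note r = assms(4)
  show ?thesis
  proof (intro conjI allI impI, goal_cases)
    case (1 x y z)
    then show ?case by (intro meromorphic_frakK r) (auto simp: good_def)
  next
    case (2 x y z)
    then show ?case by (intro analytic_frakK_ext r) (auto simp: good_def)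
  next
    case (3 x y z)
    then have "frakK_ext r x y z \<omega>1 \<omega>2 analytic_on {0}"
      by (intro analytic_frakK_ext r) (auto simp: good_def)
    moreover have "Abs_fps (\<lambda>j. calK (j + 1) r x y z \<omega>1 \<omega>2 / fact (j + 1)) =
        fps_expansion (frakK_ext r x y z \<omega>1 \<omega>2) 0"
      by (rule fps_ext) (simp add: calK_def del: fact_Suc)
    ultimately show ?case using analytic_at_imp_has_fps_expansion_0 by simp
  next
    case (4 x y z k)
    then show ?case by (intro calK_eq_calG r) (auto simp: good_def)
  next
    case (5 x y z k)
    then show ?case using abs_summable_termT[OF r, of z k x y] by (simp add: case_prod_unfold)
  next
    case (6 x y z k)
    then show ?case by (intro has_Lim_box_sum r) (auto simp: good_def)
  next
    case (7 k)
    then show ?case by (intro uniform_limit_termT[OF r, of _ 0 0]) auto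
  next
    case (8 a b)
    then show ?case by (intro uniform_limit_termT[OF r, of _ a b]) auto
  qed
qed

end
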